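(* Let $\mathcal{SH}(\Lambda,\psi)=\{\psi_{j,k,m}: j\ge 0,\ k\in K_j,\ m\in\mathbb{Z}^2\}$ be a feasible shearlet system with sampling vector $c=(c_1,c_2)\in(\mathbb{R}^+)^2$ (see context), and let $L_{inf}$, $L_{sup}$ and $R(c)$ be the associated quantities defined in the context. If real numbers $\tilde L_{inf}$ and $\tilde L_{sup}$ are chosen such that $$R(c)<\tilde L_{inf}\le L_{inf}\qquad\text{and}\qquad L_{sup}\le \tilde L_{sup},$$ then $\mathcal{SH}(\Lambda,\psi)$ is a frame for $L^2(\mathcal{C})$ with frame bounds $A$ and $B$ satisfying $$\frac{1}{|\det M_c|}\bigl[\tilde L_{inf}-R(c)\bigr]\le A\le B\le \frac{1}{|\det M_c|}\bigl[\tilde L_{sup}+R(c)\bigr].$$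
   Context: Fourier transform: $\hat f(\xi)=\int_{\mathbb{R}^2} f(x)e^{-2\pi i\langle x,\xi\rangle}\,dx$ (extended to $L^2$). Matrices: for $a>0$, $s\in\mathbb{R}$, $c=(c_1,c_2)\in(\mathbb{R}^+)^2$, $A_a=\begin{pmatrix} a&0\\0&\sqrt a\end{pmatrix}$, $S_s=\begin{pmatrix}1&s\\0&1\end{pmatrix}$, $M_c=\begin{pmatrix}c_1&0\\0&c_2\end{pmatrix}$. Cone: $\mathcal{C}=\{(\xi_1,\xi_2)\in\mathbb{R}^2: |\xi_1|\ge 1,\ |\xi_2/\xi_1|\le 1\}$, and $L^2(\mathcal{C})=\{f\in L^2(\mathbb{R}^2):\operatorname{supp}\hat f\subseteq \mathcal{C}\}$. Feasible set of parameters: $\Lambda=\{(a_j,s_{j,k},t^c_{j,k,m}): j\ge 0,\ k\in K_j,\ m\in\mathbb{Z}^2\}$ with $K_j\subseteq\mathbb{Z}$, $0\in K_j$, such that: (1) $\{a_j\}_{j\ge0}\subset(0,1]$ is decreasing, and for each $\mu\in(0,1)$ there is a positive integer $p$ with $a_{j+p}/a_j<\mu$ for all $j\ge 0$; (2) $s_{j,k}=s_k\sqrt{a_j}$ for a real sequence $\{s_k\}_{k\in\mathbb{Z}}$ with $s_0=0$ and $|s_k|\le a_j^{-1/2}+1$ for all $j\ge 0$, $k\in K_j$; (3) for every $\gamma>1$ there is a constant $C(\gamma)<\infty$ with $$\sup_{x\in\mathbb{R}^2}\ \sum_{k\in\mathbb{Z}}\min\{1,|(S_{s_k}x)_2|\}\cdot\min\{1,|(S_{s_k}x)_1|^{-\gamma}\}\le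 C(\gamma);$$ (4) $t^c_{j,k,m}=S_{s_{j,k}}A_{a_j}M_c m$ for some $c=(c_1,c_2)\in(\mathbb{R}^+)^2$ (the sampling vector). Feasible shearlet: $\psi\in L^2(\mathbb{R}^2)$ for which there exist $\alpha>\gamma>3$ and $q>q'>0$, $q>r>0$ with $$|\hat\psi(\xi_1,\xi_2)|\le\min\{1,|q\xi_1|^{\alpha}\}\cdot\min\{1,|q'\xi_1|^{-\gamma}\}\cdot\min\{1,|r\xi_2|^{-\gamma}\}.$$ Feasible shearlet system: for $\Lambda$ a feasible set of parameters and $\psi$ a feasible shearlet, $$\mathcal{SH}(\Lambda,\psi)=\{\psi_{j,k,m}=a_j^{-3/4}\psi(S_{-s_k}A_{a_j^{-1}}\,\cdot\,-M_cm): j\ge0,\ k\in K_j,\ m\in\mathbb{Z}^2\}.$$ Associated quantities: for $\xi\in\mathcal{C}$, $\omega\in\mathbb{R}^2$, $$\Phi(\xi,\omega)=\sum_{j\ge0}\sum_{k\in K_j}|\hat\psi(S_{s_k}^TA_{a_j}\xi)|\,|\hat\psi(S_{s_k}^TA_{a_j}\xi+\omega)|,\qquad \Gamma(\omega)=\operatorname*{ess\,sup}_{\xi\in\mathcal{C}}\Phi(\xi,\omega),$$ $$L_{inf}=\operatorname*{ess\,inf}_{\xi\in\mathcal{C}}\Phi(\xi,0),\qquad L_{sup}=\operatorname*{ess\,sup}_{\xi\in\mathcal{C}}\Phi(\xi,0),\qquad R(c)=\sum_{m\in\mathbb{Z}^2\setminus\{0\}}\bigl[\Gamma(M_c^{-1}m)\,\Gamma(-M_c^{-1}m)\bigr]^{1/2}.$$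 Frame for $L^2(\mathcal{C})$ with (optimal) frame bounds $0<A\le B<\infty$: $A\|f\|_2^2\le\sum_{j,k,m}|\langle f,\psi_{j,k,m}\rangle|^2\le B\|f\|_2^2$ for all $f\in L^2(\mathcal{C})$ (the elements $\psi_{j,k,m}$ need not lie in $L^2(\mathcal{C})$; equivalently they are orthogonally projected onto it). *)

theory Defs
  imports "HOL-Probability.Essential_Supremum"
begin

section \<open>Square-integrable functions on the plane\<close>

text \<open>Elements of \<open>L2\<close> are Borel representatives of the almost-everywhere classes.\<close>

definition L2 :: "(real^2 \<Rightarrow> complex) set" where
  "L2 = {f \<in> borel_measurable lborel. integrable lborel (\<lambda>x. (norm (f x))\<^sup>2)}"

definition L2_norm :: "(real^2 \<Rightarrow> complex) \<Rightarrow> real" where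
  "L2_norm f = sqrt (LINT x|lborel. (norm (f x))\<^sup>2)"

definition L2_inner :: "(real^2 \<Rightarrow> complex) \<Rightarrow> (real^2 \<Rightarrow> complex) \<Rightarrow> complex" where
  "L2_inner f g = (LINT x|lborel. f x * cnj (g x))"

definition fourier_integral :: "(real^2 \<Rightarrow> complex) \<Rightarrow> real^2 \<Rightarrow> complex" where
  "fourier_integral f \<xi> = (LINT x|lborel. f x * cis (- 2 * pi * (x \<bullet> \<xi>)))"

text \<open>
  The extension to \<open>L2\<close> by density: \<open>g\<close> is a Fourier transform of \<open>f\<close> if it is the \<open>L2\<close>-limit of
  the Fourier integrals of some sequence in \<open>L1 \<inter> L2\<close> converging to \<open>f\<close> in \<open>L2\<close>. The distances are
  nonnegative Lebesgue integrals, so that nothing is hidden by the value 0 which the Bochner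
  integral assigns to functions that are not integrable.
\<close>

definition has_fourier_transform :: "(real^2 \<Rightarrow> complex) \<Rightarrow> (real^2 \<Rightarrow> complex) \<Rightarrow> bool" where
  "has_fourier_transform f g \<longleftrightarrow> f \<in> L2 \<and> g \<in> L2 \<and>
     (\<exists>F :: nat \<Rightarrow> real^2 \<Rightarrow> complex.
        (\<forall>n. F n \<in> L2 \<and> integrable lborel (F n)) \<and>
        (\<lambda>n. \<integral>\<^sup>+ x. ennreal ((norm (F n x - f x))\<^sup>2) \<partial>lborel) \<longlonglongrightarrow> 0 \<and>
        (\<lambda>n. \<integral>\<^sup>+ \<xi>. ennreal ((norm (fourier_integral (F n) \<xi> - g \<xi>))\<^sup>2) \<partial>lborel) \<longlonglongrightarrow> 0)"

text \<open>
  By Plancherel's theorem a Fourier transform exists for every function in \<open>L2\<close> and is unique up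
  to null sets; \<open>fourier\<close> picks a representative. Nothing below depends on the values on a null set.
\<close>

definition fourier :: "(real^2 \<Rightarrow> complex) \<Rightarrow> real^2 \<Rightarrow> complex" where
  "fourier f = (SOME g. has_fourier_transform f g)"


section \<open>The cone and the matrices\<close>

definition freq_cone :: "(real^2) set" where
  "freq_cone = {\<xi>. \<bar>\<xi>$1\<bar> \<ge> 1 \<and> \<bar>\<xi>$2 / \<xi>$1\<bar> \<le> 1}"

text \<open>
  Since the cone is closed, the essential support of the Fourier transform is contained in it iff
  the Fourier transform vanishes almost everywhere outside it.
\<close>

definition L2_cone :: "(real^2 \<Rightarrow> complex) set" where
  "L2_cone = {f \<in> L2. AE \<xi> in lborel. \<xi> \<notin> freq_cone \<longrightarrow> fourier f \<xi> = 0}"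

definition scaling_mat :: "real \<Rightarrow> real^2^2" where
  "scaling_mat a = vector [vector [a, 0], vector [0, sqrt a]]"

definition shear_mat :: "real \<Rightarrow> real^2^2" where
  "shear_mat s = vector [vector [1, s], vector [0, 1]]"

definition sampling_mat :: "real^2 \<Rightarrow> real^2^2" where
  "sampling_mat c = vector [vector [c$1, 0], vector [0, c$2]]"

definition int_vec :: "int^2 \<Rightarrow> real^2" where
  "int_vec m = (\<chi> i. real_of_int (m$i))"


section \<open>Feasible parameters and feasible shearlets\<close>

text \<open>
  \<open>decay \<gamma> t\<close> is \<open>min {1, |t|\<^sup>-\<^sup>\<gamma>}\<close>, where \<open>|t|\<^sup>-\<^sup>\<gamma> = \<infinity>\<close> at \<open>t = 0\<close>; the case distinction is needed
  because \<open>0 powr (- \<gamma>) = 0\<close>.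
\<close>

definition decay :: "real \<Rightarrow> real \<Rightarrow> real" where
  "decay \<gamma> t = (if t = 0 then 1 else min 1 (\<bar>t\<bar> powr (- \<gamma>)))"

definition shear_parameter :: "(nat \<Rightarrow> real) \<Rightarrow> (int \<Rightarrow> real) \<Rightarrow> nat \<Rightarrow> int \<Rightarrow> real" where
  "shear_parameter a s j k = s k * sqrt (a j)"

definition translation_parameter ::
    "(nat \<Rightarrow> real) \<Rightarrow> (int \<Rightarrow> real) \<Rightarrow> real^2 \<Rightarrow> nat \<Rightarrow> int \<Rightarrow> int^2 \<Rightarrow> real^2" where
  "translation_parameter a s c j k m =
     (shear_mat (shear_parameter a s j k) ** scaling_mat (a j) ** sampling_mat c) *v int_vec m"

text \<open>
  \<open>\<Lambda>\<close> is the set of parameters generated by the scales \<open>a\<close>, the index sets \<open>K\<close>, the shears \<open>s\<close> and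
  the sampling vector \<open>c\<close>. The sum over the shears is taken in \<open>[0, \<infinity>]\<close>.
\<close>

definition feasible_parameters ::
    "(real \<times> real \<times> (real^2)) set \<Rightarrow> (nat \<Rightarrow> real) \<Rightarrow> (nat \<Rightarrow> int set) \<Rightarrow> (int \<Rightarrow> real) \<Rightarrow> real^2 \<Rightarrow> bool"
  where
  "feasible_parameters \<Lambda> a K s c \<longleftrightarrow>
     \<Lambda> = {(a j, shear_parameter a s j k, translation_parameter a s c j k m) | j k m. k \<in> K j} \<and>
     (\<forall>j. 0 \<in> K j) \<and>
     (\<forall>j. 0 < a j \<and> a j \<le> 1) \<and> decseq a \<and>
     (\<forall>\<mu>. 0 < \<mu> \<and> \<mu> < 1 \<longrightarrow> (\<exists>p>0. \<forall>j. a (j + p) / a j < \<mu>)) \<and>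
     s 0 = 0 \<and>
     (\<forall>j. \<forall>k\<in>K j. \<bar>s k\<bar> \<le> a j powr (- 1 / 2) + 1) \<and>
     (\<forall>\<gamma>>1. \<exists>C :: real.
        (SUP x :: real^2. \<Sum>\<^sub>\<infinity>k\<in>UNIV.
           ennreal (min 1 \<bar>(shear_mat (s k) *v x)$2\<bar> * decay \<gamma> ((shear_mat (s k) *v x)$1)))
        \<le> ennreal C) \<and>
     c$1 > 0 \<and> c$2 > 0"

definition feasible_shearlet :: "(real^2 \<Rightarrow> complex) \<Rightarrow> bool" where
  "feasible_shearlet \<psi> \<longleftrightarrow> \<psi> \<in> L2 \<and>
     (\<exists>\<alpha> \<gamma> q q' r. \<alpha> > \<gamma> \<and> \<gamma> > 3 \<and> q > q' \<and> q' > 0 \<and> q > r \<and> r > 0 \<and>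
        (AE \<xi> in lborel. norm (fourier \<psi> \<xi>)
           \<le> min 1 (\<bar>q * \<xi>$1\<bar> powr \<alpha>) * decay \<gamma> (q' * \<xi>$1) * decay \<gamma> (r * \<xi>$2)))"

text \<open>The shearlet system as a family indexed by triples \<open>(j, k, m)\<close>.\<close>

definition shearlet_index :: "(nat \<Rightarrow> int set) \<Rightarrow> (nat \<times> int \<times> (int^2)) set" where
  "shearlet_index K = {(j, k, m). k \<in> K j}"

definition shearlet_system ::
    "(nat \<Rightarrow> real) \<Rightarrow> (int \<Rightarrow> real) \<Rightarrow> real^2 \<Rightarrow> (real^2 \<Rightarrow> complex) \<Rightarrow>
     nat \<times> int \<times> (int^2) \<Rightarrow> real^2 \<Rightarrow> complex" where
  "shearlet_system a s c \<psi> = (\<lambda>(j, k, m) x.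
     of_real (a j powr (- 3 / 4)) *
     \<psi> ((shear_mat (- s k) ** scaling_mat (inverse (a j))) *v x - sampling_mat c *v int_vec m))"


section \<open>The associated quantities\<close>

definition Phi ::
    "(nat \<Rightarrow> real) \<Rightarrow> (nat \<Rightarrow> int set) \<Rightarrow> (int \<Rightarrow> real) \<Rightarrow> (real^2 \<Rightarrow> complex) \<Rightarrow>
     real^2 \<Rightarrow> real^2 \<Rightarrow> ennreal" where
  "Phi a K s \<psi> \<xi> \<omega> = (\<Sum>\<^sub>\<infinity>j\<in>UNIV. \<Sum>\<^sub>\<infinity>k\<in>K j.
     ennreal (norm (fourier \<psi> ((transpose (shear_mat (s k)) ** scaling_mat (a j)) *v \<xi>)) *
              norm (fourier \<psi> ((transpose (shear_mat (s k)) ** scaling_mat (a j)) *v \<xi> + \<omega>))))"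

text \<open>The library has no essential infimum; this is the dual of \<^const>\<open>esssup\<close>.\<close>

definition essinf :: "'a measure \<Rightarrow> ('a \<Rightarrow> ennreal) \<Rightarrow> ennreal" where
  "essinf M f = (if f \<in> borel_measurable M then Liminf (ae_filter M) f else 0)"

abbreviation cone_measure :: "(real^2) measure" where
  "cone_measure \<equiv> restrict_space lborel freq_cone"

definition Gamma_sup ::
    "(nat \<Rightarrow> real) \<Rightarrow> (nat \<Rightarrow> int set) \<Rightarrow> (int \<Rightarrow> real) \<Rightarrow> (real^2 \<Rightarrow> complex) \<Rightarrow> real^2 \<Rightarrow> ennreal" where
  "Gamma_sup a K s \<psi> \<omega> = esssup cone_measure (\<lambda>\<xi>. Phi a K s \<psi> \<xi> \<omega>)"

definition L_inf ::
    "(nat \<Rightarrow> real) \<Rightarrow> (nat \<Rightarrow> int set) \<Rightarrow> (int \<Rightarrow> real) \<Rightarrow> (real^2 \<Rightarrow> complex) \<Rightarrow> ennreal" where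
  "L_inf a K s \<psi> = essinf cone_measure (\<lambda>\<xi>. Phi a K s \<psi> \<xi> 0)"

definition L_sup ::
    "(nat \<Rightarrow> real) \<Rightarrow> (nat \<Rightarrow> int set) \<Rightarrow> (int \<Rightarrow> real) \<Rightarrow> (real^2 \<Rightarrow> complex) \<Rightarrow> ennreal" where
  "L_sup a K s \<psi> = esssup cone_measure (\<lambda>\<xi>. Phi a K s \<psi> \<xi> 0)"

definition ennreal_sqrt :: "ennreal \<Rightarrow> ennreal" where
  "ennreal_sqrt x = (if x = \<infinity> then \<infinity> else ennreal (sqrt (enn2real x)))"

definition R_sum ::
    "(nat \<Rightarrow> real) \<Rightarrow> (nat \<Rightarrow> int set) \<Rightarrow> (int \<Rightarrow> real) \<Rightarrow> (real^2 \<Rightarrow> complex) \<Rightarrow> real^2 \<Rightarrow> ennreal" where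
  "R_sum a K s \<psi> c = (\<Sum>\<^sub>\<infinity>m\<in>UNIV - {0}.
     ennreal_sqrt (Gamma_sup a K s \<psi> (matrix_inv (sampling_mat c) *v int_vec m) *
                   Gamma_sup a K s \<psi> (- (matrix_inv (sampling_mat c) *v int_vec m))))"


section \<open>Frames\<close>

text \<open>
  The family \<open>\<phi>\<close> need not lie in the space \<open>H\<close>. The sums are taken in \<open>[0, \<infinity>]\<close>, so the upper bound
  includes their convergence.
\<close>

definition lower_frame_bound ::
    "(real^2 \<Rightarrow> complex) set \<Rightarrow> 'i set \<Rightarrow> ('i \<Rightarrow> real^2 \<Rightarrow> complex) \<Rightarrow> real \<Rightarrow> bool" where
  "lower_frame_bound H I \<phi> A \<longleftrightarrow> 0 < A \<and>
     (\<forall>f\<in>H. ennreal (A * (L2_norm f)\<^sup>2) \<le> (\<Sum>\<^sub>\<infinity>i\<in>I. ennreal ((norm (L2_inner f (\<phi> i)))\<^sup>2)))"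

definition upper_frame_bound ::
    "(real^2 \<Rightarrow> complex) set \<Rightarrow> 'i set \<Rightarrow> ('i \<Rightarrow> real^2 \<Rightarrow> complex) \<Rightarrow> real \<Rightarrow> bool" where
  "upper_frame_bound H I \<phi> B \<longleftrightarrow> 0 < B \<and>
     (\<forall>f\<in>H. (\<Sum>\<^sub>\<infinity>i\<in>I. ennreal ((norm (L2_inner f (\<phi> i)))\<^sup>2)) \<le> ennreal (B * (L2_norm f)\<^sup>2))"

definition is_frame_with_optimal_bounds ::
    "(real^2 \<Rightarrow> complex) set \<Rightarrow> 'i set \<Rightarrow> ('i \<Rightarrow> real^2 \<Rightarrow> complex) \<Rightarrow> real \<Rightarrow> real \<Rightarrow> bool" where
  "is_frame_with_optimal_bounds H I \<phi> A B \<longleftrightarrow>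
     lower_frame_bound H I \<phi> A \<and> (\<forall>A'. lower_frame_bound H I \<phi> A' \<longrightarrow> A' \<le> A) \<and>
     upper_frame_bound H I \<phi> B \<and> (\<forall>B'. upper_frame_bound H I \<phi> B' \<longrightarrow> B \<le> B')"

end

theory Submission
  imports Defs "HOL-Probability.Probability_Measure" "HOL-Analysis.Simplex_Content"
begin

text \<open>
  Write \<open>T = S\<^sub>s\<^sup>T A\<^sub>a\<close> for the matrix that belongs to a scale and a shear, \<open>M\<close> for the sampling matrix, and
  \<open>f\<hat>\<close>, \<open>\<psi>\<hat>\<close> for the Fourier transforms. By Parseval's formula and the substitution \<open>\<zeta> = M T \<xi>\<close>, the
  inner products of \<open>f\<close> with the translates of one dilated shearlet are, up to a factor, the Fourier
  coefficients of the periodization of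
  \<open>G(\<zeta>) = f\<hat>(T\<^sup>-\<^sup>1 M\<^sup>-\<^sup>1 \<zeta>) cnj (\<psi>\<hat>(M\<^sup>-\<^sup>1 \<zeta>))\<close> with respect to the integer lattice. The sum of their squares is the
  square of the \<open>L\<^sup>2\<close> norm of the periodization \<open>\<Sum> G(\<zeta> + n)\<close> on the unit square, and expanding
  \<open>|\<Sum> G(\<zeta> + n)|\<^sup>2\<close> gives the diagonal \<open>\<integral> |G|\<^sup>2\<close> and an error of size at most the overlap
  \<open>\<Sum>\<^bsub>l \<noteq> 0\<^esub> \<integral> |G(\<zeta>)| |G(\<zeta> + l)|\<close> (\<open>Fourier_coefficients_overlap\<close>, \<open>dilated_coefficients\<close>).

  Summed over scales and shears, the diagonal terms add up to \<open>\<integral> |f\<hat>(\<xi>)|\<^sup>2 \<Phi>(\<xi>, 0)\<close>, which lies between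
  \<open>L\<^sub>i\<^sub>n\<^sub>f \<parallel>f\<parallel>\<^sup>2\<close> and \<open>L\<^sub>s\<^sub>u\<^sub>p \<parallel>f\<parallel>\<^sup>2\<close> because \<open>f\<hat>\<close> vanishes outside the cone. The overlaps at the lattice
  point \<open>l\<close> add up to at most \<open>[\<Gamma>(\<omega>) \<Gamma>(-\<omega>)]\<^sup>1\<^sup>/\<^sup>2 \<parallel>f\<parallel>\<^sup>2\<close> with \<open>\<omega> = M\<^sup>-\<^sup>1 l\<close>, by the Cauchy-Schwarz inequality
  (\<open>total_overlap_le\<close>), hence altogether to at most \<open>R(c) \<parallel>f\<parallel>\<^sup>2\<close>. This gives the two inequalities of
  \<open>shearlet_frame_inequalities\<close>. The optimal bounds are the supremum of the lower and the infimum of the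
  upper bounds; that they are finite, positive and in the right order uses a nonzero function whose transform is
  supported in the cone (\<open>L2_cone_nontrivial\<close>).

  The required Fourier analysis is developed from Parseval's identity on the torus, which follows from the
  theorem of Stone and Weierstrass. The identity for periodizations, applied to \<open>F(x) e\<^sup>-\<^sup>2\<^sup>\<pi>\<^sup>i\<^sup>x\<^sup>\<theta>\<close>
  and integrated over \<open>\<theta>\<close>, yields Plancherel's theorem in the plane (\<open>Plancherel_bounded_support\<close>), first for functions
  with bounded support and then by completeness of \<open>L\<^sup>2\<close> for all square-integrable functions.

  Sums of nonnegative terms are treated as integrals with respect to counting measures, so that the
  interchange of sums and integrals is always an instance of the theorems of Tonelli and Fubini.
\<close>

section \<open>Square-integrable functions on a measure space\<close>

lemma borel_measurable_cnj[measurable]: "cnj \<in> borel_measurable borel"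
  by (intro borel_measurable_continuous_onI continuous_intros)

abbreviation abs_sq :: "complex \<Rightarrow> ennreal" where
  "abs_sq z \<equiv> ennreal ((norm z)\<^sup>2)"

definition sqnorm :: "'a measure \<Rightarrow> ('a \<Rightarrow> complex) \<Rightarrow> ennreal" where
  "sqnorm M f = (\<integral>\<^sup>+x. abs_sq (f x) \<partial>M)"

abbreviation L2_lim :: "'a measure \<Rightarrow> (nat \<Rightarrow> 'a \<Rightarrow> complex) \<Rightarrow> ('a \<Rightarrow> complex) \<Rightarrow> bool" where
  "L2_lim M F f \<equiv> (\<lambda>n. sqnorm M (\<lambda>x. F n x - f x)) \<longlonglongrightarrow> 0"

definition ip :: "'a measure \<Rightarrow> ('a \<Rightarrow> complex) \<Rightarrow> ('a \<Rightarrow> complex) \<Rightarrow> complex" where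
  "ip M f g = (LINT x|M. f x * cnj (g x))"

definition sq_integrable :: "'a measure \<Rightarrow> ('a \<Rightarrow> complex) \<Rightarrow> bool" where
  "sq_integrable M f \<longleftrightarrow> f \<in> borel_measurable M \<and> sqnorm M f < \<infinity>"

lemma sq_integrable_measurable[measurable_dest]: "sq_integrable M f \<Longrightarrow> f \<in> borel_measurable M"
  by (simp add: sq_integrable_def)

lemma sqnorm_finite: "sq_integrable M f \<Longrightarrow> sqnorm M f < \<infinity>"
  by (simp add: sq_integrable_def)

lemma sqnorm_cong_AE:
  assumes "AE x in M. f x = g x"
  shows "sqnorm M f = sqnorm M g"
  unfolding sqnorm_def by (rule nn_integral_cong_AE) (use assms in eventually_elim, simp)

lemma norm_add_sq_le: "(norm (a + b))\<^sup>2 \<le> 2 * (norm a)\<^sup>2 + 2 * (norm (b::complex))\<^sup>2"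
proof -
  have "(norm (a + b))\<^sup>2 \<le> (norm a + norm b)\<^sup>2"
    by (intro power_mono norm_triangle_ineq) auto
  also have "\<dots> \<le> 2 * (norm a)\<^sup>2 + 2 * (norm b)\<^sup>2"
    using sum_squares_bound[of "norm a" "norm b"] by (simp add: power2_sum)
  finally show ?thesis .
qed

lemma sqnorm_add_le:
  assumes [measurable]: "f \<in> borel_measurable M" "g \<in> borel_measurable M"
  shows "sqnorm M (\<lambda>x. f x + g x) \<le> 2 * sqnorm M f + 2 * sqnorm M g"
proof -
  have "sqnorm M (\<lambda>x. f x + g x) \<le> (\<integral>\<^sup>+x. 2 * abs_sq (f x) + 2 * abs_sq (g x) \<partial>M)"
    unfolding sqnorm_def
  proof (rule nn_integral_mono)
    fix x
    have "abs_sq (f x + g x) \<le> ennreal (2 * (norm (f x))\<^sup>2 + 2 * (norm (g x))\<^sup>2)"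
      by (intro ennreal_leI norm_add_sq_le)
    then show "abs_sq (f x + g x) \<le> 2 * abs_sq (f x) + 2 * abs_sq (g x)"
      by (simp add: ennreal_mult)
  qed
  also have "\<dots> = 2 * sqnorm M f + 2 * sqnorm M g"
    by (simp add: nn_integral_add nn_integral_cmult sqnorm_def)
  finally show ?thesis .
qed

lemma sqnorm_cmult:
  assumes [measurable]: "f \<in> borel_measurable M"
  shows "sqnorm M (\<lambda>x. c * f x) = abs_sq c * sqnorm M f"
  by (simp add: sqnorm_def norm_mult power_mult_distrib ennreal_mult nn_integral_cmult)

lemma sqnorm_minus_commute: "sqnorm M (\<lambda>x. f x - g x) = sqnorm M (\<lambda>x. g x - f x)"
  by (simp add: sqnorm_def norm_minus_commute)

lemma sqnorm_diff_le:
  assumes [measurable]: "f \<in> borel_measurable M" "g \<in> borel_measurable M" "h \<in> borel_measurable M"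
  shows "sqnorm M (\<lambda>x. f x - h x) \<le> 2 * sqnorm M (\<lambda>x. f x - g x) + 2 * sqnorm M (\<lambda>x. g x - h x)"
  using sqnorm_add_le[of "\<lambda>x. f x - g x" M "\<lambda>x. g x - h x"] by simp

lemma sq_integrable_add:
  assumes "sq_integrable M f" "sq_integrable M g"
  shows "sq_integrable M (\<lambda>x. f x + g x)"
proof -
  note [measurable] = assms[THEN sq_integrable_measurable]
  have "sqnorm M (\<lambda>x. f x + g x) \<le> 2 * sqnorm M f + 2 * sqnorm M g"
    by (rule sqnorm_add_le) auto
  also have "\<dots> < \<infinity>"
    using assms[THEN sqnorm_finite] by (simp add: ennreal_mult_less_top)
  finally show ?thesis by (simp add: sq_integrable_def)
qed

lemma sq_integrable_cmult:
  assumes "sq_integrable M f"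
  shows "sq_integrable M (\<lambda>x. c * f x)"
proof -
  note [measurable] = assms[THEN sq_integrable_measurable]
  show ?thesis
    using assms[THEN sqnorm_finite] by (simp add: sq_integrable_def sqnorm_cmult ennreal_mult_less_top)
qed

lemma sq_integrable_diff:
  assumes "sq_integrable M f" "sq_integrable M g"
  shows "sq_integrable M (\<lambda>x. f x - g x)"
  using sq_integrable_add[OF assms(1) sq_integrable_cmult[OF assms(2), of "-1"]] by simp

lemma sq_integrable_sum:
  assumes "\<And>i. i \<in> I \<Longrightarrow> sq_integrable M (f i)"
  shows "sq_integrable M (\<lambda>x. \<Sum>i\<in>I. f i x)"
  using assms
proof (induction I rule: infinite_finite_induct)
  case (insert i I)
  then show ?case by (simp add: sq_integrable_add)
qed (auto simp: sq_integrable_def sqnorm_def)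

lemma sq_integrable_bounded_mult:
  assumes "sq_integrable M f" and [measurable]: "g \<in> borel_measurable M" and "\<And>x. norm (g x) \<le> 1"
  shows "sq_integrable M (\<lambda>x. g x * f x)"
proof -
  note [measurable] = assms(1)[THEN sq_integrable_measurable]
  have "sqnorm M (\<lambda>x. g x * f x) \<le> sqnorm M f"
    unfolding sqnorm_def
    by (intro nn_integral_mono ennreal_leI power_mono) (auto simp: norm_mult mult_left_le_one_le assms)
  then show ?thesis using assms(1) by (auto simp: sq_integrable_def intro: le_less_trans)
qed

text \<open>
  The Cauchy-Schwarz inequality, in a form that also says that the product of two
  square-integrable functions is integrable.
\<close>

lemma nn_integral_mult_le:
  assumes [measurable]: "f \<in> borel_measurable M" "g \<in> borel_measurable M"
  shows "(\<integral>\<^sup>+x. ennreal (norm (f x * cnj (g x))) \<partial>M)\<^sup>2 \<le> sqnorm M f * sqnorm M g"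
  using Cauchy_Schwarz_nn_integral[of "\<lambda>x. ennreal (norm (f x))" M "\<lambda>x. ennreal (norm (g x))"]
  by (simp add: sqnorm_def norm_mult ennreal_mult ennreal_power)

lemma ennreal_square_finite: "(x::ennreal)\<^sup>2 < \<infinity> \<Longrightarrow> x < \<infinity>"
  by (cases x) (auto simp: power2_eq_square ennreal_top_mult)

lemma integrable_ip:
  assumes "sq_integrable M f" "sq_integrable M g"
  shows "integrable M (\<lambda>x. f x * cnj (g x))"
proof -
  note [measurable] = assms[THEN sq_integrable_measurable]
  have "(\<integral>\<^sup>+x. ennreal (norm (f x * cnj (g x))) \<partial>M)\<^sup>2 < \<infinity>"
    using assms[THEN sqnorm_finite]
    by (intro le_less_trans[OF nn_integral_mult_le]) (auto simp: ennreal_mult_less_top)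
  from ennreal_square_finite[OF this] show ?thesis
    by (intro integrableI_bounded) auto
qed

lemma norm_ip_le:
  assumes "sq_integrable M f" "sq_integrable M g"
  shows "norm (ip M f g) \<le> sqrt (enn2real (sqnorm M f)) * sqrt (enn2real (sqnorm M g))"
proof -
  note [measurable] = assms[THEN sq_integrable_measurable]
  have "(ennreal (norm (ip M f g)))\<^sup>2 \<le> (\<integral>\<^sup>+x. ennreal (norm (f x * cnj (g x))) \<partial>M)\<^sup>2"
    unfolding ip_def by (intro power_mono integral_norm_bound_ennreal integrable_ip assms) auto
  also have "\<dots> \<le> sqnorm M f * sqnorm M g"
    by (rule nn_integral_mult_le) auto
  also have "\<dots> = ennreal (enn2real (sqnorm M f) * enn2real (sqnorm M g))"
    using assms[THEN sqnorm_finite] by (simp add: ennreal_mult)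
  finally have "(norm (ip M f g))\<^sup>2 \<le> enn2real (sqnorm M f) * enn2real (sqnorm M g)"
    by (simp add: ennreal_power)
  then show ?thesis
    by (simp add: real_le_rsqrt flip: real_sqrt_mult)
qed

lemma ip_add_left:
  assumes "sq_integrable M f" "sq_integrable M g" "sq_integrable M h"
  shows "ip M (\<lambda>x. f x + g x) h = ip M f h + ip M g h"
  unfolding ip_def
  by (subst Bochner_Integration.integral_add[symmetric]) (auto intro!: integrable_ip assms simp: algebra_simps)

lemma ip_diff_left:
  assumes "sq_integrable M f" "sq_integrable M g" "sq_integrable M h"
  shows "ip M (\<lambda>x. f x - g x) h = ip M f h - ip M g h"
  unfolding ip_def
  by (subst Bochner_Integration.integral_diff[symmetric]) (auto intro!: integrable_ip assms simp: algebra_simps)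

lemma ip_cmult_left: "ip M (\<lambda>x. c * f x) h = c * ip M f h"
  unfolding ip_def by (simp add: mult.assoc)

lemma ip_commute: "ip M g f = cnj (ip M f g)"
  unfolding ip_def by (simp add: mult.commute flip: Bochner_Integration.integral_cnj)

lemma ip_add_right:
  assumes "sq_integrable M f" "sq_integrable M g" "sq_integrable M h"
  shows "ip M h (\<lambda>x. f x + g x) = ip M h f + ip M h g"
  using arg_cong[OF ip_add_left[OF assms], of cnj] by (simp flip: ip_commute)

lemma ip_diff_right:
  assumes "sq_integrable M f" "sq_integrable M g" "sq_integrable M h"
  shows "ip M h (\<lambda>x. f x - g x) = ip M h f - ip M h g"
  using arg_cong[OF ip_diff_left[OF assms], of cnj] by (simp flip: ip_commute)

lemma ip_cmult_right: "ip M h (\<lambda>x. c * f x) = cnj c * ip M h f"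
  using arg_cong[OF ip_cmult_left[of M c f h], of cnj] by (simp flip: ip_commute)

lemma ip_sum_left:
  assumes "\<And>i. i \<in> I \<Longrightarrow> sq_integrable M (f i)" "sq_integrable M h"
  shows "ip M (\<lambda>x. \<Sum>i\<in>I. f i x) h = (\<Sum>i\<in>I. ip M (f i) h)"
  using assms
proof (induction I rule: infinite_finite_induct)
  case (insert i I)
  then show ?case by (simp add: ip_add_left sq_integrable_sum)
qed (auto simp: ip_def)

lemma ip_self:
  assumes "sq_integrable M f"
  shows "ip M f f = of_real (enn2real (sqnorm M f))"
proof -
  note [measurable] = assms[THEN sq_integrable_measurable]
  have "ip M f f = (LINT x|M. complex_of_real ((norm (f x))\<^sup>2))"
    unfolding ip_def by (simp only: complex_norm_square)
  also have "\<dots> = of_real (LINT x|M. (norm (f x))\<^sup>2)"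
    by (rule integral_complex_of_real)
  also have "(LINT x|M. (norm (f x))\<^sup>2) = enn2real (sqnorm M f)"
    unfolding sqnorm_def by (rule integral_eq_nn_integral) auto
  finally show ?thesis .
qed

lemma sqnorm_eq_ip: 
  assumes "sq_integrable M f"
  shows "sqnorm M f = ennreal (Re (ip M f f))"
  using sqnorm_finite[OF assms] by (simp add: ip_self[OF assms])

lemma sqnorm_add_eq:
  assumes "sq_integrable M f" "sq_integrable M g"
  shows "enn2real (sqnorm M (\<lambda>x. f x + g x)) =
    enn2real (sqnorm M f) + enn2real (sqnorm M g) + 2 * Re (ip M f g)"
proof -
  have fg: "sq_integrable M (\<lambda>x. f x + g x)" by (intro sq_integrable_add assms)
  have "ip M (\<lambda>x. f x + g x) (\<lambda>x. f x + g x) = ip M f f + ip M f g + (ip M g f + ip M g g)"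
    by (simp add: ip_add_left ip_add_right assms fg)
  from this[THEN arg_cong, of Re] show ?thesis
    by (simp add: ip_self[OF assms(1)] ip_self[OF assms(2)] ip_self[OF fg] ip_commute[of M g f])
qed

text \<open>
  Inner products can be recovered from norms, so an isometry preserves them. The two spaces may
  differ: for the Fourier transform they are position space and frequency space.
\<close>

lemma ip_polarization:
  assumes "sq_integrable M f" "sq_integrable M g" "sq_integrable N f'" "sq_integrable N g'"
    and "\<And>c. sqnorm M (\<lambda>x. f x + c * g x) = sqnorm N (\<lambda>x. f' x + c * g' x)"
    and "sqnorm M f = sqnorm N f'" "sqnorm M g = sqnorm N g'"
  shows "ip M f g = ip N f' g'"
proof -
  have *: "Re (cnj c * ip M f g) = Re (cnj c * ip N f' g')" for c
  proof -
    have [measurable]: "g \<in> borel_measurable M" "g' \<in> borel_measurable N"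
      using assms by (auto simp: sq_integrable_def)
    moreover have "sqnorm M (\<lambda>x. c * g x) = sqnorm N (\<lambda>x. c * g' x)"
      by (simp add: sqnorm_cmult assms(7))
    ultimately show ?thesis
      using sqnorm_add_eq[OF assms(1) sq_integrable_cmult[OF assms(2)], of c]
        sqnorm_add_eq[OF assms(3) sq_integrable_cmult[OF assms(4)], of c] assms(5)[of c] assms(6)
      by (simp add: ip_cmult_right)
  qed
  from *[of 1] *[of \<i>] show ?thesis by (simp add: complex_eq_iff)
qed

lemma tendsto_sqrt_sqnorm_0:
  assumes "(\<lambda>n. sqnorm M (f n)) \<longlonglongrightarrow> 0"
  shows "(\<lambda>n. sqrt (enn2real (sqnorm M (f n)))) \<longlonglongrightarrow> 0"
proof -
  have "(\<lambda>n. enn2real (sqnorm M (f n))) \<longlonglongrightarrow> 0"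
    by (rule tendsto_enn2real) (use assms in auto)
  from tendsto_real_sqrt[OF this] show ?thesis by simp
qed

lemma ip_tendsto:
  assumes F: "\<And>n. sq_integrable M (F n)" "sq_integrable M f" "L2_lim M F f"
    and G: "\<And>n. sq_integrable M (G n)" "sq_integrable M g" "L2_lim M G g"
  shows "(\<lambda>n. ip M (F n) (G n)) \<longlonglongrightarrow> ip M f g"
proof -
  define u where "u n = sqrt (enn2real (sqnorm M (\<lambda>x. F n x - f x)))" for n
  define v where "v n = sqrt (enn2real (sqnorm M (\<lambda>x. G n x - g x)))" for n
  define a where "a = sqrt (enn2real (sqnorm M f))"
  define b where "b = sqrt (enn2real (sqnorm M g))"
  have u: "u \<longlonglongrightarrow> 0" unfolding u_def by (rule tendsto_sqrt_sqnorm_0[OF F(3)])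
  have v: "v \<longlonglongrightarrow> 0" unfolding v_def by (rule tendsto_sqrt_sqnorm_0[OF G(3)])
  have le: "norm (ip M (F n) (G n) - ip M f g) \<le> u n * v n + u n * b + a * v n" for n
  proof -
    have dF: "sq_integrable M (\<lambda>x. F n x - f x)" and dG: "sq_integrable M (\<lambda>x. G n x - g x)"
      by (auto intro: sq_integrable_diff F G)
    have "ip M (F n) (G n) - ip M f g = ip M (\<lambda>x. F n x - f x) (G n) + ip M f (\<lambda>x. G n x - g x)"
      by (simp add: ip_diff_left ip_diff_right F G)
    also have "ip M (\<lambda>x. F n x - f x) (G n) =
        ip M (\<lambda>x. F n x - f x) (\<lambda>x. G n x - g x) + ip M (\<lambda>x. F n x - f x) g"
      by (simp add: ip_diff_right dF G)
    finally have "norm (ip M (F n) (G n) - ip M f g) \<le>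
        norm (ip M (\<lambda>x. F n x - f x) (\<lambda>x. G n x - g x)) + norm (ip M (\<lambda>x. F n x - f x) g)
        + norm (ip M f (\<lambda>x. G n x - g x))"
      by (simp only:) (rule norm_triangle_le, rule add_right_mono, rule norm_triangle_ineq)
    also have "\<dots> \<le> u n * v n + u n * b + a * v n"
      unfolding u_def v_def a_def b_def by (intro add_mono norm_ip_le dF dG F G)
    finally show ?thesis .
  qed
  have "(\<lambda>n. u n * v n + u n * b + a * v n) \<longlonglongrightarrow> 0 * 0 + 0 * b + a * 0"
    by (intro tendsto_intros u v)
  then have "(\<lambda>n. u n * v n + u n * b + a * v n) \<longlonglongrightarrow> 0" by simp
  with always_eventually[OF allI[OF le]] have "(\<lambda>n. ip M (F n) (G n) - ip M f g) \<longlonglongrightarrow> 0"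
    by (rule Lim_null_comparison)
  then show ?thesis by (rule LIM_zero_cancel)
qed

lemma sqnorm_tendsto:
  assumes F: "\<And>n. sq_integrable M (F n)" "sq_integrable M f" "L2_lim M F f"
  shows "(\<lambda>n. sqnorm M (F n)) \<longlonglongrightarrow> sqnorm M f"
  unfolding sqnorm_eq_ip[OF F(1)] sqnorm_eq_ip[OF F(2)]
  by (rule tendsto_ennrealI, rule tendsto_Re, rule ip_tendsto[OF F F])

lemma sqnorm_Fatou:
  assumes [measurable]: "\<And>n. F n \<in> borel_measurable M" "f \<in> borel_measurable M"
    and "AE x in M. (\<lambda>n. F n x) \<longlonglongrightarrow> f x" and "\<forall>\<^sub>F n in sequentially. sqnorm M (F n) \<le> e"
  shows "sqnorm M f \<le> e"
proof -
  have "sqnorm M f = (\<integral>\<^sup>+x. liminf (\<lambda>n. abs_sq (F n x)) \<partial>M)"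
    unfolding sqnorm_def
  proof (rule nn_integral_cong_AE)
    show "AE x in M. abs_sq (f x) = liminf (\<lambda>n. abs_sq (F n x))"
      using assms(3)
    proof eventually_elim
      case (elim x)
      have "(\<lambda>n. abs_sq (F n x)) \<longlonglongrightarrow> abs_sq (f x)"
        by (intro tendsto_ennrealI tendsto_intros elim)
      from lim_imp_Liminf[OF _ this] show ?case by simp
    qed
  qed
  also have "\<dots> \<le> liminf (\<lambda>n. sqnorm M (F n))"
    unfolding sqnorm_def by (rule nn_integral_liminf) auto
  also have "\<dots> \<le> limsup (\<lambda>n. sqnorm M (F n))"
    by (rule Liminf_le_Limsup) auto
  also have "\<dots> \<le> e"
    by (rule Limsup_bounded) (use assms in auto)
  finally show ?thesis .
qed

lemma sqnorm_dominated_tendsto: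
  assumes [measurable]: "\<And>n. F n \<in> borel_measurable M" "f \<in> borel_measurable M"
    and w: "sq_integrable M w"
    and b: "\<And>n x. norm (F n x) \<le> norm (w x)"
    and lim: "\<And>x. (\<lambda>n. F n x) \<longlonglongrightarrow> f x"
  shows "L2_lim M F f"
proof -
  note [measurable] = w[THEN sq_integrable_measurable]
  have "norm (f x) \<le> norm (w x)" for x
    by (rule LIMSEQ_le_const2[OF tendsto_norm[OF lim]]) (use b in auto)
  then have "norm (F n x - f x) \<le> 2 * norm (w x)" for n x
    using norm_triangle_ineq4[of "F n x" "f x"] b[of n x] by (smt (verit))
  then have le: "(norm (F n x - f x))\<^sup>2 \<le> (2 * norm (w x))\<^sup>2" for n x
    by (intro power_mono) auto
  have "(\<lambda>n. \<integral>\<^sup>+x. abs_sq (F n x - f x) \<partial>M) \<longlonglongrightarrow> (\<integral>\<^sup>+x. 0 \<partial>M)"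
  proof (rule nn_integral_dominated_convergence[where w = "\<lambda>x. ennreal ((2 * norm (w x))\<^sup>2)"])
    show "(\<integral>\<^sup>+x. ennreal ((2 * norm (w x))\<^sup>2) \<partial>M) < \<infinity>"
      using sqnorm_finite[OF w]
      by (simp add: power_mult_distrib ennreal_mult nn_integral_cmult sqnorm_def ennreal_mult_less_top)
    show "AE x in M. (\<lambda>n. abs_sq (F n x - f x)) \<longlonglongrightarrow> 0"
    proof (intro AE_I2)
      fix x
      have "(\<lambda>n. (norm (F n x - f x))\<^sup>2) \<longlonglongrightarrow> (norm (f x - f x))\<^sup>2"
        by (intro tendsto_intros lim)
      from tendsto_ennrealI[OF this] show "(\<lambda>n. abs_sq (F n x - f x)) \<longlonglongrightarrow> 0" by simp
    qed
  qed (use le in \<open>auto intro!: ennreal_leI AE_I2\<close>)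
  then show ?thesis by (simp add: sqnorm_def)
qed

text \<open>
  Riesz and Fischer: along a subsequence with \<open>\<parallel>g\<^sub>k\<^sub>+\<^sub>1 - g\<^sub>k\<parallel>\<^sup>2 \<le> 8\<^sup>-\<^sup>k\<close> the weighted sum
  \<open>\<Sum> 2\<^sup>k |g\<^sub>k\<^sub>+\<^sub>1 - g\<^sub>k|\<^sup>2\<close> is finite almost everywhere, and by the inequality between the
  arithmetic and the geometric mean it controls \<open>\<Sum> |g\<^sub>k\<^sub>+\<^sub>1 - g\<^sub>k|\<close>. The pointwise limit obtained in
  this way is the limit in \<open>L\<^sup>2\<close> by Fatou's lemma.
\<close>

lemma sqnorm_complete:
  fixes g :: "nat \<Rightarrow> 'a \<Rightarrow> complex"
  assumes [measurable]: "\<And>n. g n \<in> borel_measurable M"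
    and Cauchy: "\<And>e::real. e > 0 \<Longrightarrow> \<exists>N. \<forall>m\<ge>N. \<forall>n\<ge>N. sqnorm M (\<lambda>x. g m x - g n x) \<le> ennreal e"
  shows "\<exists>h\<in>borel_measurable M. L2_lim M g h"
proof -
  have "\<exists>N. \<forall>m\<ge>N. \<forall>n\<ge>N. sqnorm M (\<lambda>x. g m x - g n x) \<le> ennreal ((1/8)^k)" for k :: nat
    by (rule Cauchy) simp
  then obtain N where N: "\<And>k m n. m \<ge> N k \<Longrightarrow> n \<ge> N k \<Longrightarrow>
      sqnorm M (\<lambda>x. g m x - g n x) \<le> ennreal ((1/8)^k)"
    by metis
  \<comment> \<open>a strictly increasing sequence of indices with \<open>r k \<ge> N k\<close>\<close>
  define r where "r k = k + (\<Sum>i\<le>k. N i)" for k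
  have r: "r (Suc k) > r k" "r k \<ge> N k" "r k \<ge> k" for k
    by (auto simp: r_def intro: trans_le_add2 member_le_sum)
  define d where "d k x = g (r (Suc k)) x - g (r k) x" for k x
  have [measurable]: "d k \<in> borel_measurable M" for k
    unfolding d_def by measurable
  have d: "sqnorm M (d k) \<le> ennreal ((1/8)^k)" for k
    unfolding d_def by (rule N) (use r(1,2)[of k] in linarith)+
  have "(\<integral>\<^sup>+x. (\<Sum>k. ennreal (2^k * (norm (d k x))\<^sup>2)) \<partial>M) = (\<Sum>k. ennreal (2^k) * sqnorm M (d k))"
    by (simp add: nn_integral_suminf sqnorm_def ennreal_mult nn_integral_cmult)
  also have "\<dots> \<le> (\<Sum>k. ennreal ((1/4)^k))"
  proof (intro suminf_le summableI)
    fix k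
    have "ennreal (2^k) * sqnorm M (d k) \<le> ennreal (2^k) * ennreal ((1/8)^k)"
      by (intro mult_left_mono d) auto
    also have "\<dots> = ennreal (2^k * (1/8)^k)" by (simp add: ennreal_mult)
    also have "2^k * (1/8)^k = (1/4::real)^k" by (simp flip: power_mult_distrib)
    finally show "ennreal (2^k) * sqnorm M (d k) \<le> ennreal ((1/4)^k)" .
  qed
  also have "\<dots> = ennreal (\<Sum>k. (1/4)^k)"
    by (intro suminf_ennreal2 summable_geometric) auto
  also have "\<dots> < \<infinity>" by simp
  finally have "AE x in M. (\<Sum>k. ennreal (2^k * (norm (d k x))\<^sup>2)) \<noteq> \<infinity>"
    by (intro nn_integral_PInf_AE) auto
  then have conv: "AE x in M. convergent (\<lambda>k. g (r k) x)"
  proof eventually_elim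
    case (elim x)
    have "summable (\<lambda>k. 2^k * (norm (d k x))\<^sup>2)"
      by (rule summable_suminf_not_top) (use elim in auto)
    then have "summable (\<lambda>k. (1/2)^k + 2^k * (norm (d k x))\<^sup>2)"
      by (intro summable_add summable_geometric) auto
    then have "summable (\<lambda>k. norm (d k x))"
    proof (rule summable_comparison_test'[where N = 0])
      fix k :: nat
      have "2 * (sqrt ((1/2)^k) * (sqrt (2^k) * norm (d k x))) \<le> (sqrt ((1/2)^k))\<^sup>2 + (sqrt (2^k) * norm (d k x))\<^sup>2"
        using sum_squares_bound[of "sqrt ((1/2)^k)" "sqrt (2^k) * norm (d k x)"] by (simp add: mult.assoc)
      also have "\<dots> = (1/2)^k + 2^k * (norm (d k x))\<^sup>2"
        by (simp add: power_mult_distrib)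
      also have "sqrt ((1/2)^k) * (sqrt (2^k) * norm (d k x)) = norm (d k x)"
        by (simp add: real_sqrt_mult[symmetric] power_mult_distrib[symmetric] flip: mult.assoc)
      finally show "norm (norm (d k x)) \<le> (1/2)^k + 2^k * (norm (d k x))\<^sup>2"
        using norm_ge_zero[of "d k x"] by (simp only: real_norm_def abs_norm_cancel)
    qed
    then have "summable (\<lambda>k. d k x)" by (rule summable_norm_cancel)
    then have "convergent (\<lambda>n. \<Sum>k<n. d k x)" by (simp add: summable_iff_convergent)
    then have "convergent (\<lambda>n. g (r 0) x + (\<Sum>k<n. d k x))"
      by (intro convergent_add convergent_const)
    moreover have "g (r 0) x + (\<Sum>k<n. d k x) = g (r n) x" for n
      unfolding d_def by (subst sum_lessThan_telescope) simp
    ultimately show ?case by simp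
  qed
  define h where "h x = lim (\<lambda>k. g (r k) x)" for x
  have [measurable]: "h \<in> borel_measurable M"
    unfolding h_def by measurable
  from conv have lim: "AE x in M. (\<lambda>k. g (r k) x) \<longlonglongrightarrow> h x"
    by eventually_elim (simp add: h_def convergent_LIMSEQ_iff)
  have "L2_lim M g h"
  proof (rule order_tendstoI)
    fix e :: ennreal assume "0 < e"
    then obtain y where y: "0 < y" "y < e" using dense by blast
    then obtain e' :: real where e': "0 < e'" "ennreal e' < e"
      by (cases y) auto
    from Cauchy[OF e'(1)] obtain N where N: "\<And>m n. m \<ge> N \<Longrightarrow> n \<ge> N \<Longrightarrow> sqnorm M (\<lambda>x. g m x - g n x) \<le> ennreal e'"
      by blast
    have "sqnorm M (\<lambda>x. g n x - h x) \<le> ennreal e'" if "n \<ge> N" for n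
    proof (rule sqnorm_Fatou[where F = "\<lambda>k x. g n x - g (r k) x"])
      show "AE x in M. (\<lambda>k. g n x - g (r k) x) \<longlonglongrightarrow> g n x - h x"
        using lim by eventually_elim (intro tendsto_intros)
      show "\<forall>\<^sub>F k in sequentially. sqnorm M (\<lambda>x. g n x - g (r k) x) \<le> ennreal e'"
        using eventually_ge_at_top[of N]
        by eventually_elim (use r(3) that in \<open>auto intro!: N intro: order_trans\<close>)
    qed auto
    then show "\<forall>\<^sub>F n in sequentially. sqnorm M (\<lambda>x. g n x - h x) < e"
      using e'(2) by (auto simp: eventually_sequentially intro!: exI[of _ N] intro: le_less_trans)
  qed auto
  then show ?thesis by (intro bexI[of _ h]) auto
qed

section \<open>Tiling the plane by translates of the unit square\<close>

definition unit_square :: "(real^2) set" where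
  "unit_square = {x. \<forall>i. 0 \<le> x$i \<and> x$i < 1}"

text \<open>
  The torus is represented by Lebesgue measure on a fundamental domain. As a density on the whole plane it
  has the Borel sets of the plane as measurable sets, so that measurability in the plane carries over unchanged.
\<close>

definition torus :: "(real^2) measure" where
  "torus = density lborel (indicator unit_square)"

lemma unit_square_measurable[measurable]: "unit_square \<in> sets borel"
proof -
  have "unit_square = (\<Inter>i. {x. 0 \<le> x$i} \<inter> {x. x$i < 1})" by (auto simp: unit_square_def)
  also have "\<dots> \<in> sets borel"
    by (intro sets.countable_INT' sets.Int borel_closed borel_open closed_halfspace_component_ge_cart
        open_halfspace_component_lt_cart) auto
  finally show ?thesis .
qed

lemma sets_torus[measurable_cong, simp]: "sets torus = sets borel"
  by (simp add: torus_def)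

lemma space_torus[simp]: "space torus = UNIV"
  by (simp add: torus_def)

lemma borel_measurable_torus: "f \<in> borel_measurable borel \<Longrightarrow> f \<in> borel_measurable torus"
  by (simp add: measurable_cong_sets[OF sets_torus refl])

lemma nn_integral_torus:
  assumes [measurable]: "f \<in> borel_measurable borel"
  shows "(\<integral>\<^sup>+x. f x \<partial>torus) = (\<integral>\<^sup>+x. f x * indicator unit_square x \<partial>lborel)"
  unfolding torus_def by (subst nn_integral_density) (auto simp: mult.commute)

lemma integral_torus:
  fixes f :: "real^2 \<Rightarrow> complex"
  assumes [measurable]: "f \<in> borel_measurable borel"
  shows "(LINT x|torus. f x) = (LINT x|lborel. indicator unit_square x *\<^sub>R f x)"
proof -
  have eq: "torus = density lborel (\<lambda>x. ennreal (indicator unit_square x))"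
    unfolding torus_def by (rule arg_cong[where f = "density lborel"]) (auto simp: indicator_def fun_eq_iff)
  show ?thesis unfolding eq by (subst integral_density) auto
qed

lemma AE_torus: "(AE x in torus. P x) \<longleftrightarrow> (AE x in lborel. x \<in> unit_square \<longrightarrow> P x)"
  unfolding torus_def by (subst AE_density) (auto simp: indicator_def)

lemma emeasure_unit_square:
  "emeasure lborel (box 0 (1::real^2)) = 1" "emeasure lborel (cbox 0 (1::real^2)) = 1"
proof -
  have *: "0 \<bullet> b \<le> (1::real^2) \<bullet> b" "(1::real^2) \<bullet> b = 1" if "b \<in> Basis" for b
    using that by (auto simp: Basis_vec_def inner_axis)
  show "emeasure lborel (box 0 (1::real^2)) = 1" "emeasure lborel (cbox 0 (1::real^2)) = 1"
    by (simp_all add: *)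
qed

lemma box_subset_unit_square: "box 0 1 \<subseteq> unit_square" "unit_square \<subseteq> cbox 0 1"
  by (auto simp: unit_square_def mem_box_cart less_imp_le)

lemma AE_torus_box: "AE x in torus. x \<in> box 0 1"
proof -
  have "emeasure lborel (cbox 0 1 - box 0 (1::real^2)) = 1 - 1"
    by (subst emeasure_Diff) (auto simp: emeasure_unit_square box_subset_cbox)
  then have "AE x in lborel. x \<notin> cbox 0 1 - box 0 (1::real^2)"
    by (intro AE_not_in null_setsI) auto
  then show ?thesis unfolding AE_torus
    by eventually_elim (use box_subset_unit_square in auto)
qed

lemma emeasure_torus_UNIV: "emeasure torus UNIV = 1"
proof -
  have "emeasure torus UNIV = emeasure lborel unit_square"
    unfolding torus_def by (subst emeasure_density) auto
  also have "\<dots> = 1"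
  proof (rule antisym)
    show "emeasure lborel unit_square \<le> 1"
      using emeasure_mono[OF box_subset_unit_square(2), of lborel] by (simp add: emeasure_unit_square)
    show "1 \<le> emeasure lborel unit_square"
      using emeasure_mono[OF box_subset_unit_square(1), of lborel] by (simp add: emeasure_unit_square)
  qed
  finally show ?thesis .
qed

interpretation torus: prob_space torus
  by standard (simp add: emeasure_torus_UNIV)

lemma int_vec_simps[simp]: "int_vec 0 = 0" "int_vec (- m) = - int_vec m"
  "int_vec (m + n) = int_vec m + int_vec n" "int_vec (m - n) = int_vec m - int_vec n"
  by (auto simp: int_vec_def vec_eq_iff)

abbreviation Z2 :: "(int^2) measure" where
  "Z2 \<equiv> count_space UNIV"

lemma diff_int_vec_unit_square_iff: "x - int_vec n \<in> unit_square \<longleftrightarrow> n = (\<chi> i. \<lfloor>x$i\<rfloor>)"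
proof -
  have "x - int_vec n \<in> unit_square \<longleftrightarrow> (\<forall>i. \<lfloor>x$i\<rfloor> = n$i)"
    unfolding floor_eq_iff by (auto simp: unit_square_def int_vec_def algebra_simps)
  then show ?thesis by (auto simp: vec_eq_iff)
qed

lemma nn_integral_tiles: "(\<integral>\<^sup>+n. indicator unit_square (x - int_vec n) \<partial>Z2) = 1"
proof -
  have "(\<integral>\<^sup>+n. indicator unit_square (x - int_vec n) \<partial>Z2)
      = (\<integral>\<^sup>+n. indicator {\<chi> i. \<lfloor>x$i\<rfloor>} n \<partial>Z2)"
    by (intro nn_integral_cong) (simp add: indicator_def diff_int_vec_unit_square_iff)
  then show ?thesis by simp
qed

lemma nn_integral_translate:
  assumes [measurable]: "f \<in> borel_measurable borel"
  shows "(\<integral>\<^sup>+x. f (x + v) \<partial>lborel) = (\<integral>\<^sup>+x. f x \<partial>(lborel :: (real^2) measure))"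
proof -
  have "(\<integral>\<^sup>+x. f x \<partial>lborel) = (\<integral>\<^sup>+x. f x \<partial>distr lborel borel ((+) v))"
    by (simp add: lborel_distr_plus)
  also have "\<dots> = (\<integral>\<^sup>+x. f (x + v) \<partial>lborel)"
    by (subst nn_integral_distr) (auto simp: add.commute)
  finally show ?thesis by simp
qed

lemma nn_integral_tiling:
  assumes [measurable]: "h \<in> borel_measurable borel"
  shows "(\<integral>\<^sup>+x. h x \<partial>lborel) = (\<integral>\<^sup>+x. \<integral>\<^sup>+n. h (x + int_vec n) \<partial>Z2 \<partial>torus)"
proof -
  have "(\<integral>\<^sup>+x. h x \<partial>lborel) = (\<integral>\<^sup>+x. \<integral>\<^sup>+n. h x * indicator unit_square (x - int_vec n) \<partial>Z2 \<partial>lborel)"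
    by (simp add: nn_integral_cmult nn_integral_tiles)
  also have "\<dots> = (\<integral>\<^sup>+n. \<integral>\<^sup>+x. h x * indicator unit_square (x - int_vec n) \<partial>lborel \<partial>Z2)"
    by (rule nn_integral_count_space_nn_integral) auto
  also have "\<dots> = (\<integral>\<^sup>+n. \<integral>\<^sup>+x. h (x + int_vec n) * indicator unit_square x \<partial>lborel \<partial>Z2)"
  proof (rule nn_integral_cong)
    fix n
    show "(\<integral>\<^sup>+x. h x * indicator unit_square (x - int_vec n) \<partial>lborel) =
        (\<integral>\<^sup>+x. h (x + int_vec n) * indicator unit_square x \<partial>lborel)"
      by (subst nn_integral_translate[where v = "int_vec n", symmetric]) auto
  qed
  also have "\<dots> = (\<integral>\<^sup>+n. \<integral>\<^sup>+x. h (x + int_vec n) \<partial>torus \<partial>Z2)"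
    by (subst nn_integral_torus) auto
  also have "\<dots> = (\<integral>\<^sup>+x. \<integral>\<^sup>+n. h (x + int_vec n) \<partial>Z2 \<partial>torus)"
    by (rule nn_integral_count_space_nn_integral[symmetric]) auto
  finally show ?thesis .
qed

lemma sigma_finite_count_int: "sigma_finite_measure Z2"
  by (rule sigma_finite_measure_count_space)

interpretation torus_int: pair_sigma_finite torus "Z2"
  by (intro pair_sigma_finite.intro sigma_finite_count_int torus.sigma_finite_measure_axioms)

lemma measurable_add_int_vec[measurable]:
  "(\<lambda>p. fst p + int_vec (snd p)) \<in> borel_measurable (torus \<Otimes>\<^sub>M Z2)"
proof -
  have [measurable]: "int_vec \<in> measurable Z2 borel" by simp
  show ?thesis by measurable
qed

lemma borel_measurable_lattice_sum[measurable]: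
  fixes h :: "real^2 \<Rightarrow> ennreal"
  assumes [measurable]: "h \<in> borel_measurable borel"
  shows "(\<lambda>x. \<integral>\<^sup>+n. h (x + int_vec n) \<partial>Z2) \<in> borel_measurable borel"
proof -
  have "(\<lambda>p. h (fst p + int_vec (snd p))) \<in> borel_measurable (torus \<Otimes>\<^sub>M Z2)" by measurable
  from torus_int.M2.borel_measurable_nn_integral_fst[OF this] show ?thesis by simp
qed

text \<open>
  The plane is the product of the torus and the lattice. In this form the tiling also applies to
  complex-valued integrals, through Fubini's theorem for the product measure.
\<close>

lemma lborel_eq_distr_tiling:
  "lborel = distr (torus \<Otimes>\<^sub>M Z2) borel (\<lambda>p. fst p + int_vec (snd p))"
proof (rule measure_eqI)
  fix A :: "(real^2) set" assume "A \<in> sets lborel"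
  then have [measurable]: "A \<in> sets borel" by simp
  have "emeasure lborel A = (\<integral>\<^sup>+x. indicator A x \<partial>lborel)" by simp
  also have "\<dots> = (\<integral>\<^sup>+x. \<integral>\<^sup>+n. indicator A (x + int_vec n) \<partial>Z2 \<partial>torus)"
    by (rule nn_integral_tiling) auto
  also have "\<dots> = (\<integral>\<^sup>+p. indicator A (fst p + int_vec (snd p)) \<partial>(torus \<Otimes>\<^sub>M Z2))"
    by (subst torus_int.M2.nn_integral_fst[symmetric]) auto
  also have "\<dots> = (\<integral>\<^sup>+x. indicator A x \<partial>distr (torus \<Otimes>\<^sub>M Z2) borel (\<lambda>p. fst p + int_vec (snd p)))"
    by (subst nn_integral_distr) auto
  finally show "emeasure lborel A = emeasure (distr (torus \<Otimes>\<^sub>M Z2) borel (\<lambda>p. fst p + int_vec (snd p))) A"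
    by simp
qed simp

lemma integral_tiling:
  fixes G :: "real^2 \<Rightarrow> complex"
  assumes "integrable lborel G"
  shows "AE x in torus. integrable Z2 (\<lambda>n. G (x + int_vec n))"
    and "integrable torus (\<lambda>x. LINT n|Z2. G (x + int_vec n))"
    and "(LINT x|torus. LINT n|Z2. G (x + int_vec n)) = (LINT x|lborel. G x)"
proof -
  have [measurable]: "G \<in> borel_measurable borel" using assms by (auto dest: borel_measurable_integrable)
  have "integrable (torus \<Otimes>\<^sub>M Z2) (\<lambda>p. G (fst p + int_vec (snd p)))"
    using assms by (subst (asm) lborel_eq_distr_tiling, subst (asm) integrable_distr_eq) auto
  note * = torus_int.AE_integrable_fst'[OF this] torus_int.integrable_fst'[OF this] torus_int.integral_fst'[OF this]
  show "AE x in torus. integrable Z2 (\<lambda>n. G (x + int_vec n))"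
    "integrable torus (\<lambda>x. LINT n|Z2. G (x + int_vec n))"
    using *(1,2) by simp_all
  have "(LINT x|lborel. G x) = (LINT x|distr (torus \<Otimes>\<^sub>M Z2) borel (\<lambda>p. fst p + int_vec (snd p)). G x)"
    by (subst lborel_eq_distr_tiling) (rule refl)
  also have "\<dots> = (LINT p|(torus \<Otimes>\<^sub>M Z2). G (fst p + int_vec (snd p)))"
    by (subst integral_distr) auto
  finally show "(LINT x|torus. LINT n|Z2. G (x + int_vec n)) = (LINT x|lborel. G x)"
    using *(3) by simp
qed

section \<open>Characters of the torus\<close>

definition character :: "int^2 \<Rightarrow> real^2 \<Rightarrow> complex" where
  "character m x = cis (2 * pi * (x \<bullet> int_vec m))"

lemma continuous_on_character: "continuous_on A (character m)"
  unfolding character_def by (intro continuous_intros)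

lemma borel_measurable_character[measurable]: "character m \<in> borel_measurable borel"
  by (intro borel_measurable_continuous_onI continuous_on_character)

lemma norm_character[simp]: "norm (character m x) = 1"
  by (simp add: character_def)

lemma character_0[simp]: "character 0 x = 1" "character m 0 = 1"
  by (simp_all add: character_def)

lemma character_mult: "character m x * character n x = character (m + n) x"
  by (simp add: character_def cis_mult algebra_simps inner_add_right)

lemma cnj_character: "cnj (character m x) = character (- m) x"
  by (simp add: character_def cis_cnj)

lemma character_add: "character m (x + y) = character m x * character m y"
  by (simp add: character_def cis_mult algebra_simps inner_add_left)

lemma character_int_vec[simp]: "character m (int_vec n) = 1"
proof -
  have "int_vec n \<bullet> int_vec m \<in> \<int>" by (auto simp: inner_vec_def int_vec_def)
  then show ?thesis by (simp add: character_def)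
qed

lemma character_periodic[simp]: "character m (x + int_vec n) = character m x"
  by (simp add: character_add)

lemma sq_integrable_character: "sq_integrable torus (character m)"
  using torus.emeasure_space_1 by (simp add: sq_integrable_def sqnorm_def)

text \<open>
  The integral of a periodic function over a square does not change when the square is translated.
  A translation by half a period of a non-trivial character changes the sign of its integral.
\<close>

lemma integral_character: "(LINT x|torus. character m x) = (if m = 0 then 1 else 0)"
proof (cases "m = 0")
  case False
  then obtain i where i: "m$i \<noteq> 0" by (auto simp: vec_eq_iff)
  \<comment> \<open>half a period of the character in direction \<open>i\<close>\<close>
  define v where "v = axis i (1 / (2 * real_of_int (m$i)))"
  have v: "character m v = -1"
    using i by (simp add: character_def v_def inner_axis' int_vec_def)
  define G where "G x = character m x * of_real (indicator unit_square (x - v))" for x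
  have [measurable]: "G \<in> borel_measurable borel" unfolding G_def by measurable
  have "(\<integral>\<^sup>+x. ennreal (norm (G x)) \<partial>lborel) = (\<integral>\<^sup>+x. indicator unit_square (x + - v) \<partial>lborel)"
    by (intro nn_integral_cong) (auto simp: G_def norm_mult indicator_def)
  also have "\<dots> = emeasure torus UNIV"
    by (subst nn_integral_translate) (simp_all add: torus_def emeasure_density)
  finally have int: "integrable lborel G"
    by (intro integrableI_bounded) (auto simp: emeasure_torus_UNIV)
  have "(LINT x|lborel. G x) = (LINT x|distr lborel borel ((+) v). G x)"
    by (simp add: lborel_distr_plus)
  also have "\<dots> = (LINT x|lborel. G (v + x))"
    by (subst integral_distr) auto
  also have "\<dots> = (LINT x|lborel. indicator unit_square x *\<^sub>R (- character m x))"
    by (intro Bochner_Integration.integral_cong) (auto simp: G_def character_add v scaleR_conv_of_real)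
  also have "\<dots> = - (LINT x|torus. character m x)"
    by (simp add: integral_torus)
  finally have 1: "(LINT x|lborel. G x) = - (LINT x|torus. character m x)" .
  have "(LINT n|Z2. G (x + int_vec n)) = character m x" for x
  proof -
    have *: "G (x + int_vec n) = (if n = - (\<chi> i. \<lfloor>(x - v)$i\<rfloor>) then character m x else 0)" for n
    proof -
      have "x + int_vec n - v \<in> unit_square \<longleftrightarrow> (x - v) - int_vec (- n) \<in> unit_square"
        by (simp add: algebra_simps)
      also have "\<dots> \<longleftrightarrow> n = - (\<chi> i. \<lfloor>(x - v)$i\<rfloor>)"
        unfolding diff_int_vec_unit_square_iff by (metis minus_minus)
      finally show ?thesis by (auto simp only: G_def character_periodic indicator_def of_bool_def if_True if_False
            of_real_1 of_real_0 mult_1_right mult_zero_right split: if_splits)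
    qed
    show ?thesis
      by (subst lebesgue_integral_count_space_finite_support) (auto simp: * cong: conj_cong)
  qed
  with integral_tiling(3)[OF int] 1 show ?thesis
    using False by (simp add: eq_neg_iff_add_eq_0)
qed (use torus.prob_space in simp)

lemma ip_character: "ip torus (character m) (character n) = (if m = n then 1 else 0)"
  by (simp add: ip_def cnj_character character_mult integral_character)

lemma sqnorm_character_sum:
  assumes "finite S"
  shows "sqnorm torus (\<lambda>x. \<Sum>m\<in>S. c m * character m x) = ennreal (\<Sum>m\<in>S. (norm (c m))\<^sup>2)"
proof -
  have sq: "sq_integrable torus (\<lambda>x. c m * character m x)" for m
    by (intro sq_integrable_cmult sq_integrable_character)
  have sum: "sq_integrable torus (\<lambda>x. \<Sum>m\<in>S. c m * character m x)"
    by (intro sq_integrable_sum sq)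
  have "ip torus (\<lambda>x. \<Sum>m\<in>S. c m * character m x) (\<lambda>x. \<Sum>m\<in>S. c m * character m x)
      = (\<Sum>m\<in>S. c m * cnj (ip torus (\<lambda>x. \<Sum>m\<in>S. c m * character m x) (character m)))"
    by (subst ip_sum_left[OF sq sum]) (auto simp: ip_cmult_left ip_commute[of _ "character _"] intro!: sum.cong)
  also have "\<dots> = (\<Sum>m\<in>S. c m * cnj (c m))"
  proof (rule sum.cong[OF refl])
    fix m assume "m \<in> S"
    have "ip torus (\<lambda>x. \<Sum>m\<in>S. c m * character m x) (character m) = (\<Sum>n\<in>S. if n = m then c n else 0)"
      by (subst ip_sum_left[OF sq sq_integrable_character])
        (auto simp: ip_cmult_left ip_character intro!: sum.cong)
    also have "\<dots> = c m" using assms \<open>m \<in> S\<close> by simp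
    finally show "c m * cnj (ip torus (\<lambda>x. \<Sum>m\<in>S. c m * character m x) (character m)) = c m * cnj (c m)"
      by simp
  qed
  also have "\<dots> = of_real (\<Sum>m\<in>S. (norm (c m))\<^sup>2)"
    by (simp only: complex_norm_square of_real_sum)
  finally show ?thesis by (simp add: sqnorm_eq_ip[OF sum])
qed

section \<open>Density of the trigonometric polynomials and Parseval's identity\<close>

inductive trig_poly :: "(real^2 \<Rightarrow> complex) \<Rightarrow> bool" where
  trig_poly_character: "trig_poly (\<lambda>x. c * character m x)"
| trig_poly_add: "trig_poly p \<Longrightarrow> trig_poly q \<Longrightarrow> trig_poly (\<lambda>x. p x + q x)"

lemma trig_poly_const: "trig_poly (\<lambda>x. c)"
  using trig_poly_character[of c 0] by simp

lemma trig_poly_mult: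
  assumes "trig_poly p" "trig_poly q"
  shows "trig_poly (\<lambda>x. p x * q x)"
  using assms(1)
proof induction
  case (trig_poly_character c m)
  show ?case using assms(2)
  proof induction
    case (trig_poly_character d n)
    have "(\<lambda>x. c * character m x * (d * character n x)) = (\<lambda>x. (c * d) * character (m + n) x)"
      by (simp add: character_mult[symmetric] algebra_simps)
    then show ?case by (simp only: trig_poly.trig_poly_character)
  next
    case (trig_poly_add p q)
    then show ?case
      using trig_poly.trig_poly_add[of "\<lambda>x. c * character m x * p x" "\<lambda>x. c * character m x * q x"]
      by (simp add: distrib_left)
  qed
next
  case (trig_poly_add p1 p2)
  then show ?case
    using trig_poly.trig_poly_add[of "\<lambda>x. p1 x * q x" "\<lambda>x. p2 x * q x"] by (simp add: distrib_right)
qed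

lemma trig_poly_cmult: "trig_poly p \<Longrightarrow> trig_poly (\<lambda>x. c * p x)"
  by (intro trig_poly_mult trig_poly_const)

lemma trig_poly_coefficients:
  assumes "trig_poly p"
  obtains S c where "finite S" "p = (\<lambda>x. \<Sum>m\<in>S. c m * character m x)"
  using assms
proof (induction arbitrary: thesis)
  case (trig_poly_character c m)
  show ?case by (rule trig_poly_character[of "{m}" "\<lambda>_. c"]) auto
next
  case (trig_poly_add p q)
  obtain S c where S: "finite S" "p = (\<lambda>x. \<Sum>m\<in>S. c m * character m x)" by (rule trig_poly_add.IH(1))
  obtain T d where T: "finite T" "q = (\<lambda>x. \<Sum>m\<in>T. d m * character m x)" by (rule trig_poly_add.IH(2))
  define e where "e m = (if m \<in> S then c m else 0) + (if m \<in> T then d m else 0)" for m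
  show ?case
  proof (rule trig_poly_add.prems[of "S \<union> T" e])
    have "(\<Sum>m\<in>S. c m * character m x) = (\<Sum>m\<in>S \<union> T. (if m \<in> S then c m else 0) * character m x)" for x
      using S(1) T(1) by (intro sum.mono_neutral_cong_left) auto
    moreover have "(\<Sum>m\<in>T. d m * character m x) = (\<Sum>m\<in>S \<union> T. (if m \<in> T then d m else 0) * character m x)" for x
      using S(1) T(1) by (intro sum.mono_neutral_cong_left) auto
    ultimately show "(\<lambda>x. p x + q x) = (\<lambda>x. \<Sum>m\<in>S \<union> T. e m * character m x)"
      unfolding S(2) T(2) by (simp add: e_def distrib_right sum.distrib)
  qed (use S T in auto)
qed

lemma sq_integrable_trig_poly:
  assumes "trig_poly p"
  shows "sq_integrable torus p"
  using assms by induction (auto intro: sq_integrable_add sq_integrable_cmult sq_integrable_character)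

text \<open>
  A function on the plane that vanishes outside the open unit square induces a function on the
  torus, which is realized in \<open>\<complex>\<^sup>2\<close> as the image of the closed square under the exponential map \<open>E\<close>.
  The induced function is continuous because \<open>E\<close>, being defined on a compact set, is a quotient map.
\<close>

lemma trig_poly_uniform_approximation:
  fixes \<phi> :: "real^2 \<Rightarrow> real"
  assumes cont: "continuous_on UNIV \<phi>" and zero: "\<And>x. x \<notin> box 0 1 \<Longrightarrow> \<phi> x = 0" and "e > 0"
  obtains p where "trig_poly p" "\<And>x. x \<in> unit_square \<Longrightarrow> norm (of_real (\<phi> x) - p x) < e"
proof -
  define E :: "real^2 \<Rightarrow> complex^2" where "E x = (\<chi> i. cis (2 * pi * x$i))" for x
  define Q :: "(real^2) set" where "Q = cbox 0 1"
  have contE: "continuous_on Q E"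
    unfolding E_def by (intro continuous_intros)
  have compQ: "compact Q" by (simp add: Q_def compact_cbox)
  define \<Phi> where "\<Phi> z = \<phi> (inv_into Q E z)" for z
  have E_eq: "\<phi> x = \<phi> y" if "x \<in> Q" "y \<in> Q" "E x = E y" for x y
  proof (cases "x = y")
    case False
    then obtain i where i: "x$i \<noteq> y$i" by (auto simp: vec_eq_iff)
    from that(3) have "cis (2 * pi * x$i) = cis (2 * pi * y$i)"
      by (simp add: E_def vec_eq_iff)
    then have "sin (2 * pi * x$i) = sin (2 * pi * y$i) \<and> cos (2 * pi * x$i) = cos (2 * pi * y$i)"
      by (simp add: complex_eq_iff)
    then obtain n :: int where n: "2 * pi * x$i = 2 * pi * y$i + 2 * pi * n"
      unfolding sin_cos_eq_iff by blast
    have "2 * pi * x$i = 2 * pi * (y$i + real_of_int n)" using n by (simp add: algebra_simps)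
    then have xy: "x$i = y$i + real_of_int n" by simp
    have b: "0 \<le> x$i" "x$i \<le> 1" "0 \<le> y$i" "y$i \<le> 1"
      using that(1,2) by (auto simp: Q_def mem_box_cart)
    have "n = 1 \<or> n = -1" using xy b i by (cases "n \<ge> 2"; cases "n \<le> -2") auto
    then have "(x$i = 1 \<and> y$i = 0) \<or> (x$i = 0 \<and> y$i = 1)" using xy b by auto
    then have "x \<notin> box 0 1" "y \<notin> box 0 1" by (auto simp: mem_box_cart) (metis less_irrefl)+
    then show ?thesis by (simp add: zero)
  qed simp
  have \<Phi>E: "\<Phi> (E x) = \<phi> x" if "x \<in> Q" for x
    unfolding \<Phi>_def by (rule E_eq) (use that in \<open>auto intro: inv_into_into f_inv_into_f\<close>)
  have cont\<Phi>: "continuous_on (E ` Q) \<Phi>"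
    unfolding continuous_on_closed_vimage[OF compact_imp_closed[OF compact_continuous_image[OF contE compQ]]]
  proof safe
    fix C :: "real set" assume "closed C"
    have eq: "\<Phi> -` C \<inter> E ` Q = E ` (\<phi> -` C \<inter> Q)" using \<Phi>E by auto
    have "closed (\<phi> -` C)" using cont \<open>closed C\<close> by (auto simp: continuous_on_closed_vimage[OF closed_UNIV])
    then have "compact (\<phi> -` C \<inter> Q)" using compQ by (rule closed_Int_compact)
    moreover have "continuous_on (\<phi> -` C \<inter> Q) E" by (rule continuous_on_subset[OF contE]) auto
    ultimately show "closed (\<Phi> -` C \<inter> E ` Q)"
      unfolding eq by (intro compact_imp_closed compact_continuous_image)
  qed
  define R where "R = {g. continuous_on (E ` Q) g \<and> (\<exists>p. trig_poly p \<and> (\<forall>x. of_real (g (E x)) = p x))}"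
  have coord: "(\<lambda>z. Re (z$i)) \<in> R" "(\<lambda>z. Im (z$i)) \<in> R" for i
  proof -
    have ax: "character (axis i 1) x = cis (2 * pi * x$i)" "character (- axis i 1) x = cis (- (2 * pi * x$i))" for x
    proof -
      have "int_vec (axis i 1) = axis i 1" by (auto simp: int_vec_def axis_def vec_eq_iff)
      then show "character (axis i 1) x = cis (2 * pi * x$i)" "character (- axis i 1) x = cis (- (2 * pi * x$i))"
        by (simp_all add: character_def inner_axis)
    qed
    have "of_real (Re (E x $ i)) = (1/2) * character (axis i 1) x + (1/2) * character (- axis i 1) x" for x
      unfolding ax by (simp add: E_def complex_eq_iff)
    moreover have "trig_poly (\<lambda>x. (1/2) * character (axis i 1) x + (1/2) * character (- axis i 1) x)"
      by (intro trig_poly.intros)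
    ultimately show "(\<lambda>z. Re (z$i)) \<in> R"
      unfolding R_def by (auto intro!: continuous_intros)
    have "of_real (Im (E x $ i)) = (-\<i>/2) * character (axis i 1) x + (\<i>/2) * character (- axis i 1) x" for x
      unfolding ax by (simp add: E_def complex_eq_iff)
    moreover have "trig_poly (\<lambda>x. (-\<i>/2) * character (axis i 1) x + (\<i>/2) * character (- axis i 1) x)"
      by (intro trig_poly.intros)
    ultimately show "(\<lambda>z. Im (z$i)) \<in> R"
      unfolding R_def by (auto intro!: continuous_intros)
  qed
  interpret function_ring_on R "E ` Q"
  proof
    show "compact (E ` Q)" by (intro compact_continuous_image contE compQ)
    show "continuous_on (E ` Q) f" if "f \<in> R" for f using that by (simp add: R_def)
    show "(\<lambda>x. f x + g x) \<in> R" if "f \<in> R" "g \<in> R" for f g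
    proof -
      from that obtain p q where "trig_poly p" "\<And>x. of_real (f (E x)) = p x" "trig_poly q" "\<And>x. of_real (g (E x)) = q x"
        by (auto simp: R_def)
      then show ?thesis using that by (auto simp: R_def intro!: continuous_intros trig_poly_add exI[of _ "\<lambda>x. p x + q x"])
    qed
    show "(\<lambda>x. f x * g x) \<in> R" if "f \<in> R" "g \<in> R" for f g
    proof -
      from that obtain p q where "trig_poly p" "\<And>x. of_real (f (E x)) = p x" "trig_poly q" "\<And>x. of_real (g (E x)) = q x"
        by (auto simp: R_def)
      then show ?thesis using that by (auto simp: R_def intro!: continuous_intros trig_poly_mult exI[of _ "\<lambda>x. p x * q x"])
    qed
    show "(\<lambda>_. c) \<in> R" for c by (auto simp: R_def intro: trig_poly_const)
    fix z w :: "complex^2" assume "z \<noteq> w"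
    then obtain i where "Re (z$i) \<noteq> Re (w$i) \<or> Im (z$i) \<noteq> Im (w$i)"
      by (auto simp: vec_eq_iff complex_eq_iff)
    then show "\<exists>f\<in>R. f z \<noteq> f w"
      by (elim disjE) (rule bexI[OF _ coord(1)[of i]], assumption, rule bexI[OF _ coord(2)[of i]], assumption)
  qed
  obtain g where g: "g \<in> R" "\<And>z. z \<in> E ` Q \<Longrightarrow> \<bar>\<Phi> z - g z\<bar> < e"
    using Stone_Weierstrass_basic[OF cont\<Phi> \<open>e > 0\<close>] by blast
  from g(1) obtain p where p: "trig_poly p" "\<And>x. of_real (g (E x)) = p x" by (auto simp: R_def)
  show ?thesis
  proof (rule that[OF p(1)])
    fix x :: "real^2" assume "x \<in> unit_square"
    then have "x \<in> Q" using box_subset_unit_square by (auto simp: Q_def)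
    then show "norm (of_real (\<phi> x) - p x) < e"
      using g(2)[of "E x"] \<Phi>E[of x] unfolding p(2)[symmetric]
      by (simp flip: of_real_diff)
  qed
qed

text \<open>
  Membership in the \<open>L\<^sup>2\<close> closure of the trigonometric polynomials. Closure under linear operations and limits
  extends it from continuous functions to indicators of open sets, of Borel sets, and to all
  square-integrable functions.
\<close>

definition trig_approximable :: "(real^2 \<Rightarrow> complex) \<Rightarrow> bool" where
  "trig_approximable g \<longleftrightarrow> sq_integrable torus g \<and>
     (\<forall>e::real. e > 0 \<longrightarrow> (\<exists>p. trig_poly p \<and> sqnorm torus (\<lambda>x. g x - p x) \<le> ennreal e))"

lemma trig_approximableD:
  assumes "trig_approximable g" "e > (0::real)"
  obtains p where "trig_poly p" "sqnorm torus (\<lambda>x. g x - p x) \<le> ennreal e"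
  using assms by (auto simp: trig_approximable_def)

lemma trig_approximable_closed:
  assumes g: "sq_integrable torus g"
    and h: "\<And>e::real. e > 0 \<Longrightarrow> \<exists>h. trig_approximable h \<and> sqnorm torus (\<lambda>x. g x - h x) \<le> ennreal e"
  shows "trig_approximable g"
  unfolding trig_approximable_def
proof (intro conjI allI impI g)
  fix e :: real assume "e > 0"
  then have e: "e/4 > 0" by simp
  obtain h where h: "trig_approximable h" "sqnorm torus (\<lambda>x. g x - h x) \<le> ennreal (e/4)" using h[OF e] by blast
  obtain p where p: "trig_poly p" "sqnorm torus (\<lambda>x. h x - p x) \<le> ennreal (e/4)"
    using trig_approximableD[OF h(1) e] .
  have [measurable]: "p \<in> borel_measurable torus" "h \<in> borel_measurable torus" "g \<in> borel_measurable torus"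
    using sq_integrable_trig_poly[OF p(1)] h(1) g by (auto simp: sq_integrable_def trig_approximable_def)
  have "sqnorm torus (\<lambda>x. g x - p x) \<le> 2 * sqnorm torus (\<lambda>x. g x - h x) + 2 * sqnorm torus (\<lambda>x. h x - p x)"
    by (rule sqnorm_diff_le) auto
  also have "\<dots> \<le> ennreal 2 * ennreal (e/4) + ennreal 2 * ennreal (e/4)"
    unfolding ennreal_numeral by (intro add_mono mult_left_mono p h) auto
  also have "\<dots> = ennreal e"
    using \<open>e > 0\<close> by (simp only: ennreal_mult[symmetric] ennreal_plus[symmetric]) simp
  finally show "\<exists>p. trig_poly p \<and> sqnorm torus (\<lambda>x. g x - p x) \<le> ennreal e" using p(1) by blast
qed

lemma trig_approximable_add:
  assumes f: "trig_approximable f" and g: "trig_approximable g"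
  shows "trig_approximable (\<lambda>x. f x + g x)"
proof (rule trig_approximable_closed)
  show "sq_integrable torus (\<lambda>x. f x + g x)"
    using assms by (auto simp: trig_approximable_def intro: sq_integrable_add)
  fix e :: real assume "e > 0"
  obtain p where p: "trig_poly p" "sqnorm torus (\<lambda>x. f x - p x) \<le> ennreal e"
    using trig_approximableD[OF f \<open>e > 0\<close>] .
  have "trig_approximable (\<lambda>x. p x + g x)"
    unfolding trig_approximable_def
  proof (intro conjI allI impI)
    show "sq_integrable torus (\<lambda>x. p x + g x)"
      using g p(1) by (auto simp: trig_approximable_def intro: sq_integrable_add sq_integrable_trig_poly)
    fix d :: real assume "d > 0"
    obtain q where "trig_poly q" "sqnorm torus (\<lambda>x. g x - q x) \<le> ennreal d"
      using trig_approximableD[OF g \<open>d > 0\<close>] .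
    then show "\<exists>q. trig_poly q \<and> sqnorm torus (\<lambda>x. p x + g x - q x) \<le> ennreal d"
      by (intro exI[of _ "\<lambda>x. p x + q x"]) (simp add: trig_poly_add p(1))
  qed
  then show "\<exists>h. trig_approximable h \<and> sqnorm torus (\<lambda>x. f x + g x - h x) \<le> ennreal e"
    using p(2) by (intro exI[of _ "\<lambda>x. p x + g x"]) simp
qed

lemma trig_approximable_lim:
  assumes F: "\<And>n::nat. trig_approximable (F n)" and g: "sq_integrable torus g" and lim: "L2_lim torus F g"
  shows "trig_approximable g"
proof (rule trig_approximable_closed[OF g])
  fix e :: real assume "e > 0"
  then have "\<forall>\<^sub>F n in sequentially. sqnorm torus (\<lambda>x. F n x - g x) < ennreal e"
    using order_tendstoD(2)[OF lim, of "ennreal e"] by simp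
  then obtain n where "sqnorm torus (\<lambda>x. F n x - g x) < ennreal e"
    by (auto simp: eventually_sequentially)
  then show "\<exists>h. trig_approximable h \<and> sqnorm torus (\<lambda>x. g x - h x) \<le> ennreal e"
    by (intro exI[of _ "F n"]) (simp add: F sqnorm_minus_commute[of _ g] less_imp_le)
qed

lemma trig_approximable_trig_poly:
  assumes "trig_poly p"
  shows "trig_approximable p"
  unfolding trig_approximable_def
proof (intro conjI allI impI)
  show "\<exists>q. trig_poly q \<and> sqnorm torus (\<lambda>x. p x - q x) \<le> ennreal e" for e
    by (rule exI[of _ p]) (use assms in \<open>simp add: sqnorm_def\<close>)
qed (rule sq_integrable_trig_poly[OF assms])

lemma trig_approximable_cmult:
  assumes f: "trig_approximable f"
  shows "trig_approximable (\<lambda>x. c * f x)"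
  unfolding trig_approximable_def
proof (intro conjI allI impI)
  have sq: "sq_integrable torus f" using f by (simp add: trig_approximable_def)
  then show "sq_integrable torus (\<lambda>x. c * f x)" by (rule sq_integrable_cmult)
  fix e :: real assume "e > 0"
  define d where "d = e / ((norm c)\<^sup>2 + 1)"
  have pos: "(norm c)\<^sup>2 + 1 > 0" by (simp add: add_nonneg_pos)
  then have d: "d > 0" using \<open>e > 0\<close> by (simp add: d_def)
  obtain p where p: "trig_poly p" "sqnorm torus (\<lambda>x. f x - p x) \<le> ennreal d"
    using trig_approximableD[OF f d] .
  have [measurable]: "f \<in> borel_measurable torus" "p \<in> borel_measurable torus"
    using sq sq_integrable_trig_poly[OF p(1)] by (auto simp: sq_integrable_def)
  have "sqnorm torus (\<lambda>x. c * f x - c * p x) = abs_sq c * sqnorm torus (\<lambda>x. f x - p x)"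
    by (subst sqnorm_cmult[symmetric]) (auto simp: right_diff_distrib)
  also have "\<dots> \<le> abs_sq c * ennreal d" by (intro mult_left_mono p) simp
  also have "\<dots> = ennreal ((norm c)\<^sup>2 * d)" using d by (simp add: ennreal_mult)
  also have "\<dots> \<le> ennreal e"
    using d pos unfolding d_def by (intro ennreal_leI) (simp add: field_simps)
  finally show "\<exists>p. trig_poly p \<and> sqnorm torus (\<lambda>x. c * f x - p x) \<le> ennreal e"
    using p(1) by (intro exI[of _ "\<lambda>x. c * p x"]) (simp add: trig_poly_cmult)
qed

lemma trig_approximable_sum:
  assumes "\<And>i. i \<in> I \<Longrightarrow> trig_approximable (f i)"
  shows "trig_approximable (\<lambda>x. \<Sum>i\<in>I. f i x)"
  using assms
  by (induction I rule: infinite_finite_induct)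
    (auto intro: trig_approximable_add trig_approximable_trig_poly trig_poly_const)

lemma sq_integrable_torus_bounded:
  assumes [measurable]: "f \<in> borel_measurable torus" and "\<And>x. norm (f x) \<le> B"
  shows "sq_integrable torus f"
proof -
  have "sqnorm torus f \<le> (\<integral>\<^sup>+x. ennreal (B\<^sup>2) \<partial>torus)"
    unfolding sqnorm_def by (intro nn_integral_mono ennreal_leI power_mono assms) auto
  also have "\<dots> < \<infinity>" using torus.emeasure_space_1 by (simp add: ennreal_mult_less_top)
  finally show ?thesis by (simp add: sq_integrable_def)
qed

lemma trig_approximable_cong_AE:
  assumes "trig_approximable f" and [measurable]: "g \<in> borel_measurable torus" and "AE x in torus. f x = g x"
  shows "trig_approximable g"
proof -
  have "sqnorm torus (\<lambda>x. f x - p x) = sqnorm torus (\<lambda>x. g x - p x)" for p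
    by (rule sqnorm_cong_AE) (use assms(3) in eventually_elim, simp)
  moreover have "sqnorm torus f = sqnorm torus g"
    by (rule sqnorm_cong_AE) (rule assms)
  ultimately show ?thesis using assms(1) by (simp add: trig_approximable_def sq_integrable_def)
qed

lemma trig_approximable_continuous:
  fixes \<phi> :: "real^2 \<Rightarrow> real"
  assumes cont: "continuous_on UNIV \<phi>" and zero: "\<And>x. x \<notin> box 0 1 \<Longrightarrow> \<phi> x = 0"
    and bdd: "\<And>x. \<bar>\<phi> x\<bar> \<le> 1"
  shows "trig_approximable (\<lambda>x. of_real (\<phi> x))"
  unfolding trig_approximable_def
proof (intro conjI allI impI)
  have [measurable]: "\<phi> \<in> borel_measurable borel" using cont by (rule borel_measurable_continuous_onI)
  show "sq_integrable torus (\<lambda>x. of_real (\<phi> x))"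
    by (rule sq_integrable_torus_bounded[where B = 1]) (use bdd in auto)
  fix e :: real assume "e > 0"
  then have "sqrt e > 0" by simp
  obtain p where p: "trig_poly p" "\<And>x. x \<in> unit_square \<Longrightarrow> norm (of_real (\<phi> x) - p x) < sqrt e"
    using trig_poly_uniform_approximation[OF cont zero \<open>sqrt e > 0\<close>] by blast
  have "sqnorm torus (\<lambda>x. of_real (\<phi> x) - p x) \<le> (\<integral>\<^sup>+x. ennreal e \<partial>torus)"
    unfolding sqnorm_def
  proof (rule nn_integral_mono_AE)
    show "AE x in torus. abs_sq (of_real (\<phi> x) - p x) \<le> ennreal e"
      unfolding AE_torus
    proof (intro AE_I2 impI ennreal_leI)
      fix x assume "x \<in> unit_square"
      then have "(norm (of_real (\<phi> x) - p x))\<^sup>2 \<le> (sqrt e)\<^sup>2"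
        by (intro power_mono order.strict_implies_order[OF p(2)]) auto
      then show "(norm (of_real (\<phi> x) - p x))\<^sup>2 \<le> e" using \<open>e > 0\<close> by simp
    qed
  qed
  also have "\<dots> = ennreal e" using torus.emeasure_space_1 by simp
  finally show "\<exists>p. trig_poly p \<and> sqnorm torus (\<lambda>x. of_real (\<phi> x) - p x) \<le> ennreal e"
    using p(1) by blast
qed

text \<open>
  The boundary of the square is a null set, so an open set can be replaced by its intersection \<open>U\<close> with the
  open square. The indicator of \<open>U\<close> is the limit of the continuous functions \<open>min 1 (n d(x, U\<^sup>c))\<close>, which
  vanish outside \<open>U\<close>.
\<close>

lemma trig_approximable_indicator_open:
  assumes "open (A :: (real^2) set)"
  shows "trig_approximable (\<lambda>x. of_real (indicator A x))"
proof -
  define U where "U = A \<inter> box 0 (1::real^2)"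
  have U: "open U" using assms by (auto simp: U_def intro!: open_Int open_box)
  have ne: "- U \<noteq> {}"
  proof -
    have "(0::real^2) \<notin> U" by (auto simp: U_def mem_box_cart)
    then show ?thesis by blast
  qed
  define \<phi> where "\<phi> n x = min 1 (real n * infdist x (- U))" for n :: nat and x
  have \<phi>: "continuous_on UNIV (\<phi> n)" "0 \<le> \<phi> n x" "\<phi> n x \<le> 1" for n x
    unfolding \<phi>_def by (auto intro!: continuous_intros simp: infdist_nonneg)
  have \<phi>0: "\<phi> n x = 0" if "x \<notin> U" for n x
    using that by (simp add: \<phi>_def)
  have [measurable]: "\<phi> n \<in> borel_measurable borel" for n
    using \<phi>(1) by (rule borel_measurable_continuous_onI)
  have [measurable]: "U \<in> sets borel" using U by simp
  have lim: "(\<lambda>n. \<phi> n x) \<longlonglongrightarrow> indicator U x" for x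
  proof (cases "x \<in> U")
    case True
    then have "infdist x (- U) > 0"
      using U ne by (metis Compl_iff closed_Compl in_closed_iff_infdist_zero infdist_nonneg less_eq_real_def)
    then obtain N :: nat where N: "real N * infdist x (- U) > 1"
      using reals_Archimedean3 by blast
    have "\<phi> n x = 1" if "n \<ge> N" for n
    proof -
      have "real N * infdist x (- U) \<le> real n * infdist x (- U)"
        using that by (intro mult_right_mono infdist_nonneg) auto
      then show ?thesis using N by (simp add: \<phi>_def)
    qed
    then show ?thesis
      using True by (intro tendsto_eventually) (auto simp: eventually_sequentially)
  next
    case False
    then show ?thesis by (simp add: \<phi>0)
  qed
  have "trig_approximable (\<lambda>x. of_real (indicator U x))"
  proof (rule trig_approximable_lim)
    show "trig_approximable (\<lambda>x. of_real (\<phi> n x))" for n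
      by (rule trig_approximable_continuous) (use \<phi> \<phi>0 in \<open>auto simp: U_def\<close>)
    show "sq_integrable torus (\<lambda>x. of_real (indicator U x))"
      by (rule sq_integrable_torus_bounded[where B = 1]) (auto simp: indicator_def)
    show "(\<lambda>n. sqnorm torus (\<lambda>x. of_real (\<phi> n x) - of_real (indicator U x))) \<longlonglongrightarrow> 0"
    proof (rule sqnorm_dominated_tendsto[where w = "\<lambda>_. 1"])
      show "sq_integrable torus (\<lambda>_. 1)" by (rule sq_integrable_torus_bounded[where B = 1]) auto
    qed (use \<phi> in \<open>auto intro!: tendsto_of_real lim\<close>)
  qed
  then show ?thesis
  proof (rule trig_approximable_cong_AE)
    have [measurable]: "A \<in> sets borel" using assms by simp
    show "(\<lambda>x. complex_of_real (indicator A x)) \<in> borel_measurable torus"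
      by (rule sq_integrable_measurable[OF sq_integrable_torus_bounded[where B = 1]]) (auto simp: indicator_def)
    show "AE x in torus. complex_of_real (indicator U x) = of_real (indicator A x)"
      using AE_torus_box by eventually_elim (simp add: U_def indicator_def)
  qed
qed

text \<open>
  The sets with this property form a Dynkin system, and the open sets are closed under intersection
  and generate the Borel sets.
\<close>

lemma trig_approximable_indicator:
  assumes "A \<in> sets borel"
  shows "trig_approximable (\<lambda>x. of_real (indicator A x))"
proof -
  have "Int_stable {S. open (S :: (real^2) set)}" by (auto simp: Int_stable_def)
  moreover have "{S. open S} \<subseteq> Pow (UNIV :: (real^2) set)" by auto
  moreover have "A \<in> sigma_sets UNIV {S. open S}" using assms by (simp add: sets_borel)
  ultimately show ?thesis
  proof (induction rule: sigma_sets_induct_disjoint)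
    case (basic A)
    then show ?case by (intro trig_approximable_indicator_open) auto
  next
    case empty
    show ?case by (simp add: trig_approximable_trig_poly trig_poly_const)
  next
    case (compl A)
    have "trig_approximable (\<lambda>x. 1 + (-1) * of_real (indicator A x))"
      by (intro trig_approximable_add trig_approximable_cmult compl trig_approximable_trig_poly trig_poly_const)
    also have "(\<lambda>x. 1 + (-1) * of_real (indicator A x)) = (\<lambda>x. complex_of_real (indicator (UNIV - A) x))"
      by (auto simp: fun_eq_iff indicator_def)
    finally show ?case .
  next
    case (union D)
    have [measurable]: "D i \<in> sets borel" for i
      using union(2) by (auto simp: sets_borel)
    have sum: "(\<Sum>i<n. complex_of_real (indicator (D i) x)) = of_real (indicator (\<Union>i<n. D i) x)" for n x
      by (subst indicator_UN_disjoint) (use union(1) in \<open>auto simp: disjoint_family_on_def\<close>)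
    show ?case
    proof (rule trig_approximable_lim)
      show "trig_approximable (\<lambda>x. \<Sum>i<n. of_real (indicator (D i) x))" for n
        by (intro trig_approximable_sum union)
      show "sq_integrable torus (\<lambda>x. of_real (indicator (\<Union>i. D i) x))"
        by (rule sq_integrable_torus_bounded[where B = 1]) (auto simp: indicator_def)
      show "L2_lim torus (\<lambda>n x. \<Sum>i<n. of_real (indicator (D i) x)) (\<lambda>x. of_real (indicator (\<Union>i. D i) x))"
        unfolding sum
      proof (rule sqnorm_dominated_tendsto[where w = "\<lambda>_. 1"])
        show "sq_integrable torus (\<lambda>_. 1)" by (rule sq_integrable_torus_bounded[where B = 1]) auto
        show "(\<lambda>n. complex_of_real (indicator (\<Union>i<n. D i) x)) \<longlonglongrightarrow> of_real (indicator (\<Union>i. D i) x)" for x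
          by (intro tendsto_of_real LIMSEQ_indicator_UN)
      qed (auto simp: indicator_def)
    qed
  qed
qed

lemma trig_approximable_sq_integrable:
  assumes g: "sq_integrable torus g"
  shows "trig_approximable g"
proof -
  have [measurable]: "g \<in> borel_measurable torus" using g by (simp add: sq_integrable_def)
  from borel_measurable_implies_sequence_metric[OF this, of 0] obtain F where
    F: "\<And>n. simple_function torus (F n)" "\<And>x. (\<lambda>n. F n x) \<longlonglongrightarrow> g x" "\<And>n x. norm (F n x) \<le> 2 * norm (g x)"
    by auto
  note [measurable] = borel_measurable_simple_function[OF F(1)]
  show ?thesis
  proof (rule trig_approximable_lim[OF _ g])
    show "L2_lim torus F g"
      by (rule sqnorm_dominated_tendsto[where w = "\<lambda>x. 2 * g x"])
        (use F g in \<open>auto simp: norm_mult intro: sq_integrable_cmult\<close>)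
    fix n
    have fin: "finite (range (F n))" using F(1)[of n] by (simp add: simple_function_def)
    have m: "F n -` {y} \<in> sets borel" for y
      using simple_functionD(2)[OF F(1)[of n], of "{y}"] by simp
    have "trig_approximable (\<lambda>x. \<Sum>y\<in>range (F n). y * of_real (indicator (F n -` {y}) x))"
      by (intro trig_approximable_sum trig_approximable_cmult trig_approximable_indicator m)
    also have "(\<lambda>x. \<Sum>y\<in>range (F n). y * of_real (indicator (F n -` {y}) x)) = F n"
    proof
      fix x
      have "(\<Sum>y\<in>range (F n). y * of_real (indicator (F n -` {y}) x)) = (\<Sum>y\<in>range (F n). if F n x = y then y else 0)"
        by (intro sum.cong) (auto simp: indicator_def)
      then show "(\<Sum>y\<in>range (F n). y * of_real (indicator (F n -` {y}) x)) = F n x" using fin by simp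
    qed
    finally show "trig_approximable (F n)" .
  qed
qed

text \<open>
  The Fourier coefficients give the best approximation among the trigonometric polynomials with
  given frequencies: completing the square shows
  \<open>\<parallel>g - \<Sum> c\<^sub>m e\<^sub>m\<parallel>\<^sup>2 = \<parallel>g\<parallel>\<^sup>2 - \<Sum> |g\<^sub>m|\<^sup>2 + \<Sum> |c\<^sub>m - g\<^sub>m|\<^sup>2\<close> for the coefficients \<open>g\<^sub>m\<close> of \<open>g\<close>. With
  \<open>c = g\<close> this is Bessel's inequality; density of the trigonometric polynomials gives equality.
\<close>

lemma sqnorm_diff_character_sum:
  assumes g: "sq_integrable torus g" and S: "finite S"
  shows "enn2real (sqnorm torus (\<lambda>x. g x - (\<Sum>m\<in>S. c m * character m x))) =
    enn2real (sqnorm torus g) - (\<Sum>m\<in>S. (norm (ip torus g (character m)))\<^sup>2)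
      + (\<Sum>m\<in>S. (norm (c m - ip torus g (character m)))\<^sup>2)"
proof -
  define b where "b m = ip torus g (character m)" for m
  have sq: "sq_integrable torus (\<lambda>x. - c m * character m x)" for m
    by (intro sq_integrable_cmult sq_integrable_character)
  have "(\<lambda>x. g x - (\<Sum>m\<in>S. c m * character m x)) = (\<lambda>x. g x + (\<Sum>m\<in>S. - c m * character m x))"
    by (simp add: sum_negf)
  then have "enn2real (sqnorm torus (\<lambda>x. g x - (\<Sum>m\<in>S. c m * character m x))) =
      enn2real (sqnorm torus g) + enn2real (sqnorm torus (\<lambda>x. \<Sum>m\<in>S. - c m * character m x))
      + 2 * Re (ip torus g (\<lambda>x. \<Sum>m\<in>S. - c m * character m x))"
    by (simp only: sqnorm_add_eq[OF g sq_integrable_sum[OF sq]])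
  also have "sqnorm torus (\<lambda>x. \<Sum>m\<in>S. - c m * character m x) = ennreal (\<Sum>m\<in>S. (norm (- c m))\<^sup>2)"
    by (rule sqnorm_character_sum[OF S])
  also have "ip torus g (\<lambda>x. \<Sum>m\<in>S. - c m * character m x) = (\<Sum>m\<in>S. - cnj (c m) * b m)"
  proof -
    have "ip torus g (\<lambda>x. \<Sum>m\<in>S. - c m * character m x) = cnj (\<Sum>m\<in>S. ip torus (\<lambda>x. - c m * character m x) g)"
      by (subst ip_commute, subst ip_sum_left[OF sq g]) (rule refl)
    also have "\<dots> = cnj (\<Sum>m\<in>S. - c m * ip torus (character m) g)"
      by (simp only: ip_cmult_left)
    also have "\<dots> = (\<Sum>m\<in>S. - cnj (c m) * b m)"
      by (simp add: b_def flip: ip_commute)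
    finally show ?thesis .
  qed
  finally have "enn2real (sqnorm torus (\<lambda>x. g x - (\<Sum>m\<in>S. c m * character m x))) =
      enn2real (sqnorm torus g) + ((\<Sum>m\<in>S. (norm (c m))\<^sup>2) + (\<Sum>m\<in>S. 2 * Re (- cnj (c m) * b m)))"
    by (simp add: sum_nonneg sum_distrib_left)
  also have "(\<Sum>m\<in>S. (norm (c m))\<^sup>2) + (\<Sum>m\<in>S. 2 * Re (- cnj (c m) * b m)) =
      (\<Sum>m\<in>S. (norm (c m - b m))\<^sup>2) - (\<Sum>m\<in>S. (norm (b m))\<^sup>2)"
    by (subst sum.distrib[symmetric], subst sum_subtractf[symmetric])
      (rule sum.cong, rule refl, simp only: cmod_power2, simp add: power2_eq_square algebra_simps)
  finally show ?thesis by (simp add: b_def)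
qed

lemma nn_integral_count_space_SUP:
  fixes f :: "'i :: countable \<Rightarrow> ennreal"
  shows "(\<integral>\<^sup>+i. f i \<partial>count_space A) = (SUP F\<in>{F. finite F \<and> F \<subseteq> A}. sum f F)"
proof (rule antisym)
  show "(SUP F\<in>{F. finite F \<and> F \<subseteq> A}. sum f F) \<le> (\<integral>\<^sup>+i. f i \<partial>count_space A)"
  proof (rule SUP_least, clarify)
    fix F assume "finite F" "F \<subseteq> A"
    then have "sum f F = (\<integral>\<^sup>+i. f i * indicator F i \<partial>count_space A)"
      by (subst nn_integral_count_space'[where A = F]) (auto intro!: sum.cong)
    also have "\<dots> \<le> (\<integral>\<^sup>+i. f i \<partial>count_space A)"
      by (intro nn_integral_mono) (auto simp: indicator_def)
    finally show "sum f F \<le> (\<integral>\<^sup>+i. f i \<partial>count_space A)" .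
  qed
  show "(\<integral>\<^sup>+i. f i \<partial>count_space A) \<le> (SUP F\<in>{F. finite F \<and> F \<subseteq> A}. sum f F)"
  proof (cases "finite A")
    case True
    then show ?thesis by (auto simp: nn_integral_count_space_finite intro: SUP_upper)
  next
    case False
    then have bij: "bij_betw (from_nat_into A) UNIV A" by (intro bij_betw_from_nat_into) auto
    have "(\<integral>\<^sup>+i. f i \<partial>count_space A) = (\<Sum>n. f (from_nat_into A n))"
      by (simp add: nn_integral_bij_count_space[OF bij, symmetric] nn_integral_count_space_nat)
    also have "\<dots> = (SUP n. \<Sum>k<n. f (from_nat_into A k))" by (rule suminf_eq_SUP)
    also have "\<dots> \<le> (SUP F\<in>{F. finite F \<and> F \<subseteq> A}. sum f F)"
    proof (rule SUP_least)
      fix n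
      have "(\<Sum>k<n. f (from_nat_into A k)) = sum f (from_nat_into A ` {..<n})"
        using bij by (intro sum.reindex_cong[symmetric, OF _ refl refl]) (auto simp: bij_betw_def intro: inj_on_subset)
      also have "\<dots> \<le> (SUP F\<in>{F. finite F \<and> F \<subseteq> A}. sum f F)"
        using bij by (intro SUP_upper) (auto simp: bij_betw_def)
      finally show "(\<Sum>k<n. f (from_nat_into A k)) \<le> (SUP F\<in>{F. finite F \<and> F \<subseteq> A}. sum f F)" .
    qed
    finally show ?thesis .
  qed
qed

lemma infsum_ennreal_eq_nn_integral:
  fixes f :: "'i :: countable \<Rightarrow> ennreal"
  shows "(\<Sum>\<^sub>\<infinity>i\<in>A. f i) = (\<integral>\<^sup>+i. f i \<partial>count_space A)"
  by (simp add: nonneg_infsum_complete nn_integral_count_space_SUP)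

theorem Parseval_torus:
  assumes g: "sq_integrable torus g"
  shows "(\<integral>\<^sup>+m. abs_sq (ip torus g (character m)) \<partial>Z2) = sqnorm torus g"
proof (rule antisym)
  define b where "b m = ip torus g (character m)" for m
  define G where "G = enn2real (sqnorm torus g)"
  have G: "sqnorm torus g = ennreal G" using sqnorm_finite[OF g] by (simp add: G_def)
  have "(\<Sum>m\<in>F. abs_sq (b m)) \<le> sqnorm torus g" if "finite F" for F
  proof -
    have "0 \<le> enn2real (sqnorm torus (\<lambda>x. g x - (\<Sum>m\<in>F. b m * character m x)))" by simp
    also have "\<dots> = G - (\<Sum>m\<in>F. (norm (b m))\<^sup>2)"
      using sqnorm_diff_character_sum[OF g that, of b] by (simp add: b_def G_def)
    finally show ?thesis unfolding G by (subst sum_ennreal) (auto intro: ennreal_leI)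
  qed
  then show "(\<integral>\<^sup>+m. abs_sq (ip torus g (character m)) \<partial>Z2) \<le> sqnorm torus g"
    unfolding nn_integral_count_space_SUP b_def by (intro SUP_least) auto
  show "sqnorm torus g \<le> (\<integral>\<^sup>+m. abs_sq (ip torus g (character m)) \<partial>Z2)"
  proof (rule ennreal_le_epsilon)
    fix e :: real assume "e > 0"
    obtain p where p: "trig_poly p" "sqnorm torus (\<lambda>x. g x - p x) \<le> ennreal e"
      using trig_approximableD[OF trig_approximable_sq_integrable[OF g] \<open>e > 0\<close>] .
    obtain S c where S: "finite S" "p = (\<lambda>x. \<Sum>m\<in>S. c m * character m x)"
      using trig_poly_coefficients[OF p(1)] .
    have "G - (\<Sum>m\<in>S. (norm (b m))\<^sup>2) \<le> enn2real (sqnorm torus (\<lambda>x. g x - p x))"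
      unfolding S(2) G_def b_def sqnorm_diff_character_sum[OF g S(1)] by (simp add: sum_nonneg)
    also have "\<dots> \<le> e" using enn2real_mono[OF p(2)] \<open>e > 0\<close> by simp
    finally have "G \<le> (\<Sum>m\<in>S. (norm (b m))\<^sup>2) + e" by simp
    then have "sqnorm torus g \<le> (\<Sum>m\<in>S. abs_sq (b m)) + ennreal e"
      unfolding G using \<open>e > 0\<close> by (subst sum_ennreal) (auto simp: sum_nonneg simp flip: ennreal_plus intro!: ennreal_leI)
    also have "(\<Sum>m\<in>S. abs_sq (b m)) \<le> (\<integral>\<^sup>+m. abs_sq (b m) \<partial>Z2)"
      unfolding nn_integral_count_space_SUP using S by (intro SUP_upper) auto
    finally show "sqnorm torus g \<le> (\<integral>\<^sup>+m. abs_sq (ip torus g (character m)) \<partial>Z2) + ennreal e"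
      by (simp add: b_def)
  qed
qed

section \<open>Parseval's identity for periodizations\<close>

lemma nn_integral_count_space_split_0:
  fixes b :: "int^2 \<Rightarrow> ennreal"
  shows "(\<integral>\<^sup>+l. b l \<partial>Z2) = b 0 + (\<integral>\<^sup>+l. b l \<partial>count_space (UNIV - {0}))"
proof -
  have "(\<integral>\<^sup>+l. b l \<partial>Z2) =
      (\<integral>\<^sup>+l. b l * indicator {0} l + b l * indicator (UNIV - {0}) l \<partial>Z2)"
    by (intro nn_integral_cong) (auto simp: indicator_def)
  also have "\<dots> = (\<integral>\<^sup>+l. b l * indicator {0} l \<partial>Z2) + (\<integral>\<^sup>+l. b l * indicator (UNIV - {0}) l \<partial>Z2)"
    by (rule nn_integral_add) auto
  also have "(\<integral>\<^sup>+l. b l * indicator {0} l \<partial>Z2) = b 0"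
    by (subst nn_integral_count_space'[where A = "{0}"]) auto
  also have "(\<integral>\<^sup>+l. b l * indicator (UNIV - {0}) l \<partial>Z2) = (\<integral>\<^sup>+l. b l \<partial>count_space (UNIV - {0}))"
    by (rule nn_integral_count_space_indicator[symmetric]) simp
  finally show ?thesis .
qed

lemma bij_betw_add: "bij_betw ((+) n) UNIV (UNIV :: (int^2) set)"
  by (rule bij_betwI[where g = "\<lambda>k. k - n"]) auto

lemma nn_integral_count_space_shift:
  fixes b :: "int^2 \<Rightarrow> ennreal"
  shows "(\<integral>\<^sup>+l. b (n + l) \<partial>Z2) = (\<integral>\<^sup>+l. b l \<partial>Z2)"
  by (rule nn_integral_bij_count_space[OF bij_betw_add])

text \<open>
  The terms with distinct indices in \<open>\<Sum>\<^sub>n \<Sum>\<^sub>k |z\<^sub>n| |z\<^sub>k|\<close>, ordered by the difference \<open>l = k - n\<close>.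
\<close>

definition off_diagonal :: "(int^2 \<Rightarrow> complex) \<Rightarrow> ennreal" where
  "off_diagonal z = (\<integral>\<^sup>+n. \<integral>\<^sup>+l. ennreal (norm (z n) * norm (z (n + l))) \<partial>count_space (UNIV - {0}) \<partial>Z2)"

lemma square_of_sum:
  "(\<integral>\<^sup>+n. ennreal (norm (z n)) \<partial>Z2)\<^sup>2 =
    (\<integral>\<^sup>+n. abs_sq (z n) \<partial>Z2) + off_diagonal z"
proof -
  define s where "s = (\<integral>\<^sup>+n. ennreal (norm (z n)) \<partial>Z2)"
  have s: "s = ennreal (norm (z n)) + (\<integral>\<^sup>+l. ennreal (norm (z (n + l))) \<partial>count_space (UNIV - {0}))" for n
    using nn_integral_count_space_split_0[of "\<lambda>l. ennreal (norm (z (n + l)))"]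
    by (simp add: s_def nn_integral_count_space_shift[of "\<lambda>l. ennreal (norm (z l))"])
  have "s\<^sup>2 = (\<integral>\<^sup>+n. ennreal (norm (z n)) * s \<partial>Z2)"
    by (simp add: power2_eq_square nn_integral_multc) (simp add: s_def)
  also have "\<dots> = (\<integral>\<^sup>+n. abs_sq (z n) +
      (\<integral>\<^sup>+l. ennreal (norm (z n) * norm (z (n + l))) \<partial>count_space (UNIV - {0})) \<partial>Z2)"
  proof (rule nn_integral_cong)
    fix n
    show "ennreal (norm (z n)) * s = abs_sq (z n) +
      (\<integral>\<^sup>+l. ennreal (norm (z n) * norm (z (n + l))) \<partial>count_space (UNIV - {0}))"
      unfolding s[of n] by (simp add: distrib_left ennreal_mult power2_eq_square nn_integral_cmult)
  qed
  finally show ?thesis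
    by (simp add: s_def off_diagonal_def nn_integral_add)
qed

lemma norm_sum_minus_term_le:
  assumes z: "integrable Z2 (z :: int^2 \<Rightarrow> complex)"
  shows "ennreal (norm ((LINT k|Z2. z k) - z n))
    \<le> (\<integral>\<^sup>+l. ennreal (norm (z (n + l))) \<partial>count_space (UNIV - {0}))"
proof -
  have 1: "integrable Z2 (\<lambda>l. z (n + l))"
    unfolding integrable_bij_count_space[OF bij_betw_add, of z n] by (rule z)
  have 2: "integrable Z2 (\<lambda>l::int^2. indicator {0} l *\<^sub>R z n)"
  proof (rule integrableI_bounded)
    have "(\<integral>\<^sup>+l. ennreal (norm (indicator {0::int^2} l *\<^sub>R z n)) \<partial>Z2) = ennreal (norm (z n))"
      by (subst nn_integral_count_space'[where A = "{0}"]) (auto simp: indicator_def)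
    then show "(\<integral>\<^sup>+l. ennreal (norm (indicator {0::int^2} l *\<^sub>R z n)) \<partial>Z2) < \<infinity>" by simp
  qed simp
  have "(LINT l|Z2. indicator {0::int^2} l *\<^sub>R z n) = z n"
    by simp
  then have "(LINT k|Z2. z k) - z n = (LINT l|Z2. z (n + l) - indicator {0} l *\<^sub>R z n)"
    by (simp add: Bochner_Integration.integral_diff[OF 1 2] integral_bij_count_space[OF bij_betw_add, of z n])
  also have "ennreal (norm \<dots>) \<le> (\<integral>\<^sup>+l. ennreal (norm (z (n + l) - indicator {0} l *\<^sub>R z n)) \<partial>Z2)"
    by (rule integral_norm_bound_ennreal[OF Bochner_Integration.integrable_diff[OF 1 2]])
  also have "\<dots> = (\<integral>\<^sup>+l. ennreal (norm (z (n + l))) \<partial>count_space (UNIV - {0}))"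
    unfolding nn_integral_count_space_split_0 by (auto intro!: nn_integral_cong)
  finally show ?thesis .
qed

text \<open>
  With \<open>s = \<Sum> z\<^sub>n\<close> one has \<open>\<Sum> |z\<^sub>n|\<^sup>2 = |s|\<^sup>2 - \<Sum> z\<^sub>n cnj (s - z\<^sub>n)\<close>, and \<open>s - z\<^sub>n\<close> is the sum of the other terms.
  This avoids a double series of complex numbers.
\<close>

lemma diagonal_le:
  assumes z: "integrable Z2 (z :: int^2 \<Rightarrow> complex)"
  shows "(\<integral>\<^sup>+n. abs_sq (z n) \<partial>Z2) \<le>
    abs_sq (LINT n|Z2. z n) + off_diagonal z"
proof -
  define s where "s = (LINT n|Z2. z n)"
  have Bfin: "(\<integral>\<^sup>+n. ennreal (norm (z n)) \<partial>Z2) < \<infinity>"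
    using z by (simp add: integrable_iff_bounded)
  define B where "B = enn2real (\<integral>\<^sup>+n. ennreal (norm (z n)) \<partial>Z2)"
  have B: "norm (z n) \<le> B" for n
  proof -
    have "ennreal (norm (z n)) \<le> (\<integral>\<^sup>+n. ennreal (norm (z n)) \<partial>Z2)"
      by (rule nn_integral_ge_point) simp
    also have "\<dots> = ennreal B" using Bfin by (simp add: B_def)
    finally show ?thesis by (simp add: B_def)
  qed
  have zz: "integrable Z2 (\<lambda>n. z n * cnj (z n))"
  proof (rule Bochner_Integration.integrable_bound)
    show "integrable Z2 (\<lambda>n. z n * of_real B)" using z by simp
    show "AE n in Z2. norm (z n * cnj (z n)) \<le> norm (z n * of_real B)"
      using B by (intro AE_I2) (auto simp: norm_mult B_def intro!: mult_left_mono)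
  qed simp
  define w where "w n = z n * cnj s - z n * cnj (z n)" for n
  have zs: "integrable Z2 (\<lambda>n. z n * cnj s)" using z by simp
  have w: "integrable Z2 w" unfolding w_def[abs_def] using zz zs by simp
  have "(LINT n|Z2. z n * cnj (z n)) = (LINT n|Z2. z n * cnj s) - (LINT n|Z2. w n)"
    using zz zs by (simp add: w_def)
  also have "(LINT n|Z2. z n * cnj s) = s * cnj s"
    by (simp add: s_def)
  finally have eq: "(LINT n|Z2. z n * cnj (z n)) = s * cnj s - (LINT n|Z2. w n)" .
  have "(\<integral>\<^sup>+n. abs_sq (z n) \<partial>Z2) = (\<integral>\<^sup>+n. ennreal (norm (z n * cnj (z n))) \<partial>Z2)"
    by (simp add: norm_mult power2_eq_square)
  also have "\<dots> = ennreal (LINT n|Z2. norm (z n * cnj (z n)))"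
    using zz by (intro nn_integral_eq_integral) auto
  also have "(LINT n|Z2. norm (z n * cnj (z n))) = Re (s * cnj s - (LINT n|Z2. w n))"
    unfolding eq[symmetric] integral_Re[OF zz, symmetric]
    by (simp only: complex_norm_square[symmetric] norm_of_real Re_complex_of_real abs_power2)
  finally have 1: "(\<integral>\<^sup>+n. abs_sq (z n) \<partial>Z2) = ennreal (Re (s * cnj s - (LINT n|Z2. w n)))" .
  have "Re (s * cnj s - (LINT n|Z2. w n)) \<le> (norm s)\<^sup>2 + norm (LINT n|Z2. w n)"
    using abs_Re_le_cmod[of "LINT n|Z2. w n"] by (simp add: complex_mult_cnj cmod_power2)
  then have 2: "ennreal (Re (s * cnj s - (LINT n|Z2. w n))) \<le> abs_sq s + ennreal (norm (LINT n|Z2. w n))"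
    by (simp flip: ennreal_plus add: ennreal_leI)
  have "ennreal (norm (LINT n|Z2. w n)) \<le> (\<integral>\<^sup>+n. ennreal (norm (w n)) \<partial>Z2)"
    by (rule integral_norm_bound_ennreal[OF w])
  also have "\<dots> \<le> off_diagonal z"
    unfolding off_diagonal_def
  proof (rule nn_integral_mono)
    fix n
    have "w n = z n * cnj (s - z n)" by (simp add: w_def right_diff_distrib)
    then have "ennreal (norm (w n)) = ennreal (norm (z n)) * ennreal (norm (s - z n))"
      by (simp add: norm_mult ennreal_mult del: complex_cnj_diff)
    also have "\<dots> \<le> ennreal (norm (z n)) * (\<integral>\<^sup>+l. ennreal (norm (z (n + l))) \<partial>count_space (UNIV - {0}))"
      unfolding s_def by (intro mult_left_mono norm_sum_minus_term_le z) auto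
    finally show "ennreal (norm (w n)) \<le> (\<integral>\<^sup>+l. ennreal (norm (z n) * norm (z (n + l))) \<partial>count_space (UNIV - {0}))"
      by (simp add: ennreal_mult nn_integral_cmult)
  qed
  finally have "ennreal (norm (LINT n|Z2. w n)) \<le> off_diagonal z" .
  from order_trans[OF 2 add_left_mono[OF this]] show ?thesis unfolding 1 s_def .
qed

definition periodization :: "(real^2 \<Rightarrow> complex) \<Rightarrow> real^2 \<Rightarrow> complex" where
  "periodization G x = (LINT n|Z2. G (x + int_vec n))"

text \<open>
  Unfolding the integral over the torus identifies the Fourier coefficients of the periodization with values
  of the Fourier transform of \<open>G\<close>; the hypothesis makes the periodization square-integrable.
\<close>

lemma Parseval_periodization:
  assumes [measurable]: "G \<in> borel_measurable borel"
    and fin: "(\<integral>\<^sup>+x. (\<integral>\<^sup>+n. ennreal (norm (G (x + int_vec n))) \<partial>Z2)\<^sup>2 \<partial>torus) < \<infinity>"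
  shows "integrable lborel G"
    and "(\<integral>\<^sup>+m. abs_sq (LINT x|lborel. G x * cnj (character m x)) \<partial>Z2)
      = sqnorm torus (periodization G)"
    and "sqnorm torus (periodization G)
      \<le> (\<integral>\<^sup>+x. (\<integral>\<^sup>+n. ennreal (norm (G (x + int_vec n))) \<partial>Z2)\<^sup>2 \<partial>torus)"
proof -
  define H where "H x = (\<integral>\<^sup>+n. ennreal (norm (G (x + int_vec n))) \<partial>Z2)" for x
  have [measurable]: "H \<in> borel_measurable borel" unfolding H_def[abs_def] by measurable
  have "(\<integral>\<^sup>+x. ennreal (norm (G x)) \<partial>lborel) = (\<integral>\<^sup>+x. H x \<partial>torus)"
    unfolding H_def by (rule nn_integral_tiling) auto
  also have "\<dots> \<le> (\<integral>\<^sup>+x. 1 + (H x)\<^sup>2 \<partial>torus)"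
  proof (rule nn_integral_mono)
    fix x
    show "H x \<le> 1 + (H x)\<^sup>2"
    proof (cases "H x \<le> 1")
      case False
      then have "H x * 1 \<le> H x * H x" by (intro mult_left_mono) auto
      also have "\<dots> \<le> 1 + (H x)\<^sup>2" by (simp add: power2_eq_square)
      finally show ?thesis by simp
    qed (auto intro: order_trans)
  qed
  also have "\<dots> = 1 + (\<integral>\<^sup>+x. (H x)\<^sup>2 \<partial>torus)"
    using torus.emeasure_space_1 by (subst nn_integral_add) (auto simp: borel_measurable_torus)
  also have "\<dots> < \<infinity>" using fin by (simp add: H_def)
  finally show int: "integrable lborel G" by (intro integrableI_bounded) auto
  have le: "abs_sq (periodization G x) \<le> (H x)\<^sup>2" if "integrable Z2 (\<lambda>n. G (x + int_vec n))" for x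
  proof -
    have "ennreal (norm (periodization G x)) \<le> H x"
      unfolding periodization_def H_def by (rule integral_norm_bound_ennreal[OF that])
    then have "(ennreal (norm (periodization G x)))\<^sup>2 \<le> (H x)\<^sup>2" by (rule power_mono) simp
    then show ?thesis by (simp add: ennreal_power)
  qed
  show leH: "sqnorm torus (periodization G)
      \<le> (\<integral>\<^sup>+x. (\<integral>\<^sup>+n. ennreal (norm (G (x + int_vec n))) \<partial>Z2)\<^sup>2 \<partial>torus)"
    unfolding sqnorm_def H_def[symmetric]
    by (rule nn_integral_mono_AE) (use integral_tiling(1)[OF int] in eventually_elim, erule le)
  have sq: "sq_integrable torus (periodization G)"
    using borel_measurable_integrable[OF integral_tiling(2)[OF int]] le_less_trans[OF leH fin]
    by (simp add: sq_integrable_def periodization_def[abs_def])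
  have "(LINT x|lborel. G x * cnj (character m x)) = ip torus (periodization G) (character m)" for m
  proof -
    have "integrable lborel (\<lambda>x. G x * cnj (character m x))"
      by (rule Bochner_Integration.integrable_bound[OF int]) (auto simp: norm_mult)
    from integral_tiling(3)[OF this] show ?thesis
      by (simp add: ip_def periodization_def)
  qed
  then show "(\<integral>\<^sup>+m. abs_sq (LINT x|lborel. G x * cnj (character m x)) \<partial>Z2)
      = sqnorm torus (periodization G)"
    using Parseval_torus[OF sq] by simp
qed

definition overlap :: "(real^2 \<Rightarrow> complex) \<Rightarrow> ennreal" where
  "overlap G = (\<integral>\<^sup>+l. \<integral>\<^sup>+x. ennreal (norm (G x) * norm (G (x + int_vec l))) \<partial>lborel \<partial>count_space (UNIV - {0}))"

text \<open>
  The pointwise estimates of \<open>|\<Sum> G(x + n)|\<^sup>2\<close> by its diagonal and off-diagonal terms are integrated over the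
  torus; by tiling the diagonal becomes \<open>\<integral> |G|\<^sup>2\<close> and the off-diagonal terms become the overlap.
\<close>

theorem Fourier_coefficients_overlap:
  assumes [measurable]: "G \<in> borel_measurable borel"
    and fin: "sqnorm lborel G < \<infinity>" "overlap G < \<infinity>"
  defines "S \<equiv> (\<integral>\<^sup>+m. abs_sq (LINT x|lborel. G x * cnj (character m x)) \<partial>Z2)"
  shows "S \<le> sqnorm lborel G + overlap G" and "sqnorm lborel G \<le> S + overlap G"
proof -
  define z where "z x n = G (x + int_vec n)" for x n
  define O' where "O' x = (\<integral>\<^sup>+l. ennreal (norm (G x) * norm (G (x + int_vec l))) \<partial>count_space (UNIV - {0}))" for x
  have [measurable]: "int_vec \<in> measurable (count_space A) borel" for A by simp
  have sf: "sigma_finite_measure (count_space (UNIV - {0 :: int^2}))"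
    by (rule sigma_finite_measure_count_space_countable) auto
  have m1: "(\<lambda>p. ennreal (norm (G (fst p)) * norm (G (fst p + int_vec (snd p))))) \<in> borel_measurable (borel \<Otimes>\<^sub>M count_space (UNIV - {0}))"
    by measurable
  have [measurable]: "O' \<in> borel_measurable borel"
    using sigma_finite_measure.borel_measurable_nn_integral_fst[OF sf m1] by (simp add: O'_def[abs_def])
  have D: "(\<integral>\<^sup>+x. \<integral>\<^sup>+n. abs_sq (z x n) \<partial>Z2 \<partial>torus) = sqnorm lborel G"
    unfolding z_def sqnorm_def by (rule nn_integral_tiling[symmetric]) auto
  have off: "off_diagonal (z x) = (\<integral>\<^sup>+n. O' (x + int_vec n) \<partial>Z2)" for x
    by (simp add: off_diagonal_def z_def O'_def add.assoc)
  have E: "(\<integral>\<^sup>+x. off_diagonal (z x) \<partial>torus) = overlap G"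
  proof -
    have "(\<integral>\<^sup>+x. off_diagonal (z x) \<partial>torus) = (\<integral>\<^sup>+x. O' x \<partial>lborel)"
      unfolding off by (rule nn_integral_tiling[symmetric]) auto
    also have "\<dots> = overlap G"
      unfolding O'_def overlap_def by (rule nn_integral_count_space_nn_integral) auto
    finally show ?thesis .
  qed
  have offm[measurable]: "(\<lambda>x. off_diagonal (z x)) \<in> borel_measurable borel"
    unfolding off by measurable
  have zm: "(\<lambda>x. \<integral>\<^sup>+n. abs_sq (z x n) \<partial>Z2) \<in> borel_measurable borel"
    unfolding z_def by measurable
  have tm: "f \<in> borel_measurable torus" if "f \<in> borel_measurable borel" for f :: "real^2 \<Rightarrow> ennreal"
    using that by (rule borel_measurable_torus)
  have H: "(\<integral>\<^sup>+x. (\<integral>\<^sup>+n. ennreal (norm (z x n)) \<partial>Z2)\<^sup>2 \<partial>torus) = sqnorm lborel G + overlap G"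
    unfolding square_of_sum D[symmetric] E[symmetric]
    by (rule nn_integral_add[OF tm[OF zm] tm[OF offm]])
  have Hfin: "(\<integral>\<^sup>+x. (\<integral>\<^sup>+n. ennreal (norm (G (x + int_vec n))) \<partial>Z2)\<^sup>2 \<partial>torus) < \<infinity>"
    using H fin by (simp add: z_def)
  note P = Parseval_periodization[OF assms(1) Hfin]
  have S: "S = sqnorm torus (periodization G)" unfolding S_def by (rule P(2))
  have [measurable]: "periodization G \<in> borel_measurable torus"
    using borel_measurable_integrable[OF integral_tiling(2)[OF P(1)]] by (simp add: periodization_def[abs_def])
  show "S \<le> sqnorm lborel G + overlap G" using P(3) H by (simp add: S z_def)
  have "sqnorm lborel G \<le> (\<integral>\<^sup>+x. abs_sq (periodization G x) + off_diagonal (z x) \<partial>torus)"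
    unfolding D[symmetric]
  proof (rule nn_integral_mono_AE)
    have z: "z x = (\<lambda>n. G (x + int_vec n))" for x by (simp add: z_def fun_eq_iff)
    show "AE x in torus. (\<integral>\<^sup>+n. abs_sq (z x n) \<partial>Z2) \<le>
        abs_sq (periodization G x) + off_diagonal (z x)"
      using integral_tiling(1)[OF P(1)]
      by eventually_elim (unfold periodization_def z, erule diagonal_le)
  qed
  also have "\<dots> = S + overlap G"
    unfolding S E[symmetric] sqnorm_def by (rule nn_integral_add) (auto intro!: tm)
  finally show "sqnorm lborel G \<le> S + overlap G" .
qed

section \<open>Plancherel's theorem\<close>

lemma L2_iff: "f \<in> L2 \<longleftrightarrow> sq_integrable lborel f"
proof -
  have "integrable lborel (\<lambda>x. (norm (f x))\<^sup>2) \<longleftrightarrow> sqnorm lborel f < \<infinity>" if "f \<in> borel_measurable lborel"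
  proof -
    note [measurable] = that
    show ?thesis by (simp add: integrable_iff_bounded sqnorm_def)
  qed
  then show ?thesis by (auto simp: L2_def sq_integrable_def)
qed

lemma L2_norm_square: "f \<in> L2 \<Longrightarrow> ennreal ((L2_norm f)\<^sup>2) = sqnorm lborel f"
proof -
  assume f: "f \<in> L2"
  then have i: "integrable lborel (\<lambda>x. (norm (f x))\<^sup>2)" by (simp add: L2_def)
  have "(L2_norm f)\<^sup>2 = (LINT x|lborel. (norm (f x))\<^sup>2)"
    by (simp add: L2_norm_def)
  also have "ennreal \<dots> = sqnorm lborel f"
    unfolding sqnorm_def by (rule nn_integral_eq_integral[OF i, symmetric]) simp
  finally show ?thesis .
qed

lemma has_fourier_transform_iff:
  "has_fourier_transform f g \<longleftrightarrow> sq_integrable lborel f \<and> sq_integrable lborel g \<and>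
    (\<exists>F. (\<forall>n. sq_integrable lborel (F n) \<and> integrable lborel (F n)) \<and>
      L2_lim lborel F f \<and>
      L2_lim lborel (\<lambda>n. fourier_integral (F n)) g)"
  by (simp add: has_fourier_transform_def L2_iff sqnorm_def)

lemma borel_measurable_cis[measurable]: "cis \<in> borel_measurable borel"
  by (intro borel_measurable_continuous_onI continuous_intros)

lemma borel_measurable_fourier_integral[measurable]:
  assumes [measurable]: "F \<in> borel_measurable borel"
  shows "fourier_integral F \<in> borel_measurable borel"
proof -
  have "(\<lambda>p. F (snd p) * cis (- 2 * pi * (snd p \<bullet> fst p))) \<in> borel_measurable (borel \<Otimes>\<^sub>M lborel)"
    by measurable
  then show ?thesis
    unfolding fourier_integral_def[abs_def]
    by (intro lborel.borel_measurable_lebesgue_integral) (simp add: case_prod_beta')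
qed

lemma integrable_times_cis:
  assumes "integrable lborel F" and [measurable]: "h \<in> borel_measurable borel"
  shows "integrable lborel (\<lambda>x. F x * cis (h x))"
proof -
  have [measurable]: "F \<in> borel_measurable borel" using assms(1) by (auto dest: borel_measurable_integrable)
  show ?thesis
    by (rule Bochner_Integration.integrable_bound[OF assms(1)]) (auto simp: norm_mult)
qed

lemma fourier_integral_add:
  assumes "integrable lborel F" "integrable lborel G"
  shows "fourier_integral (\<lambda>x. F x + c * G x) \<xi> = fourier_integral F \<xi> + c * fourier_integral G \<xi>"
proof -
  have "fourier_integral (\<lambda>x. F x + c * G x) \<xi> =
      (LINT x|lborel. F x * cis (- 2 * pi * (x \<bullet> \<xi>)) + c * (G x * cis (- 2 * pi * (x \<bullet> \<xi>))))"
    unfolding fourier_integral_def by (intro Bochner_Integration.integral_cong) (auto simp: algebra_simps)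
  also have "\<dots> = fourier_integral F \<xi> + c * fourier_integral G \<xi>"
    unfolding fourier_integral_def
    by (subst Bochner_Integration.integral_add)
      (intro integrable_times_cis assms Bochner_Integration.integrable_mult_right, measurable)+
  finally show ?thesis .
qed

lemma fourier_integral_diff:
  assumes "integrable lborel F" "integrable lborel G"
  shows "fourier_integral (\<lambda>x. F x - G x) \<xi> = fourier_integral F \<xi> - fourier_integral G \<xi>"
  using fourier_integral_add[OF assms, of "-1"] by simp

lemma finite_int_vec_bounded: "finite {n :: int^2. \<forall>i. \<bar>n$i\<bar> \<le> k}"
proof (rule finite_imageD)
  show "finite ((\<lambda>n. (n$1, n$2)) ` {n :: int^2. \<forall>i. \<bar>n$i\<bar> \<le> k})"
    by (rule finite_subset[of _ "{-k..k} \<times> {-k..k}"]) (auto simp: abs_le_iff minus_le_iff)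
  show "inj_on (\<lambda>n. (n$1, n$2)) {n :: int^2. \<forall>i. \<bar>n$i\<bar> \<le> k}"
    by (auto simp: inj_on_def vec_eq_iff forall_2)
qed

text \<open>
  For fixed \<open>\<theta>\<close> the numbers \<open>F\<hat>(m + \<theta>)\<close> are the Fourier coefficients of the periodization of
  \<open>F(x) e\<^sup>-\<^sup>2\<^sup>\<pi>\<^sup>i\<^sup>x\<^sup>\<theta>\<close>, so that Parseval's identity computes the sum of their squares; up to a factor of
  modulus 1 this periodization is the Zak transform \<open>\<Sum> F(x + n) e\<^sup>-\<^sup>2\<^sup>\<pi>\<^sup>i\<^sup>n\<^sup>\<theta>\<close>. Integration over \<open>\<theta>\<close> turns
  the sum over \<open>m\<close> into the integral over the plane, and the orthonormality of the characters
  in \<open>\<theta>\<close> turns the Zak transform back into \<open>\<Sum> |F(x + n)|\<^sup>2\<close>.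
\<close>

lemma Plancherel_bounded_support:
  assumes F: "sq_integrable lborel F" and supp: "\<And>x. norm x > real N \<Longrightarrow> F x = 0"
  shows "sqnorm lborel (fourier_integral F) = sqnorm lborel F"
proof -
  have [measurable]: "F \<in> borel_measurable borel" using F by (simp add: sq_integrable_def)
  define I where "I = {n :: int^2. \<forall>i. \<bar>n$i\<bar> \<le> int N + 1}"
  have I: "finite I" unfolding I_def by (rule finite_int_vec_bounded)
  have F0: "F (x + int_vec n) = 0" if "x \<in> box 0 1" "n \<notin> I" for x n
  proof (rule supp)
    from that(2) obtain i where i: "\<bar>n$i\<bar> > int N + 1" by (auto simp: I_def not_le)
    have "0 < x$i" "x$i < 1" using that(1) by (auto simp: mem_box_cart)
    then have "real N < \<bar>(x + int_vec n)$i\<bar>"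
      using i by (auto simp: int_vec_def abs_if split: if_splits)
    also have "\<dots> \<le> norm (x + int_vec n)" by (rule component_le_norm_cart)
    finally show "real N < norm (x + int_vec n)" .
  qed
  have H: "(\<integral>\<^sup>+x. (\<integral>\<^sup>+n. ennreal (norm (F (x + int_vec n))) \<partial>Z2)\<^sup>2 \<partial>torus) < \<infinity>"
  proof -
    have "(\<integral>\<^sup>+x. (\<integral>\<^sup>+n. ennreal (norm (F (x + int_vec n))) \<partial>Z2)\<^sup>2 \<partial>torus) \<le>
        (\<integral>\<^sup>+x. ennreal (real (card I)) * (\<integral>\<^sup>+n. abs_sq (F (x + int_vec n)) \<partial>Z2) \<partial>torus)"
    proof (rule nn_integral_mono_AE)
      show "AE x in torus. (\<integral>\<^sup>+n. ennreal (norm (F (x + int_vec n))) \<partial>Z2)\<^sup>2 \<le>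
        ennreal (real (card I)) * (\<integral>\<^sup>+n. abs_sq (F (x + int_vec n)) \<partial>Z2)"
        using AE_torus_box
      proof eventually_elim
        case (elim x)
        have *: "(\<integral>\<^sup>+n. ennreal (h (F (x + int_vec n))) \<partial>Z2) = ennreal (\<Sum>n\<in>I. h (F (x + int_vec n)))"
          if "h 0 = 0" "\<And>z. h z \<ge> 0" for h
          using I that F0[OF elim] by (subst nn_integral_count_space'[where A = I]) auto
        have "(\<Sum>n\<in>I. norm (F (x + int_vec n)))\<^sup>2 \<le> real (card I) * (\<Sum>n\<in>I. (norm (F (x + int_vec n)))\<^sup>2)"
          using Cauchy_Schwarz_ineq_sum[of "\<lambda>_. 1" "\<lambda>n. norm (F (x + int_vec n))" I] by simp
        then show ?case
          using *[of norm] *[of "\<lambda>z. (norm z)\<^sup>2"]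
          by (simp add: ennreal_power sum_nonneg ennreal_leI flip: ennreal_mult)
      qed
    qed
    also have "\<dots> = ennreal (real (card I)) * (\<integral>\<^sup>+x. \<integral>\<^sup>+n. abs_sq (F (x + int_vec n)) \<partial>Z2 \<partial>torus)"
    proof (rule nn_integral_cmult)
      show "(\<lambda>x. \<integral>\<^sup>+n. abs_sq (F (x + int_vec n)) \<partial>Z2) \<in> borel_measurable torus"
        by (rule borel_measurable_torus) measurable
    qed
    also have "\<dots> = ennreal (real (card I)) * sqnorm lborel F"
      unfolding sqnorm_def by (subst nn_integral_tiling[symmetric]) auto
    also have "\<dots> < \<infinity>" using sqnorm_finite[OF F] by (simp add: ennreal_mult_less_top)
    finally show ?thesis .
  qed
  \<comment> \<open>the complex conjugate of the Zak transform, which is a trigonometric polynomial in \<open>\<theta>\<close>\<close>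
  define Z where "Z x \<theta> = (\<Sum>n\<in>I. cnj (F (x + int_vec n)) * character n \<theta>)" for x \<theta>
  define G where "G \<theta> x = F x * cis (- 2 * pi * (x \<bullet> \<theta>))" for \<theta> x
  have [measurable]: "G \<theta> \<in> borel_measurable borel" for \<theta> unfolding G_def by measurable
  have normG: "norm (G \<theta> x) = norm (F x)" for \<theta> x by (simp add: G_def norm_mult)
  have coeff: "(LINT x|lborel. G \<theta> x * cnj (character m x)) = fourier_integral F (\<theta> + int_vec m)" for \<theta> m
    unfolding fourier_integral_def G_def
    by (intro Bochner_Integration.integral_cong) (auto simp: character_def cis_cnj cis_mult algebra_simps inner_add_right)
  have per: "norm (periodization (G \<theta>) x) = norm (Z x \<theta>)" if "x \<in> box 0 1" for \<theta> x
  proof -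
    have "{n \<in> UNIV. G \<theta> (x + int_vec n) \<noteq> 0} \<subseteq> I" using F0[OF that] by (auto simp: G_def)
    then have "periodization (G \<theta>) x = (\<Sum>n\<in>I. G \<theta> (x + int_vec n))"
      unfolding periodization_def using I
      by (subst lebesgue_integral_count_space_finite_support)
        (auto intro!: sum.mono_neutral_left intro: finite_subset)
    also have "\<dots> = (\<Sum>n\<in>I. cis (- 2 * pi * (x \<bullet> \<theta>)) * cnj (cnj (F (x + int_vec n)) * character n \<theta>))"
      by (intro sum.cong refl)
        (auto simp: G_def character_def cis_cnj cis_mult algebra_simps inner_add_left inner_commute)
    also have "\<dots> = cis (- 2 * pi * (x \<bullet> \<theta>)) * cnj (Z x \<theta>)"
      by (simp add: Z_def sum_distrib_left)
    finally show ?thesis by (simp add: norm_mult)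
  qed
  interpret TT: pair_sigma_finite torus torus by standard
  have Zm: "(\<lambda>p. abs_sq (Z (fst p) (snd p))) \<in> borel_measurable (torus \<Otimes>\<^sub>M torus)"
    unfolding Z_def by measurable
  have "sqnorm lborel (fourier_integral F) =
      (\<integral>\<^sup>+\<theta>. \<integral>\<^sup>+m. abs_sq (fourier_integral F (\<theta> + int_vec m)) \<partial>Z2 \<partial>torus)"
    unfolding sqnorm_def by (rule nn_integral_tiling) measurable
  also have "\<dots> = (\<integral>\<^sup>+\<theta>. sqnorm torus (periodization (G \<theta>)) \<partial>torus)"
  proof (rule nn_integral_cong)
    fix \<theta>
    show "(\<integral>\<^sup>+m. abs_sq (fourier_integral F (\<theta> + int_vec m)) \<partial>Z2) = sqnorm torus (periodization (G \<theta>))"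
      unfolding coeff[symmetric] by (rule Parseval_periodization(2)) (use H in \<open>auto simp: normG\<close>)
  qed
  also have "\<dots> = (\<integral>\<^sup>+\<theta>. \<integral>\<^sup>+x. abs_sq (Z x \<theta>) \<partial>torus \<partial>torus)"
    unfolding sqnorm_def
  proof (rule nn_integral_cong)
    fix \<theta>
    show "(\<integral>\<^sup>+x. abs_sq (periodization (G \<theta>) x) \<partial>torus) = (\<integral>\<^sup>+x. abs_sq (Z x \<theta>) \<partial>torus)"
      by (rule nn_integral_cong_AE) (use AE_torus_box in eventually_elim, simp add: per)
  qed
  also have "\<dots> = (\<integral>\<^sup>+x. \<integral>\<^sup>+\<theta>. abs_sq (Z x \<theta>) \<partial>torus \<partial>torus)"
    using TT.Fubini[OF Zm] by simp
  also have "\<dots> = (\<integral>\<^sup>+x. ennreal (\<Sum>n\<in>I. (norm (F (x + int_vec n)))\<^sup>2) \<partial>torus)"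
    unfolding Z_def sqnorm_character_sum[OF I, unfolded sqnorm_def] by simp
  also have "\<dots> = (\<integral>\<^sup>+x. \<integral>\<^sup>+n. abs_sq (F (x + int_vec n)) \<partial>Z2 \<partial>torus)"
    by (rule nn_integral_cong_AE, use AE_torus_box in eventually_elim)
      (use I F0 in \<open>subst nn_integral_count_space'[where A = I], auto\<close>)
  also have "\<dots> = sqnorm lborel F"
    unfolding sqnorm_def by (rule nn_integral_tiling[symmetric]) auto
  finally show ?thesis .
qed

definition truncation :: "nat \<Rightarrow> (real^2 \<Rightarrow> complex) \<Rightarrow> real^2 \<Rightarrow> complex" where
  "truncation N f x = of_real (indicator (cball 0 (real N)) x) * f x"

lemma borel_measurable_truncation[measurable]:
  "f \<in> borel_measurable borel \<Longrightarrow> truncation N f \<in> borel_measurable borel"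
proof -
  assume [measurable]: "f \<in> borel_measurable borel"
  have [measurable]: "cball (0::real^2) (real N) \<in> sets borel" by simp
  show ?thesis unfolding truncation_def[abs_def] by measurable
qed

lemma norm_truncation_le: "norm (truncation N f x) \<le> norm (f x)"
  by (auto simp: truncation_def norm_mult indicator_def)

lemma truncation_tendsto: "(\<lambda>N. truncation N f x) \<longlonglongrightarrow> f x"
proof -
  obtain N :: nat where N: "norm x \<le> real N" using real_arch_simple by blast
  have "truncation n f x = f x" if "n \<ge> N" for n
    using that N by (auto simp: truncation_def indicator_def)
  then show ?thesis by (intro tendsto_eventually) (auto simp: eventually_sequentially)
qed

lemma sq_integrable_truncation: "sq_integrable lborel f \<Longrightarrow> sq_integrable lborel (truncation N f)"
  unfolding truncation_def[abs_def]
  by (rule sq_integrable_bounded_mult) (auto simp: indicator_def)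

lemma integrable_truncation:
  assumes "sq_integrable lborel f"
  shows "integrable lborel (truncation N f)"
proof -
  have "emeasure lborel (cball 0 (real N) :: (real^2) set) < \<infinity>"
    by (rule emeasure_compact_finite) simp
  then have "sq_integrable lborel (\<lambda>x :: real^2. of_real (indicator (cball 0 (real N)) x))"
  proof -
    have "sqnorm lborel (\<lambda>x :: real^2. of_real (indicator (cball 0 (real N)) x)) =
        (\<integral>\<^sup>+x. indicator (cball (0 :: real^2) (real N)) x \<partial>lborel)"
      unfolding sqnorm_def by (intro nn_integral_cong) (auto simp: indicator_def)
    with \<open>emeasure lborel (cball 0 (real N) :: (real^2) set) < \<infinity>\<close>
    have "sqnorm lborel (\<lambda>x :: real^2. of_real (indicator (cball 0 (real N)) x)) < \<infinity>" by simp
    moreover have [measurable]: "cball (0::real^2) (real N) \<in> sets borel" by simp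
    have "(\<lambda>x :: real^2. complex_of_real (indicator (cball 0 (real N)) x)) \<in> borel_measurable lborel" by measurable
    ultimately show ?thesis by (simp only: sq_integrable_def) 
  qed
  from integrable_ip[OF assms this] show ?thesis
    by (simp add: truncation_def[abs_def] mult.commute)
qed

lemma truncation_sqnorm_tendsto:
  assumes "sq_integrable lborel f"
  shows "L2_lim lborel (\<lambda>N. truncation N f) f"
proof (rule sqnorm_dominated_tendsto[where F = "\<lambda>N. truncation N f", OF _ _ assms norm_truncation_le truncation_tendsto])
  show "truncation n f \<in> borel_measurable lborel" "f \<in> borel_measurable lborel" for n
    using assms by (auto simp: sq_integrable_def)
qed

text \<open>
  Differences of truncations have bounded support, so their Fourier integrals have the same norm. Hence the
  Fourier integrals of the truncations form a Cauchy sequence.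
\<close>

lemma sqnorm_fourier_truncation_diff_le:
  assumes f: "sq_integrable lborel f" and "N \<le> m" "N \<le> n"
  shows "sqnorm lborel (\<lambda>\<xi>. fourier_integral (truncation m f) \<xi> - fourier_integral (truncation n f) \<xi>)
    \<le> sqnorm lborel (\<lambda>x. truncation N f x - f x)"
proof -
  have "sqnorm lborel (\<lambda>\<xi>. fourier_integral (truncation m f) \<xi> - fourier_integral (truncation n f) \<xi>)
    = sqnorm lborel (fourier_integral (\<lambda>x. truncation m f x - truncation n f x))"
    by (simp add: sqnorm_def fourier_integral_diff integrable_truncation f)
  also have "\<dots> = sqnorm lborel (\<lambda>x. truncation m f x - truncation n f x)"
  proof (rule Plancherel_bounded_support[where N = "max m n"])
    show "sq_integrable lborel (\<lambda>x. truncation m f x - truncation n f x)"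
      by (intro sq_integrable_diff sq_integrable_truncation f)
  qed (auto simp: truncation_def)
  also have "\<dots> \<le> sqnorm lborel (\<lambda>x. truncation N f x - f x)"
    unfolding sqnorm_def
    by (intro nn_integral_mono ennreal_leI power_mono) (use assms(2,3) in \<open>auto simp: truncation_def indicator_def\<close>)
  finally show ?thesis .
qed

lemma fourier_truncation_tendsto:
  assumes "integrable lborel f"
  shows "(\<lambda>N. fourier_integral (truncation N f) \<xi>) \<longlonglongrightarrow> fourier_integral f \<xi>"
  unfolding fourier_integral_def
proof (rule integral_dominated_convergence[where w = "\<lambda>x. norm (f x)"])
  have [measurable]: "f \<in> borel_measurable borel" using assms by (auto dest: borel_measurable_integrable)
  show "(\<lambda>x. f x * cis (- 2 * pi * (x \<bullet> \<xi>))) \<in> borel_measurable lborel"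
    "(\<lambda>x. truncation n f x * cis (- 2 * pi * (x \<bullet> \<xi>))) \<in> borel_measurable lborel" for n
    by measurable
  show "integrable lborel (\<lambda>x. norm (f x))" using assms by simp
qed (auto simp: norm_mult norm_truncation_le intro!: tendsto_intros truncation_tendsto)

text \<open>
  The Fourier integrals of the truncations converge pointwise to that of \<open>f\<close>, since \<open>f\<close> is integrable,
  and they form a Cauchy sequence in \<open>L\<^sup>2\<close>. Fatou's lemma shows that the two limits agree.
\<close>

lemma Plancherel_L1_L2:
  assumes f: "sq_integrable lborel f" and i: "integrable lborel f"
  shows "sq_integrable lborel (fourier_integral f)"
    and "sqnorm lborel (fourier_integral f) = sqnorm lborel f"
proof -
  have [measurable]: "f \<in> borel_measurable borel" using f by (simp add: sq_integrable_def)
  have sq: "sqnorm lborel (fourier_integral (truncation n f)) = sqnorm lborel (truncation n f)" for n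
    by (rule Plancherel_bounded_support[where N = n])
      (rule sq_integrable_truncation[OF f], simp add: truncation_def)
  then have sqi: "sq_integrable lborel (fourier_integral (truncation n f))" for n
    using sq_integrable_truncation[OF f, of n] by (simp add: sq_integrable_def)
  have le: "sqnorm lborel (\<lambda>\<xi>. fourier_integral f \<xi> - fourier_integral (truncation N f) \<xi>)
    \<le> sqnorm lborel (\<lambda>x. truncation N f x - f x)" for N
  proof (rule sqnorm_Fatou)
    show "\<forall>\<^sub>F n in sequentially. sqnorm lborel (\<lambda>\<xi>. fourier_integral (truncation n f) \<xi> - fourier_integral (truncation N f) \<xi>)
        \<le> sqnorm lborel (\<lambda>x. truncation N f x - f x)"
      using eventually_ge_at_top[of N]
      by eventually_elim (rule sqnorm_fourier_truncation_diff_le[OF f], auto)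
    show "AE \<xi> in lborel. (\<lambda>n. fourier_integral (truncation n f) \<xi> - fourier_integral (truncation N f) \<xi>)
        \<longlonglongrightarrow> fourier_integral f \<xi> - fourier_integral (truncation N f) \<xi>"
      by (intro AE_I2 tendsto_intros fourier_truncation_tendsto i)
  qed auto
  have lim: "L2_lim lborel (\<lambda>N. fourier_integral (truncation N f)) (fourier_integral f)"
    by (rule tendsto_sandwich[OF _ _ tendsto_const truncation_sqnorm_tendsto[OF f]])
      (use le in \<open>auto simp: sqnorm_minus_commute[of _ "fourier_integral (truncation _ f)"]\<close>)
  have "sqnorm lborel (\<lambda>x. truncation 0 f x - f x) < \<infinity>"
    by (intro sqnorm_finite sq_integrable_diff sq_integrable_truncation f)
  then have "sq_integrable lborel (\<lambda>\<xi>. fourier_integral f \<xi> - fourier_integral (truncation 0 f) \<xi>)"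
    using le[of 0] by (auto simp: sq_integrable_def intro: le_less_trans)
  from sq_integrable_add[OF this sqi[of 0]] show sqf: "sq_integrable lborel (fourier_integral f)" by simp
  have "(\<lambda>N. sqnorm lborel (truncation N f)) \<longlonglongrightarrow> sqnorm lborel (fourier_integral f)"
    using sqnorm_tendsto[OF sqi sqf lim] by (simp add: sq)
  moreover have "(\<lambda>N. sqnorm lborel (truncation N f)) \<longlonglongrightarrow> sqnorm lborel f"
    by (intro sqnorm_tendsto sq_integrable_truncation f truncation_sqnorm_tendsto)
  ultimately show "sqnorm lborel (fourier_integral f) = sqnorm lborel f"
    by (rule LIMSEQ_unique)
qed

lemma has_fourier_transform_exists:
  assumes "f \<in> L2"
  shows "\<exists>g. has_fourier_transform f g"
proof -
  have f: "sq_integrable lborel f" using assms by (simp add: L2_iff)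
  have [measurable]: "f \<in> borel_measurable borel" using f by (simp add: sq_integrable_def)
  have "\<exists>h\<in>borel_measurable lborel. L2_lim lborel (\<lambda>n. fourier_integral (truncation n f)) h"
  proof (rule sqnorm_complete)
    fix e :: real assume "e > 0"
    then have "\<forall>\<^sub>F N in sequentially. sqnorm lborel (\<lambda>x. truncation N f x - f x) < ennreal e"
      by (intro order_tendstoD(2)[OF truncation_sqnorm_tendsto[OF f]]) simp
    then obtain N where "sqnorm lborel (\<lambda>x. truncation N f x - f x) < ennreal e"
      by (auto simp: eventually_sequentially)
    then show "\<exists>N. \<forall>m\<ge>N. \<forall>n\<ge>N. sqnorm lborel (\<lambda>\<xi>. fourier_integral (truncation m f) \<xi> - fourier_integral (truncation n f) \<xi>) \<le> ennreal e"
      by (intro exI[of _ N] allI impI order_trans[OF sqnorm_fourier_truncation_diff_le[OF f]]) auto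
  qed simp
  then obtain h where h[measurable]: "h \<in> borel_measurable lborel"
    and lim: "L2_lim lborel (\<lambda>n. fourier_integral (truncation n f)) h" by blast
  have "\<forall>\<^sub>F n in sequentially. sqnorm lborel (\<lambda>\<xi>. fourier_integral (truncation n f) \<xi> - h \<xi>) < 1"
    by (rule order_tendstoD(2)[OF lim]) simp
  then obtain n where n: "sqnorm lborel (\<lambda>\<xi>. fourier_integral (truncation n f) \<xi> - h \<xi>) < 1"
    by (auto simp: eventually_sequentially)
  have "sq_integrable lborel (\<lambda>\<xi>. fourier_integral (truncation n f) \<xi> - h \<xi>)"
    using n by (auto simp: sq_integrable_def intro: less_trans)
  from sq_integrable_diff[OF Plancherel_L1_L2(1)[OF sq_integrable_truncation[OF f] integrable_truncation[OF f], of n] this]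
  have "sq_integrable lborel h" by simp
  with lim f truncation_sqnorm_tendsto[OF f] have "has_fourier_transform f h"
    unfolding has_fourier_transform_iff
    by (intro conjI exI[of _ "\<lambda>n. truncation n f"] allI sq_integrable_truncation integrable_truncation)
  then show ?thesis by blast
qed

lemma has_fourier_transform_fourier: "f \<in> L2 \<Longrightarrow> has_fourier_transform f (fourier f)"
  unfolding fourier_def using has_fourier_transform_exists by (rule someI_ex)

text \<open>
  On integrable functions the Fourier transform is given by an integral and hence linear, so polarization applies to
  the approximating sequences; the inner products of their limits follow by continuity.
\<close>

lemma Parseval_L1_L2:
  assumes f: "sq_integrable lborel f" "integrable lborel f" and g: "sq_integrable lborel g" "integrable lborel g"
  shows "ip lborel (fourier_integral f) (fourier_integral g) = ip lborel f g"
proof (rule ip_polarization)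
  fix c
  have "sqnorm lborel (fourier_integral (\<lambda>x. f x + c * g x)) = sqnorm lborel (\<lambda>x. f x + c * g x)"
    using f g by (intro Plancherel_L1_L2 sq_integrable_add sq_integrable_cmult) auto
  moreover have "fourier_integral (\<lambda>x. f x + c * g x) = (\<lambda>\<xi>. fourier_integral f \<xi> + c * fourier_integral g \<xi>)"
    by (simp add: fun_eq_iff fourier_integral_add f g)
  ultimately show "sqnorm lborel (\<lambda>\<xi>. fourier_integral f \<xi> + c * fourier_integral g \<xi>) = sqnorm lborel (\<lambda>x. f x + c * g x)"
    by simp
qed (rule Plancherel_L1_L2 f g)+

theorem Parseval:
  assumes "has_fourier_transform f f'" "has_fourier_transform g g'"
  shows "ip lborel f g = ip lborel f' g'"
proof -
  obtain F where F: "sq_integrable lborel f" "sq_integrable lborel f'"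
    "\<And>n. sq_integrable lborel (F n)" "\<And>n. integrable lborel (F n)"
    "L2_lim lborel F f" "L2_lim lborel (\<lambda>n. fourier_integral (F n)) f'"
    using assms(1) by (auto simp: has_fourier_transform_iff)
  obtain G where G: "sq_integrable lborel g" "sq_integrable lborel g'"
    "\<And>n. sq_integrable lborel (G n)" "\<And>n. integrable lborel (G n)"
    "L2_lim lborel G g" "L2_lim lborel (\<lambda>n. fourier_integral (G n)) g'"
    using assms(2) by (auto simp: has_fourier_transform_iff)
  have "(\<lambda>n. ip lborel (F n) (G n)) \<longlonglongrightarrow> ip lborel f g" by (rule ip_tendsto) (rule F G)+
  moreover have "(\<lambda>n. ip lborel (fourier_integral (F n)) (fourier_integral (G n))) \<longlonglongrightarrow> ip lborel f' g'"
    by (rule ip_tendsto) (rule F G Plancherel_L1_L2)+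
  ultimately show ?thesis by (simp add: Parseval_L1_L2 F G LIMSEQ_unique)
qed

corollary Plancherel:
  assumes "has_fourier_transform f g"
  shows "sqnorm lborel f = sqnorm lborel g"
  using assms Parseval[OF assms assms] by (simp add: sqnorm_eq_ip has_fourier_transform_iff)

section \<open>Affine changes of variables\<close>

text \<open>
  It suffices to compare the two measures on boxes. The preimage of a box under \<open>B\<close> is its image under the
  inverse matrix, whose volume is known.
\<close>

lemma lborel_linear:
  fixes B :: "real^2^2"
  assumes "det B \<noteq> 0"
  shows "lborel = density (distr lborel borel ((*v) B)) (\<lambda>_. ennreal \<bar>det B\<bar>)"
proof (rule lborel_eqI)
  obtain W where W: "B ** W = mat 1" "W ** B = mat 1"
    using assms by (metis invertible_def invertible_det_nz)
  have det: "\<bar>det B\<bar> * \<bar>det W\<bar> = 1"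
    using arg_cong[OF W(1), of det] by (simp add: det_mul flip: abs_mult)
  have [measurable]: "(*v) B \<in> borel_measurable borel"
    by (intro borel_measurable_continuous_onI linear_continuous_on matrix_vector_mul_bounded_linear)
  fix l u :: "real^2" assume lu: "\<And>b. b \<in> Basis \<Longrightarrow> l \<bullet> b \<le> u \<bullet> b"
  have pre: "(*v) B -` box l u = (*v) W ` box l u"
  proof (intro set_eqI iffI)
    fix x assume "x \<in> (*v) B -` box l u"
    moreover have "x = W *v (B *v x)" by (simp add: matrix_vector_mul_assoc W)
    ultimately show "x \<in> (*v) W ` box l u" by blast
  next
    fix y assume "y \<in> (*v) W ` box l u"
    then show "y \<in> (*v) B -` box l u" by (auto simp: matrix_vector_mul_assoc W)
  qed
  have bdd: "bounded ((*v) W ` box l u)"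
    by (intro bounded_linear_image bounded_box matrix_vector_mul_bounded_linear)
  have borel: "(*v) W ` box l u \<in> sets borel"
    unfolding pre[symmetric] using measurable_sets[of "(*v) B" borel borel "box l u"] by simp
  have "emeasure lborel ((*v) W ` box l u) = ennreal (measure lborel ((*v) W ` box l u))"
    by (rule emeasure_eq_ennreal_measure) (use emeasure_bounded_finite[OF bdd] in auto)
  also have "measure lborel ((*v) W ` box l u) = measure lebesgue ((*v) W ` box l u)"
    using borel by (simp add: measure_completion)
  also have "\<dots> = \<bar>det W\<bar> * measure lebesgue (box l u)"
    by (subst measure_lebesgue_linear_transformation) (auto simp: matrix_of_matrix_vector_mul)
  also have "measure lebesgue (box l u) = (\<Prod>b\<in>Basis. (u - l) \<bullet> b)"
    using lu by (simp add: measure_completion measure_lborel_box)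
  finally have em: "emeasure lborel ((*v) W ` box l u) = ennreal (\<bar>det W\<bar> * (\<Prod>b\<in>Basis. (u - l) \<bullet> b))" .
  have nn: "0 \<le> (\<Prod>b\<in>Basis. (u - l) \<bullet> b)"
    using lu by (intro prod_nonneg) (auto simp: inner_diff_left)
  have "emeasure (density (distr lborel borel ((*v) B)) (\<lambda>_. ennreal \<bar>det B\<bar>)) (box l u) =
      ennreal \<bar>det B\<bar> * emeasure lborel ((*v) B -` box l u)"
    by (subst emeasure_density) (auto simp: nn_integral_cmult emeasure_distr)
  also have "\<dots> = ennreal (\<bar>det B\<bar> * \<bar>det W\<bar> * (\<Prod>b\<in>Basis. (u - l) \<bullet> b))"
    unfolding pre em using nn by (simp add: mult.assoc flip: ennreal_mult)
  finally show "emeasure (density (distr lborel borel ((*v) B)) (\<lambda>_. ennreal \<bar>det B\<bar>)) (box l u) =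
      ennreal (\<Prod>b\<in>Basis. (u - l) \<bullet> b)" by (simp add: det)
qed simp

lemma borel_measurable_matrix[measurable]: "(*v) (B :: real^2^2) \<in> borel_measurable borel"
  by (intro borel_measurable_continuous_onI linear_continuous_on matrix_vector_mul_bounded_linear)

lemma lborel_affine_matrix:
  fixes B :: "real^2^2"
  assumes "det B \<noteq> 0"
  shows "lborel = density (distr lborel borel (\<lambda>x. B *v x - v)) (\<lambda>_. ennreal \<bar>det B\<bar>)"
proof -
  have "(lborel :: (real^2) measure) = distr lborel borel ((+) (- v))"
    by (rule lborel_distr_plus[symmetric])
  also have "\<dots> = distr (density (distr lborel borel ((*v) B)) (\<lambda>_. ennreal \<bar>det B\<bar>)) borel ((+) (- v))"
    by (subst lborel_linear[OF assms]) (rule refl)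
  also have "\<dots> = density (distr lborel borel (\<lambda>x. B *v x - v)) (\<lambda>_. ennreal \<bar>det B\<bar>)"
    by (subst density_distr[symmetric]; simp add: distr_distr o_def)?
  finally show ?thesis .
qed

lemma nn_integral_affine:
  fixes B :: "real^2^2"
  assumes "det B \<noteq> 0" and [measurable]: "h \<in> borel_measurable borel"
  shows "(\<integral>\<^sup>+x. h x \<partial>lborel) = ennreal \<bar>det B\<bar> * (\<integral>\<^sup>+x. h (B *v x - v) \<partial>lborel)"
proof -
  have "(\<integral>\<^sup>+x. h x \<partial>lborel) = (\<integral>\<^sup>+x. h x \<partial>density (distr lborel borel (\<lambda>x. B *v x - v)) (\<lambda>_. ennreal \<bar>det B\<bar>))"
    by (subst lborel_affine_matrix[OF assms(1)]) (rule refl)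
  also have "\<dots> = (\<integral>\<^sup>+x. ennreal \<bar>det B\<bar> * h x \<partial>distr lborel borel (\<lambda>x. B *v x - v))"
    by (rule nn_integral_density) auto
  also have "\<dots> = ennreal \<bar>det B\<bar> * (\<integral>\<^sup>+x. h (B *v x - v) \<partial>lborel)"
    by (subst nn_integral_distr) (auto simp: nn_integral_cmult)
  finally show ?thesis .
qed

lemma integral_affine:
  fixes B :: "real^2^2" and h :: "real^2 \<Rightarrow> complex"
  assumes "det B \<noteq> 0" and [measurable]: "h \<in> borel_measurable borel"
  shows "(LINT x|lborel. h x) = of_real \<bar>det B\<bar> * (LINT x|lborel. h (B *v x - v))"
proof -
  have "(LINT x|lborel. h x) = (LINT x|density (distr lborel borel (\<lambda>x. B *v x - v)) (\<lambda>_. ennreal \<bar>det B\<bar>). h x)"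
    by (subst lborel_affine_matrix[OF assms(1)]) (rule refl)
  also have "\<dots> = (LINT x|distr lborel borel (\<lambda>x. B *v x - v). \<bar>det B\<bar> *\<^sub>R h x)"
    by (rule integral_density) auto
  also have "\<dots> = (LINT x|lborel. \<bar>det B\<bar> *\<^sub>R h (B *v x - v))"
    by (rule integral_distr) auto
  finally show ?thesis by (simp add: scaleR_conv_of_real)
qed

lemma sqnorm_affine:
  fixes B :: "real^2^2"
  assumes "det B \<noteq> 0" and [measurable]: "h \<in> borel_measurable borel" and w: "\<And>x. norm (w x) = k"
  shows "sqnorm lborel (\<lambda>x. w x * h (B *v x - v)) = ennreal (k\<^sup>2 / \<bar>det B\<bar>) * sqnorm lborel h"
proof -
  have "sqnorm lborel (\<lambda>x. w x * h (B *v x - v)) = ennreal (k\<^sup>2) * (\<integral>\<^sup>+x. abs_sq (h (B *v x - v)) \<partial>lborel)"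
    by (simp add: sqnorm_def norm_mult w power_mult_distrib ennreal_mult nn_integral_cmult)
  also have "ennreal (k\<^sup>2) = ennreal (k\<^sup>2 / \<bar>det B\<bar>) * ennreal \<bar>det B\<bar>"
    using assms(1) by (subst ennreal_mult[symmetric]) auto
  finally show ?thesis
    unfolding sqnorm_def by (subst nn_integral_affine[OF assms(1), where v = v]) (auto simp: mult.assoc)
qed

lemma L2_lim_affine:
  fixes B :: "real^2^2"
  assumes "L2_lim lborel F f" "det B \<noteq> 0" "\<And>x. norm (w x) = k"
    and [measurable]: "\<And>n. F n \<in> borel_measurable borel" "f \<in> borel_measurable borel"
  shows "L2_lim lborel (\<lambda>n x. w x * F n (B *v x - v)) (\<lambda>x. w x * f (B *v x - v))"
proof -
  have "sqnorm lborel (\<lambda>x. w x * F n (B *v x - v) - w x * f (B *v x - v)) =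
      ennreal (k\<^sup>2 / \<bar>det B\<bar>) * sqnorm lborel (\<lambda>x. F n x - f x)" for n
    using sqnorm_affine[where h = "\<lambda>x. F n x - f x" and v = v, OF assms(2) _ assms(3)] by (simp add: right_diff_distrib)
  moreover have "(\<lambda>n. ennreal (k\<^sup>2 / \<bar>det B\<bar>) * sqnorm lborel (\<lambda>x. F n x - f x)) \<longlonglongrightarrow> ennreal (k\<^sup>2 / \<bar>det B\<bar>) * 0"
    by (intro ennreal_tendsto_cmult assms(1)) simp
  ultimately show ?thesis by simp
qed

lemma integrable_affine:
  fixes B :: "real^2^2" and h :: "real^2 \<Rightarrow> complex"
  assumes "det B \<noteq> 0" "integrable lborel h"
  shows "integrable lborel (\<lambda>x. h (B *v x - v))"
proof -
  have [measurable]: "h \<in> borel_measurable borel" using assms(2) by (auto dest: borel_measurable_integrable)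
  have fin: "ennreal \<bar>det B\<bar> * (\<integral>\<^sup>+x. ennreal (norm (h (B *v x - v))) \<partial>lborel) < \<infinity>"
    using assms(2) by (subst nn_integral_affine[OF assms(1), symmetric]) (auto simp: integrable_iff_bounded)
  show ?thesis
  proof (rule integrableI_bounded)
    show "(\<integral>\<^sup>+x. ennreal (norm (h (B *v x - v))) \<partial>lborel) < \<infinity>"
      using fin assms(1) by (auto simp: ennreal_mult_less_top)
  qed measurable
qed

lemma sq_integrable_affine:
  fixes B :: "real^2^2"
  assumes "sq_integrable lborel h" "det B \<noteq> 0" and [measurable]: "w \<in> borel_measurable borel" and w: "\<And>x. norm (w x) = k"
  shows "sq_integrable lborel (\<lambda>x. w x * h (B *v x - v))"
proof -
  have [measurable]: "h \<in> borel_measurable borel" using assms(1) by (simp add: sq_integrable_def)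
  show ?thesis
    using sqnorm_finite[OF assms(1)] sqnorm_affine[OF assms(2) _ w, where h = h]
    by (simp add: sq_integrable_def ennreal_mult_less_top)
qed

text \<open>
  The matrix \<open>T\<close> is the inverse transpose of \<open>B\<close>, which the identity \<open>\<langle>B x, T \<xi>\<rangle> = \<langle>x, \<xi>\<rangle>\<close> expresses
  without inverses.
\<close>

lemma has_fourier_transform_affine:
  fixes B T :: "real^2^2"
  assumes ft: "has_fourier_transform \<psi> u" and det: "det B \<noteq> 0" "det T \<noteq> 0"
    and adj: "\<And>x \<xi>. (B *v x) \<bullet> (T *v \<xi>) = x \<bullet> \<xi>"
  shows "has_fourier_transform (\<lambda>x. \<kappa> * \<psi> (B *v x - v))
    (\<lambda>\<xi>. (\<kappa> / of_real \<bar>det B\<bar> * cis (- 2 * pi * (v \<bullet> (T *v \<xi>)))) * u (T *v \<xi>))"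
proof -
  obtain F where F: "sq_integrable lborel \<psi>" "sq_integrable lborel u"
    "\<And>n. sq_integrable lborel (F n)" "\<And>n. integrable lborel (F n)"
    "L2_lim lborel F \<psi>" "L2_lim lborel (\<lambda>n. fourier_integral (F n)) u"
    using ft by (auto simp: has_fourier_transform_iff)
  have [measurable]: "\<psi> \<in> borel_measurable borel" "u \<in> borel_measurable borel" "F n \<in> borel_measurable borel" for n
    using F(1-3) by (auto simp: sq_integrable_def)
  define w where "w \<xi> = \<kappa> / of_real \<bar>det B\<bar> * cis (- 2 * pi * (v \<bullet> (T *v \<xi>)))" for \<xi>
  have normw: "norm (w \<xi>) = norm \<kappa> / \<bar>det B\<bar>" for \<xi> by (simp add: w_def norm_mult norm_divide)
  have [measurable]: "w \<in> borel_measurable borel" unfolding w_def[abs_def] by measurable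
  have fi: "fourier_integral (\<lambda>x. \<kappa> * F n (B *v x - v)) \<xi> = w \<xi> * fourier_integral (F n) (T *v \<xi>)" for n \<xi>
  proof -
    have inner: "x \<bullet> \<xi> = (B *v x - v) \<bullet> (T *v \<xi>) + v \<bullet> (T *v \<xi>)" for x
      by (simp add: inner_diff_left adj)
    have "fourier_integral (\<lambda>x. \<kappa> * F n (B *v x - v)) \<xi> =
        (LINT x|lborel. \<kappa> * cis (- 2 * pi * (v \<bullet> (T *v \<xi>))) *
          (F n (B *v x - v) * cis (- 2 * pi * ((B *v x - v) \<bullet> (T *v \<xi>)))))"
      unfolding fourier_integral_def
    proof (intro Bochner_Integration.integral_cong refl)
      fix x
      have "cis (- 2 * pi * (x \<bullet> \<xi>)) = cis (- 2 * pi * (v \<bullet> (T *v \<xi>))) * cis (- 2 * pi * ((B *v x - v) \<bullet> (T *v \<xi>)))"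
        unfolding cis_mult by (subst inner[of x]) (simp add: algebra_simps)
      then show "\<kappa> * F n (B *v x - v) * cis (- 2 * pi * (x \<bullet> \<xi>)) = \<kappa> * cis (- 2 * pi * (v \<bullet> (T *v \<xi>))) *
          (F n (B *v x - v) * cis (- 2 * pi * ((B *v x - v) \<bullet> (T *v \<xi>))))" by simp
    qed
    also have "\<dots> = \<kappa> * cis (- 2 * pi * (v \<bullet> (T *v \<xi>))) *
        (LINT x|lborel. F n (B *v x - v) * cis (- 2 * pi * ((B *v x - v) \<bullet> (T *v \<xi>))))"
      by simp
    also have "(LINT x|lborel. F n (B *v x - v) * cis (- 2 * pi * ((B *v x - v) \<bullet> (T *v \<xi>)))) =
        fourier_integral (F n) (T *v \<xi>) / of_real \<bar>det B\<bar>"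
      unfolding fourier_integral_def using det(1)
      by (subst integral_affine[OF det(1), of "\<lambda>x. F n x * cis (- 2 * pi * (x \<bullet> (T *v \<xi>)))" v]) auto
    finally show ?thesis by (simp add: w_def)
  qed
  have "L2_lim lborel (\<lambda>n. fourier_integral (\<lambda>x. \<kappa> * F n (B *v x - v))) (\<lambda>\<xi>. w \<xi> * u (T *v \<xi>))"
    using L2_lim_affine[where v = 0, OF F(6) det(2) normw] by (simp add: fi)
  moreover have "sq_integrable lborel (\<lambda>\<xi>. w \<xi> * u (T *v \<xi>))"
    using sq_integrable_affine[where v = 0, OF F(2) det(2) _ normw] by simp
  ultimately show ?thesis
    unfolding has_fourier_transform_iff w_def
    by (intro conjI exI[of _ "\<lambda>n x. \<kappa> * F n (B *v x - v)"] allI sq_integrable_affine[where k = "norm \<kappa>"]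
        L2_lim_affine[where k = "norm \<kappa>"] Bochner_Integration.integrable_mult_right integrable_affine det F) auto
qed

section \<open>Fourier inversion\<close>

text \<open>
  The adjoint of the Fourier integral is the inverse Fourier integral, by Fubini's theorem for
  \<open>F(x) e\<^sup>-\<^sup>2\<^sup>\<pi>\<^sup>i\<^sup>x\<^sup>\<xi> cnj (g(\<xi>))\<close>.
\<close>

lemma fourier_integral_adjoint:
  assumes F: "integrable lborel F" and g: "integrable lborel g"
  shows "ip lborel (fourier_integral F) g = ip lborel F (\<lambda>x. fourier_integral g (- x))"
proof -
  have [measurable]: "F \<in> borel_measurable borel" "g \<in> borel_measurable borel"
    using F g by (auto dest: borel_measurable_integrable)
  define k where "k x \<xi> = F x * cis (- 2 * pi * (x \<bullet> \<xi>)) * cnj (g \<xi>)" for x \<xi>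
  have km: "(\<lambda>p. k (fst p) (snd p)) \<in> borel_measurable (lborel \<Otimes>\<^sub>M lborel)"
    unfolding k_def by measurable
  have int: "integrable (lborel \<Otimes>\<^sub>M lborel) (\<lambda>(x, \<xi>). k x \<xi>)"
  proof (rule integrableI_bounded)
    have "(\<integral>\<^sup>+p. ennreal (norm (case p of (x, \<xi>) \<Rightarrow> k x \<xi>)) \<partial>(lborel \<Otimes>\<^sub>M lborel)) =
        (\<integral>\<^sup>+x. \<integral>\<^sup>+\<xi>. ennreal (norm (F x)) * ennreal (norm (g \<xi>)) \<partial>lborel \<partial>lborel)"
      using km by (subst lborel.nn_integral_fst[symmetric])
        (auto simp: case_prod_beta' k_def norm_mult ennreal_mult)
    also have "\<dots> = (\<integral>\<^sup>+x. ennreal (norm (F x)) \<partial>lborel) * (\<integral>\<^sup>+\<xi>. ennreal (norm (g \<xi>)) \<partial>lborel)"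
      by (simp add: nn_integral_cmult nn_integral_multc)
    also have "\<dots> < \<infinity>" using F g by (simp add: integrable_iff_bounded ennreal_mult_less_top)
    finally show "(\<integral>\<^sup>+p. ennreal (norm (case p of (x, \<xi>) \<Rightarrow> k x \<xi>)) \<partial>(lborel \<Otimes>\<^sub>M lborel)) < \<infinity>" .
  qed (use km in \<open>simp add: case_prod_beta'\<close>)
  have "ip lborel (fourier_integral F) g = (LINT \<xi>|lborel. LINT x|lborel. k x \<xi>)"
    by (simp add: ip_def fourier_integral_def k_def)
  also have "\<dots> = (LINT x|lborel. LINT \<xi>|lborel. k x \<xi>)"
    by (rule lborel_pair.Fubini_integral[OF int])
  also have "\<dots> = ip lborel F (\<lambda>x. fourier_integral g (- x))"
    unfolding ip_def
  proof (intro Bochner_Integration.integral_cong refl)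
    fix x
    have "(LINT \<xi>|lborel. k x \<xi>) = (LINT \<xi>|lborel. F x * cnj (g \<xi> * cis (- 2 * pi * (\<xi> \<bullet> - x))))"
      by (intro Bochner_Integration.integral_cong refl)
        (simp add: k_def cis_cnj inner_commute mult.commute mult.left_commute)
    also have "\<dots> = F x * (LINT \<xi>|lborel. cnj (g \<xi> * cis (- 2 * pi * (\<xi> \<bullet> - x))))"
      by (rule integral_mult_right_zero)
    also have "\<dots> = F x * cnj (fourier_integral g (- x))"
      unfolding fourier_integral_def by (simp only: Bochner_Integration.integral_cnj)
    finally show "(LINT \<xi>|lborel. k x \<xi>) = F x * cnj (fourier_integral g (- x))" .
  qed
  finally show ?thesis .
qed

text \<open>
  Let \<open>h\<close> be the inverse transform of \<open>g\<close>. Since \<open>\<langle>h\<hat>, g\<rangle> = \<langle>h, h\<rangle>\<close> and \<open>\<parallel>h\<hat>\<parallel> = \<parallel>h\<parallel> = \<parallel>g\<parallel>\<close>, expanding the square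
  gives \<open>\<parallel>h\<hat> - g\<parallel>\<^sup>2 = 0\<close>.
\<close>

theorem Fourier_inversion:
  assumes g: "integrable lborel g" "sq_integrable lborel g"
  defines "h \<equiv> (\<lambda>x. fourier_integral g (- x))"
  shows "h \<in> L2" "sqnorm lborel h = sqnorm lborel g" "AE \<xi> in lborel. fourier h \<xi> = g \<xi>"
proof -
  have [measurable]: "g \<in> borel_measurable borel" using g by (simp add: sq_integrable_def)
  have minus: "(mat (-1) :: real^2^2) *v x - 0 = - x" for x
    by (simp add: mat_def matrix_vector_mult_def vec_eq_iff if_distrib if_distribR cong: if_cong)
  have det: "det (mat (-1) :: real^2^2) = 1" by (simp add: det_2 mat_def)
  have "sqnorm lborel h = sqnorm lborel (fourier_integral g)"
    using sqnorm_affine[where B = "mat (-1)" and h = "fourier_integral g" and w = "\<lambda>_. 1" and k = 1 and v = 0] unfolding h_def minus by (simp add: det)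
  then show hg: "sqnorm lborel h = sqnorm lborel g"
    using Plancherel_L1_L2(2)[OF g(2,1)] by simp
  have h: "sq_integrable lborel h"
    using sq_integrable_affine[where B = "mat (-1)" and w = "\<lambda>_. 1" and k = 1 and v = 0, OF Plancherel_L1_L2(1)[OF g(2,1)]]
    unfolding h_def minus by (simp add: det)
  then show hL2: "h \<in> L2" by (simp add: L2_iff)
  define h' where "h' = fourier h"
  have ft: "has_fourier_transform h h'" unfolding h'_def by (rule has_fourier_transform_fourier[OF hL2])
  from ft obtain F where F: "sq_integrable lborel h'" "\<And>n. sq_integrable lborel (F n)" "\<And>n. integrable lborel (F n)"
    "L2_lim lborel F h"
    "L2_lim lborel (\<lambda>n. fourier_integral (F n)) h'"
    by (auto simp: has_fourier_transform_iff)
  have "(\<lambda>n. ip lborel (fourier_integral (F n)) g) \<longlonglongrightarrow> ip lborel h' g"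
  proof (rule ip_tendsto)
    show "(\<lambda>n::nat. sqnorm lborel (\<lambda>x. g x - g x)) \<longlonglongrightarrow> 0" by (simp add: sqnorm_def)
  qed (rule F g Plancherel_L1_L2)+
  moreover have "(\<lambda>n. ip lborel (F n) h) \<longlonglongrightarrow> ip lborel h h"
  proof (rule ip_tendsto)
    show "(\<lambda>n::nat. sqnorm lborel (\<lambda>x. h x - h x)) \<longlonglongrightarrow> 0" by (simp add: sqnorm_def)
  qed (rule F h)+
  moreover have "ip lborel (fourier_integral (F n)) g = ip lborel (F n) h" for n
    unfolding h_def by (rule fourier_integral_adjoint) (rule F g)+
  ultimately have ip: "ip lborel h' g = ip lborel h h" by (simp add: LIMSEQ_unique)
  have mg: "sq_integrable lborel (\<lambda>\<xi>. (-1) * g \<xi>)" by (rule sq_integrable_cmult[OF g(2)])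
  have "enn2real (sqnorm lborel (\<lambda>\<xi>. h' \<xi> + (-1) * g \<xi>)) =
      enn2real (sqnorm lborel h') + enn2real (sqnorm lborel (\<lambda>\<xi>. (-1) * g \<xi>)) + 2 * Re (ip lborel h' (\<lambda>\<xi>. (-1) * g \<xi>))"
    by (rule sqnorm_add_eq[OF F(1) mg])
  also have "ip lborel h' (\<lambda>\<xi>. (-1) * g \<xi>) = - ip lborel h h"
    unfolding ip_cmult_right ip by simp
  also have "sqnorm lborel (\<lambda>\<xi>. (-1) * g \<xi>) = sqnorm lborel h"
    by (subst sqnorm_cmult) (auto simp: hg)
  also have "sqnorm lborel h' = sqnorm lborel h"
    using Plancherel[OF ft] by simp
  finally have "enn2real (sqnorm lborel (\<lambda>\<xi>. h' \<xi> + (-1) * g \<xi>)) = 0"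
    by (simp add: ip_self[OF h])
  then have "sqnorm lborel (\<lambda>\<xi>. h' \<xi> + (-1) * g \<xi>) = 0"
    using sqnorm_finite[OF sq_integrable_add[OF F(1) mg]] by (auto simp: enn2real_eq_0_iff)
  moreover have [measurable]: "h' \<in> borel_measurable borel" using F(1) by (simp add: sq_integrable_def)
  ultimately have "AE \<xi> in lborel. abs_sq (h' \<xi> + (-1) * g \<xi>) = 0"
    unfolding sqnorm_def by (subst (asm) nn_integral_0_iff_AE) auto
  then show "AE \<xi> in lborel. fourier h \<xi> = g \<xi>"
    unfolding h'_def by eventually_elim simp
qed

text \<open>
  The inverse transform of the indicator of the square \<open>[1, 2] \<times> [0, 1]\<close>, which is contained in the cone.
\<close>

lemma L2_cone_nontrivial: "\<exists>f\<in>L2_cone. 0 < sqnorm lborel f"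
proof -
  define C :: "(real^2) set" where "C = cbox (vector [1, 0]) (vector [2, 1])"
  have C: "C \<subseteq> freq_cone"
    by (auto simp: C_def freq_cone_def mem_box_cart forall_2 vector_2 abs_le_iff field_simps)
  have [measurable]: "C \<in> sets borel" by (simp add: C_def)
  have "emeasure lborel C = (\<Prod>b\<in>Basis. ((vector [2, 1] :: real^2) - vector [1, 0]) \<bullet> b)"
    unfolding C_def
  proof (rule emeasure_lborel_cbox)
    fix b :: "real^2" assume "b \<in> Basis"
    then obtain i where b: "b = axis i 1" by (auto simp: Basis_vec_def)
    show "vector [1, 0] \<bullet> b \<le> vector [2, 1] \<bullet> b"
      unfolding b inner_axis using exhaust_2[of i] by auto
  qed
  then have emC: "emeasure lborel C = 1"
    by (simp add: Basis_vec_def UNIV_2 axis_eq_axis inner_axis vector_2)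
  define g where "g \<xi> = complex_of_real (indicator C \<xi>)" for \<xi>
  have [measurable]: "g \<in> borel_measurable borel" unfolding g_def[abs_def] by measurable
  have sq: "sqnorm lborel g = 1"
  proof -
    have "sqnorm lborel g = (\<integral>\<^sup>+\<xi>. indicator C \<xi> \<partial>lborel)"
      unfolding sqnorm_def by (intro nn_integral_cong) (auto simp: g_def indicator_def)
    then show ?thesis by (simp add: emC)
  qed
  have "(\<integral>\<^sup>+\<xi>. ennreal (norm (g \<xi>)) \<partial>lborel) = (\<integral>\<^sup>+\<xi>. indicator C \<xi> \<partial>lborel)"
    by (intro nn_integral_cong) (auto simp: g_def indicator_def)
  then have i: "integrable lborel g" by (intro integrableI_bounded) (auto simp: emC)
  have sqi: "sq_integrable lborel g" using sq by (simp add: sq_integrable_def)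
  define h where "h = (\<lambda>x. fourier_integral g (- x))"
  note * = Fourier_inversion[OF i sqi, folded h_def]
  have "h \<in> L2_cone"
    unfolding L2_cone_def
  proof (intro CollectI conjI *(1))
    show "AE \<xi> in lborel. \<xi> \<notin> freq_cone \<longrightarrow> fourier h \<xi> = 0"
      using *(3) by eventually_elim (use C in \<open>auto simp: g_def indicator_def\<close>)
  qed
  then show ?thesis using *(2) sq by (intro bexI[of _ h]) auto
qed

section \<open>Shearlet coefficients at one scale and shear\<close>

lemma mat_vec_2:
  "(scaling_mat a *v x)$1 = a * x$1" "(scaling_mat a *v x)$2 = sqrt a * x$2"
  "(shear_mat t *v x)$1 = x$1 + t * x$2" "(shear_mat t *v x)$2 = x$2"
  "(transpose (shear_mat t) *v x)$1 = x$1" "(transpose (shear_mat t) *v x)$2 = t * x$1 + x$2"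
  "(sampling_mat c *v x)$1 = c$1 * x$1" "(sampling_mat c *v x)$2 = c$2 * x$2"
  by (simp_all add: scaling_mat_def shear_mat_def sampling_mat_def matrix_vector_mult_def sum_2 transpose_def vector_2)

lemma det_mats:
  "det (scaling_mat a) = a * sqrt a" "det (shear_mat t) = 1" "det (sampling_mat c) = c$1 * c$2"
  by (simp_all add: det_2 scaling_mat_def shear_mat_def sampling_mat_def vector_2)

lemma inner_sampling_mat: "(sampling_mat c *v x) \<bullet> y = (sampling_mat c *v y) \<bullet> x"
  by (simp add: inner_vec_def sum_2 mat_vec_2)

lemma adjoint_dilation:
  assumes "a > 0"
  shows "((shear_mat (- t) ** scaling_mat (inverse a)) *v x) \<bullet> ((transpose (shear_mat t) ** scaling_mat a) *v \<xi>) = x \<bullet> \<xi>"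
proof -
  have "sqrt (inverse a) * sqrt a = 1" "inverse a * a = 1" "sqrt a * sqrt a = a"
    using assms by (simp_all add: real_sqrt_mult[symmetric])
  then show ?thesis
    unfolding matrix_vector_mul_assoc[symmetric] inner_vec_def sum_2 mat_vec_2 inner_real_def
    by algebra
qed

text \<open>
  The factor \<open>a\<^sup>-\<^sup>3\<^sup>/\<^sup>4\<close> of the shearlet, divided by the determinant \<open>a\<^sup>-\<^sup>3\<^sup>/\<^sup>2\<close> of its dilation, leaves \<open>a\<^sup>3\<^sup>/\<^sup>4\<close>.
\<close>

lemma has_fourier_transform_shearlet:
  assumes u: "has_fourier_transform \<psi> u" and a: "a j > 0"
  shows "has_fourier_transform (shearlet_system a s c \<psi> (j, k, m))
    (\<lambda>\<xi>. (of_real (a j powr (3/4)) * cis (- 2 * pi * ((sampling_mat c *v int_vec m) \<bullet>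
        ((transpose (shear_mat (s k)) ** scaling_mat (a j)) *v \<xi>)))) *
      u ((transpose (shear_mat (s k)) ** scaling_mat (a j)) *v \<xi>))"
proof -
  define B where "B = shear_mat (- s k) ** scaling_mat (inverse (a j))"
  define T where "T = transpose (shear_mat (s k)) ** scaling_mat (a j)"
  have det: "det B = inverse (a j) * sqrt (inverse (a j))" "det T = a j * sqrt (a j)"
    by (simp_all add: B_def T_def det_mul det_transpose det_mats)
  have "a j powr (-3/4) / (inverse (a j) * sqrt (inverse (a j))) = a j powr (-3/4) * (a j * a j powr (1/2))"
    unfolding real_sqrt_inverse powr_half_sqrt[OF less_imp_le[OF a]]
    by (simp only: divide_inverse inverse_mult_distrib inverse_inverse_eq)
  also have "\<dots> = a j powr (3/4)"
    using a powr_mult_base[of "a j" "1/2"] by (simp add: powr_add[symmetric])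
  finally have quot: "a j powr (-3/4) / (inverse (a j) * sqrt (inverse (a j))) = a j powr (3/4)" .
  have "\<bar>det B\<bar> = inverse (a j) * sqrt (inverse (a j))" using a by (simp add: det)
  then have *: "complex_of_real (a j powr (-3/4)) / of_real \<bar>det B\<bar> = of_real (a j powr (3/4))"
    by (simp only: of_real_divide[symmetric] quot)
  have "has_fourier_transform (\<lambda>x. of_real (a j powr (-3/4)) * \<psi> (B *v x - sampling_mat c *v int_vec m))
    (\<lambda>\<xi>. (of_real (a j powr (-3/4)) / of_real \<bar>det B\<bar> * cis (- 2 * pi * ((sampling_mat c *v int_vec m) \<bullet> (T *v \<xi>)))) * u (T *v \<xi>))"
  proof (rule has_fourier_transform_affine[OF u])
    show "(B *v x) \<bullet> (T *v \<xi>) = x \<bullet> \<xi>" for x \<xi>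
      unfolding B_def T_def by (rule adjoint_dilation[OF a])
  qed (use a in \<open>auto simp: det\<close>)
  then show ?thesis unfolding * by (simp add: shearlet_system_def B_def T_def)
qed

lemma inverse_matrix:
  fixes A :: "real^2^2"
  assumes "det A \<noteq> 0"
  shows "A *v (matrix_inv A *v x) = x" "matrix_inv A *v (A *v x) = x"
proof -
  have "invertible A" using assms by (simp add: invertible_det_nz)
  then have "A ** matrix_inv A = mat 1 \<and> matrix_inv A ** A = mat 1"
    unfolding matrix_inv_def invertible_def by (rule someI_ex)
  then show "A *v (matrix_inv A *v x) = x" "matrix_inv A *v (A *v x) = x"
    by (simp_all add: matrix_vector_mul_assoc)
qed

text \<open>
  The substitution \<open>\<zeta> = M T \<xi>\<close> turns the exponentials into characters of the torus and carries
  the lattice shift \<open>\<zeta> + l\<close> to \<open>\<xi> + T\<^sup>-\<^sup>1 M\<^sup>-\<^sup>1 l\<close>.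
\<close>

lemma dilated_coefficients:
  fixes T M :: "real^2^2"
  assumes [measurable]: "g \<in> borel_measurable borel" "u \<in> borel_measurable borel"
    and det: "det T \<noteq> 0" "det M \<noteq> 0"
    and sym: "\<And>x y. (M *v x) \<bullet> y = (M *v y) \<bullet> x"
  defines "D \<equiv> (\<integral>\<^sup>+\<xi>. ennreal ((norm (g \<xi>))\<^sup>2 * (norm (u (T *v \<xi>)))\<^sup>2) \<partial>lborel)"
    and "E \<equiv> (\<integral>\<^sup>+l. \<integral>\<^sup>+\<xi>. ennreal (norm (g \<xi>) * norm (u (T *v \<xi>)) *
        (norm (g (\<xi> + matrix_inv T *v (matrix_inv M *v int_vec l))) *
         norm (u (T *v \<xi> + matrix_inv M *v int_vec l)))) \<partial>lborel \<partial>count_space (UNIV - {0}))"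
    and "S \<equiv> (\<integral>\<^sup>+m. abs_sq (LINT \<xi>|lborel. g \<xi> *
        cnj (cis (- 2 * pi * ((M *v int_vec m) \<bullet> (T *v \<xi>))) * u (T *v \<xi>))) \<partial>Z2)"
  assumes fin: "D < \<infinity>" "E < \<infinity>"
  shows "ennreal \<bar>det (M ** T)\<bar> * S \<le> D + E" and "D \<le> ennreal \<bar>det (M ** T)\<bar> * S + E"
proof -
  define W where "W = M ** T"
  have W: "W *v \<xi> = M *v (T *v \<xi>)" for \<xi> by (simp add: W_def matrix_vector_mul_assoc)
  have detW: "det W \<noteq> 0" using det by (simp add: W_def det_mul)
  define w where "w = \<bar>det W\<bar>"
  have w: "w > 0" using detW by (simp add: w_def)
  define G where "G \<zeta> = g (matrix_inv T *v (matrix_inv M *v \<zeta>)) * cnj (u (matrix_inv M *v \<zeta>))" for \<zeta>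
  have [measurable]: "G \<in> borel_measurable borel" unfolding G_def[abs_def] by measurable
  have GW: "G (W *v \<xi>) = g \<xi> * cnj (u (T *v \<xi>))" for \<xi>
    by (simp add: G_def W inverse_matrix det)
  have GWl: "G (W *v \<xi> + v) = g (\<xi> + matrix_inv T *v (matrix_inv M *v v)) * cnj (u (T *v \<xi> + matrix_inv M *v v))" for \<xi> v
    by (simp add: G_def W inverse_matrix det matrix_vector_right_distrib)
  have sqG: "sqnorm lborel G = ennreal w * D"
  proof -
    have "sqnorm lborel G = ennreal w * (\<integral>\<^sup>+\<xi>. abs_sq (G (W *v \<xi>)) \<partial>lborel)"
      unfolding sqnorm_def w_def by (subst nn_integral_affine[OF detW, where v = 0]) auto
    then show ?thesis by (simp add: GW D_def norm_mult power_mult_distrib)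
  qed
  have ovG: "overlap G = ennreal w * E"
  proof -
    have "overlap G = (\<integral>\<^sup>+l. ennreal w * (\<integral>\<^sup>+\<xi>. ennreal (norm (G (W *v \<xi>)) * norm (G (W *v \<xi> + int_vec l))) \<partial>lborel) \<partial>count_space (UNIV - {0}))"
      unfolding overlap_def w_def by (subst nn_integral_affine[OF detW, where v = 0]) auto
    also have "\<dots> = ennreal w * E"
      by (simp add: GW GWl E_def norm_mult nn_integral_cmult)
    finally show ?thesis .
  qed
  define C where "C m = (LINT \<zeta>|lborel. G \<zeta> * cnj (character m \<zeta>))" for m
  have coeff: "(LINT \<xi>|lborel. g \<xi> * cnj (cis (- 2 * pi * ((M *v int_vec m) \<bullet> (T *v \<xi>))) * u (T *v \<xi>))) = C (- m) / of_real w" for m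
  proof -
    have "C (- m) = of_real w * (LINT \<xi>|lborel. G (W *v \<xi>) * cnj (character (- m) (W *v \<xi>)))"
      unfolding C_def w_def by (subst integral_affine[OF detW, where v = 0]) auto
    also have "(LINT \<xi>|lborel. G (W *v \<xi>) * cnj (character (- m) (W *v \<xi>))) =
        (LINT \<xi>|lborel. g \<xi> * cnj (cis (- 2 * pi * ((M *v int_vec m) \<bullet> (T *v \<xi>))) * u (T *v \<xi>)))"
    proof (intro Bochner_Integration.integral_cong refl)
      fix \<xi>
      have "character (- m) (W *v \<xi>) = cis (- 2 * pi * ((M *v int_vec m) \<bullet> (T *v \<xi>)))"
        unfolding character_def W by (simp add: sym[of "int_vec m"])
      then show "G (W *v \<xi>) * cnj (character (- m) (W *v \<xi>)) =
          g \<xi> * cnj (cis (- 2 * pi * ((M *v int_vec m) \<bullet> (T *v \<xi>))) * u (T *v \<xi>))"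
        by (simp add: GW mult_ac)
    qed
    finally show ?thesis using w by simp
  qed
  define \<Sigma> where "\<Sigma> = (\<integral>\<^sup>+m. abs_sq (C m) \<partial>Z2)"
  have "S = (\<integral>\<^sup>+m. ennreal ((1 / w)\<^sup>2) * abs_sq (C (- m)) \<partial>Z2)"
    unfolding S_def coeff using w
    by (intro nn_integral_cong) (simp add: norm_divide power_divide ennreal_mult[symmetric])
  also have "\<dots> = ennreal ((1 / w)\<^sup>2) * (\<integral>\<^sup>+m. abs_sq (C (- m)) \<partial>Z2)"
    by (rule nn_integral_cmult) simp
  also have "(\<integral>\<^sup>+m. abs_sq (C (- m)) \<partial>Z2) = \<Sigma>"
    unfolding \<Sigma>_def
    by (rule nn_integral_bij_count_space[where g = uminus and f = "\<lambda>m. abs_sq (C m)"])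
      (rule bij_betwI[where g = uminus], auto)
  finally have S: "S = ennreal ((1 / w)\<^sup>2) * \<Sigma>" .
  \<comment> \<open>One factor \<open>w\<close> is cancelled against the Jacobian that \<open>sqG\<close> and \<open>ovG\<close> contribute.\<close>
  have wS: "ennreal w * (ennreal w * S) = \<Sigma>"
    unfolding S using w by (simp add: power2_eq_square mult.assoc[symmetric] flip: ennreal_mult)
  have "sqnorm lborel G < \<infinity>" "overlap G < \<infinity>"
    using fin by (simp_all add: sqG ovG ennreal_mult_less_top)
  from Fourier_coefficients_overlap[OF _ this]
  have "\<Sigma> \<le> ennreal w * D + ennreal w * E" "ennreal w * D \<le> \<Sigma> + ennreal w * E"
    by (simp_all add: \<Sigma>_def C_def sqG ovG)
  then have "ennreal w * (ennreal w * S) \<le> ennreal w * (D + E)" "ennreal w * D \<le> ennreal w * (ennreal w * S + E)"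
    unfolding wS[symmetric] by (simp_all add: distrib_left)
  then have "ennreal w * S \<le> D + E" "D \<le> ennreal w * S + E"
    using w by (simp_all add: ennreal_mult_le_mult_iff)
  then show "ennreal \<bar>det (M ** T)\<bar> * S \<le> D + E" "D \<le> ennreal \<bar>det (M ** T)\<bar> * S + E"
    by (simp_all add: w_def W_def)
qed

section \<open>Summation over scales and shears\<close>

lemma nn_integral_count_space_UNIV:
  "(\<integral>\<^sup>+x. h x \<partial>count_space X) = (\<integral>\<^sup>+x. h x * indicator X x \<partial>count_space UNIV)"
  by (cases "X = UNIV") (simp_all add: nn_integral_count_space_indicator)

lemma nn_integral_count_space_Sigma:
  fixes f :: "'a \<Rightarrow> 'b \<Rightarrow> ennreal"
  shows "(\<integral>\<^sup>+x. \<integral>\<^sup>+y. f x y \<partial>count_space (B x) \<partial>count_space A) =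
    (\<integral>\<^sup>+p. f (fst p) (snd p) \<partial>count_space (Sigma A B))"
proof -
  have "(\<integral>\<^sup>+x. \<integral>\<^sup>+y. f x y \<partial>count_space (B x) \<partial>count_space A) =
      (\<integral>\<^sup>+x. \<integral>\<^sup>+y. f x y * indicator (Sigma A B) (x, y) \<partial>count_space UNIV \<partial>count_space UNIV)"
    unfolding nn_integral_count_space_UNIV[where X = A] nn_integral_count_space_UNIV[where X = "B _"]
    by (intro nn_integral_cong) (auto simp: indicator_def nn_integral_multc[symmetric] intro!: nn_integral_cong)
  also have "\<dots> = (\<integral>\<^sup>+p. (\<lambda>(x, y). f x y * indicator (Sigma A B) (x, y)) p \<partial>count_space UNIV)"
    by (subst nn_integral_fst_count_space[symmetric]) simp
  also have "\<dots> = (\<integral>\<^sup>+p. f (fst p) (snd p) \<partial>count_space (Sigma A B))"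
    unfolding nn_integral_count_space_UNIV[where X = "Sigma A B"] by (intro nn_integral_cong) (auto simp: case_prod_beta)
  finally show ?thesis .
qed

lemma Phi_eq:
  "Phi a K s \<psi> \<xi> \<omega> = (\<integral>\<^sup>+i. ennreal (
      norm (fourier \<psi> ((transpose (shear_mat (s (snd i))) ** scaling_mat (a (fst i))) *v \<xi>)) *
      norm (fourier \<psi> ((transpose (shear_mat (s (snd i))) ** scaling_mat (a (fst i))) *v \<xi> + \<omega>)))
    \<partial>count_space (Sigma UNIV K))"
  unfolding Phi_def infsum_ennreal_eq_nn_integral
  by (rule nn_integral_count_space_Sigma[where f = "\<lambda>j k. ennreal (
      norm (fourier \<psi> ((transpose (shear_mat (s k)) ** scaling_mat (a j)) *v \<xi>)) *
      norm (fourier \<psi> ((transpose (shear_mat (s k)) ** scaling_mat (a j)) *v \<xi> + \<omega>)))"])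

text \<open>
  Taking square roots in \<open>[0, \<infinity>]\<close>. For \<open>A = \<infinity>\<close> and \<open>N = 0\<close> both right-hand sides are \<open>0\<close> by the
  convention \<open>\<infinity> \<cdot> 0 = 0\<close>.
\<close>

lemma le_ennreal_sqrt_mult:
  assumes "x\<^sup>2 \<le> A * N\<^sup>2" "N < \<infinity>"
  shows "x \<le> ennreal_sqrt A * N"
proof (cases "A = \<infinity> \<or> N = 0")
  case True
  then show ?thesis
  proof
    assume "N = 0"
    then have "x\<^sup>2 = 0" using assms(1) by simp
    then show ?thesis by simp
  next
    assume A: "A = \<infinity>"
    show ?thesis
    proof (cases "N = 0")
      case True
      then have "x\<^sup>2 = 0" using assms(1) by simp
      then show ?thesis by simp
    qed (simp add: A ennreal_sqrt_def ennreal_top_mult)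
  qed
next
  case False
  then obtain \<alpha> where A: "A = ennreal \<alpha>" "\<alpha> \<ge> 0" by (cases A) auto
  obtain \<nu> where N: "N = ennreal \<nu>" "\<nu> \<ge> 0" using assms(2) by (cases N) auto
  have "x\<^sup>2 \<le> ennreal (\<alpha> * \<nu>\<^sup>2)"
    using assms(1) A N by (simp add: ennreal_power ennreal_mult)
  then have "x \<noteq> \<infinity>" by (auto simp: power2_eq_square ennreal_top_mult top_unique)
  then obtain xr where x: "x = ennreal xr" "xr \<ge> 0" by (cases x) auto
  have "xr\<^sup>2 \<le> \<alpha> * \<nu>\<^sup>2"
    using \<open>x\<^sup>2 \<le> ennreal (\<alpha> * \<nu>\<^sup>2)\<close> A x by (simp add: ennreal_power)
  then have "xr \<le> sqrt (\<alpha> * \<nu>\<^sup>2)" by (rule real_le_rsqrt)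
  also have "\<dots> = sqrt \<alpha> * \<nu>" using N by (simp add: real_sqrt_mult)
  finally show ?thesis using A N x by (simp add: ennreal_sqrt_def ennreal_leI flip: ennreal_mult)
qed

lemma borel_measurable_vec_nth_2[measurable]: "(\<lambda>x::real^2. x $ i) \<in> borel_measurable borel"
  by (intro borel_measurable_continuous_onI continuous_intros)

lemma freq_cone_measurable[measurable]: "freq_cone \<in> sets borel"
  unfolding freq_cone_def by measurable

lemma AE_cone_measure: "(AE \<xi> in cone_measure. P \<xi>) \<longleftrightarrow> (AE \<xi> in lborel. \<xi> \<in> freq_cone \<longrightarrow> P \<xi>)"
  by (rule AE_restrict_space_iff) simp

lemma nn_integral_cone_mono:
  assumes supp: "AE \<xi> in lborel. \<xi> \<notin> freq_cone \<longrightarrow> g \<xi> = 0" and le: "AE \<xi> in cone_measure. h \<xi> \<le> k \<xi>"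
  shows "(\<integral>\<^sup>+\<xi>. abs_sq (g \<xi>) * h \<xi> \<partial>lborel) \<le> (\<integral>\<^sup>+\<xi>. abs_sq (g \<xi>) * k \<xi> \<partial>lborel)"
proof (rule nn_integral_mono_AE)
  show "AE \<xi> in lborel. abs_sq (g \<xi>) * h \<xi> \<le> abs_sq (g \<xi>) * k \<xi>"
    using supp le[unfolded AE_cone_measure]
  proof eventually_elim
    case (elim \<xi>)
    then show ?case by (cases "\<xi> \<in> freq_cone") (auto intro!: mult_left_mono)
  qed
qed

lemma nn_integral_sqnorm_const:
  assumes [measurable]: "g \<in> borel_measurable borel"
  shows "(\<integral>\<^sup>+\<xi>. abs_sq (g \<xi>) * C \<partial>lborel) = C * sqnorm lborel g"
  by (simp add: nn_integral_cmult sqnorm_def mult.commute)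

text \<open>
  The overlap at a lattice point is estimated by the Cauchy-Schwarz inequality over scales, shears
  and frequencies together. The shift in the second factor is undone by translating \<open>\<xi>\<close>; it
  depends on scale and shear, but is mapped by \<open>T\<close> to the same \<open>\<omega>\<close> for all of them.
\<close>

lemma total_overlap_le:
  fixes I :: "'i set" and T :: "'i \<Rightarrow> real^2^2"
  assumes [measurable]: "g \<in> borel_measurable borel" "u \<in> borel_measurable borel"
    and I: "countable I" and det: "\<And>i. i \<in> I \<Longrightarrow> det (T i) \<noteq> 0"
    and le: "\<And>\<sigma>. (\<integral>\<^sup>+\<xi>. abs_sq (g \<xi>) *
        (\<integral>\<^sup>+i. ennreal (norm (u (T i *v \<xi>)) * norm (u (T i *v \<xi> + \<sigma>))) \<partial>count_space I) \<partial>lborel) \<le> C \<sigma> * N"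
    and N: "N < \<infinity>"
  shows "(\<integral>\<^sup>+i. \<integral>\<^sup>+\<xi>. ennreal (norm (g \<xi>) * norm (u (T i *v \<xi>)) *
      (norm (g (\<xi> + matrix_inv (T i) *v \<omega>)) * norm (u (T i *v \<xi> + \<omega>)))) \<partial>lborel \<partial>count_space I)
    \<le> ennreal_sqrt (C \<omega> * C (- \<omega>)) * N"
    (is "(\<integral>\<^sup>+i. \<integral>\<^sup>+\<xi>. ?e i \<xi> \<partial>lborel \<partial>count_space I) \<le> _")
proof (rule le_ennreal_sqrt_mult[OF _ N])
  define v where "v i = matrix_inv (T i) *v \<omega>" for i
  have Tv: "T i *v v i = \<omega>" if "i \<in> I" for i
    using inverse_matrix(1)[OF det[OF that]] by (simp add: v_def)
  define q where "q \<sigma> i \<xi> = norm (u (T i *v \<xi>)) * norm (u (T i *v \<xi> + \<sigma>))" for \<sigma> i \<xi>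
  have [measurable]: "q \<sigma> i \<in> borel_measurable borel" for \<sigma> i
    unfolding q_def[abs_def] by measurable
  have q: "0 \<le> q \<sigma> i \<xi>" for \<sigma> i \<xi> by (simp add: q_def)
  define P where "P = count_space I \<Otimes>\<^sub>M (lborel :: (real^2) measure)"
  have meas: "(\<lambda>p. h (fst p) (snd p)) \<in> borel_measurable P"
    if "\<And>i. i \<in> I \<Longrightarrow> h i \<in> borel_measurable borel" for h :: "'i \<Rightarrow> real^2 \<Rightarrow> ennreal"
    unfolding P_def by (rule measurable_pair_measure_countable1[OF I]) (use that in simp)
  have int: "(\<integral>\<^sup>+p. h (fst p) (snd p) \<partial>P) = (\<integral>\<^sup>+i. \<integral>\<^sup>+\<xi>. h i \<xi> \<partial>lborel \<partial>count_space I)"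
    if "\<And>i. i \<in> I \<Longrightarrow> h i \<in> borel_measurable borel" for h :: "'i \<Rightarrow> real^2 \<Rightarrow> ennreal"
    using lborel.nn_integral_fst[OF meas[OF that, unfolded P_def]] by (simp add: P_def)
  \<comment> \<open>The weight \<open>q\<close> is split evenly between the two factors.\<close>
  define f1 where "f1 i \<xi> = ennreal (norm (g \<xi>) * sqrt (q \<omega> i \<xi>))" for i \<xi>
  define f2 where "f2 i \<xi> = ennreal (norm (g (\<xi> + v i)) * sqrt (q \<omega> i \<xi>))" for i \<xi>
  have [measurable]: "f1 i \<in> borel_measurable borel" "f2 i \<in> borel_measurable borel" for i
    unfolding f1_def[abs_def] f2_def[abs_def] by measurable
  have f12: "f1 i \<xi> * f2 i \<xi> = ?e i \<xi>" for i \<xi>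
  proof -
    have "f1 i \<xi> * f2 i \<xi> = ennreal ((norm (g \<xi>) * norm (g (\<xi> + v i))) * (sqrt (q \<omega> i \<xi>))\<^sup>2)"
      by (simp add: f1_def f2_def q power2_eq_square mult_ac flip: ennreal_mult)
    also have "(sqrt (q \<omega> i \<xi>))\<^sup>2 = q \<omega> i \<xi>" by (rule real_sqrt_pow2[OF q])
    finally show ?thesis by (simp add: q_def v_def mult_ac)
  qed
  have sum_q: "(\<integral>\<^sup>+i. \<integral>\<^sup>+\<xi>. abs_sq (g \<xi>) * ennreal (q \<sigma> i \<xi>) \<partial>lborel \<partial>count_space I) \<le> C \<sigma> * N" for \<sigma>
    using le[of \<sigma>]
    by (subst nn_integral_count_space_nn_integral[OF I, symmetric]) (simp_all add: nn_integral_cmult q_def)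
  have "(\<integral>\<^sup>+i. \<integral>\<^sup>+\<xi>. f1 i \<xi> * f2 i \<xi> \<partial>lborel \<partial>count_space I)\<^sup>2 =
      (\<integral>\<^sup>+p. f1 (fst p) (snd p) * f2 (fst p) (snd p) \<partial>P)\<^sup>2"
    by (subst int[where h = "\<lambda>i \<xi>. f1 i \<xi> * f2 i \<xi>"]) auto
  also have "\<dots> \<le> (\<integral>\<^sup>+p. (f1 (fst p) (snd p))\<^sup>2 \<partial>P) * (\<integral>\<^sup>+p. (f2 (fst p) (snd p))\<^sup>2 \<partial>P)"
    by (intro Cauchy_Schwarz_nn_integral meas) auto
  also have "(\<integral>\<^sup>+p. (f1 (fst p) (snd p))\<^sup>2 \<partial>P) =
      (\<integral>\<^sup>+i. \<integral>\<^sup>+\<xi>. abs_sq (g \<xi>) * ennreal (q \<omega> i \<xi>) \<partial>lborel \<partial>count_space I)"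
    by (subst int[where h = "\<lambda>i \<xi>. (f1 i \<xi>)\<^sup>2"])
      (simp_all add: f1_def q ennreal_power power_mult_distrib ennreal_mult)
  also have "(\<integral>\<^sup>+p. (f2 (fst p) (snd p))\<^sup>2 \<partial>P) = (\<integral>\<^sup>+i. \<integral>\<^sup>+\<xi>. (f2 i \<xi>)\<^sup>2 \<partial>lborel \<partial>count_space I)"
    by (rule int[where h = "\<lambda>i \<xi>. (f2 i \<xi>)\<^sup>2"]) measurable
  also have "\<dots> = (\<integral>\<^sup>+i. \<integral>\<^sup>+\<xi>. abs_sq (g \<xi>) * ennreal (q (- \<omega>) i \<xi>) \<partial>lborel \<partial>count_space I)"
  proof (rule nn_integral_cong)
    fix i assume "i \<in> space (count_space I)"
    then have "q \<omega> i (\<xi> - v i) = q (- \<omega>) i \<xi>" for \<xi>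
      using Tv[of i] by (simp add: q_def matrix_vector_mult_diff_distrib mult.commute)
    then have "(f2 i (\<xi> + - v i))\<^sup>2 = abs_sq (g \<xi>) * ennreal (q (- \<omega>) i \<xi>)" for \<xi>
      using q[of "- \<omega>" i \<xi>] by (simp add: f2_def ennreal_power power_mult_distrib flip: ennreal_mult)
    then show "(\<integral>\<^sup>+\<xi>. (f2 i \<xi>)\<^sup>2 \<partial>lborel) = (\<integral>\<^sup>+\<xi>. abs_sq (g \<xi>) * ennreal (q (- \<omega>) i \<xi>) \<partial>lborel)"
      by (subst nn_integral_translate[where v = "- v i", symmetric]) simp_all
  qed
  also have "(\<integral>\<^sup>+i. \<integral>\<^sup>+\<xi>. abs_sq (g \<xi>) * ennreal (q \<omega> i \<xi>) \<partial>lborel \<partial>count_space I) * \<dots>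
      \<le> (C \<omega> * N) * (C (- \<omega>) * N)"
    by (intro mult_mono sum_q) auto
  finally show "(\<integral>\<^sup>+i. \<integral>\<^sup>+\<xi>. ?e i \<xi> \<partial>lborel \<partial>count_space I)\<^sup>2 \<le> C \<omega> * C (- \<omega>) * N\<^sup>2"
    unfolding f12 by (simp add: power2_eq_square mult_ac)
qed

section \<open>Frame bounds\<close>

lemma L2_inner_eq_ip: "L2_inner = ip lborel"
  by (auto simp: fun_eq_iff L2_inner_def ip_def)

lemma nn_integral_shearlet_index:
  fixes h :: "nat \<times> int \<times> (int^2) \<Rightarrow> ennreal"
  shows "(\<Sum>\<^sub>\<infinity>i\<in>shearlet_index K. h i) =
    (\<integral>\<^sup>+i. \<integral>\<^sup>+m. h (fst i, snd i, m) \<partial>count_space UNIV \<partial>count_space (Sigma UNIV K))"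
proof -
  have "shearlet_index K = Sigma UNIV (\<lambda>j. Sigma (K j) (\<lambda>_. UNIV))"
    by (auto simp: shearlet_index_def)
  then have "(\<Sum>\<^sub>\<infinity>i\<in>shearlet_index K. h i) =
      (\<integral>\<^sup>+j. \<integral>\<^sup>+q. h (j, q) \<partial>count_space (Sigma (K j) (\<lambda>_. UNIV)) \<partial>count_space UNIV)"
    unfolding infsum_ennreal_eq_nn_integral
    by (simp add: nn_integral_count_space_Sigma[where f = "\<lambda>j q. h (j, q)"])
  also have "\<dots> = (\<integral>\<^sup>+j. \<integral>\<^sup>+k. \<integral>\<^sup>+m. h (j, k, m) \<partial>count_space UNIV \<partial>count_space (K j) \<partial>count_space UNIV)"
    by (simp add: nn_integral_count_space_Sigma[where f = "\<lambda>k m. h (_, k, m)"])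
  also have "\<dots> = (\<integral>\<^sup>+i. \<integral>\<^sup>+m. h (fst i, snd i, m) \<partial>count_space UNIV \<partial>count_space (Sigma UNIV K))"
    by (rule nn_integral_count_space_Sigma[where f = "\<lambda>j k. \<integral>\<^sup>+m. h (j, k, m) \<partial>count_space UNIV"])
  finally show ?thesis .
qed

text \<open>
  Each term of the sum over scales and shears is squeezed by \<open>dilated_coefficients\<close>. That lemma needs finite
  diagonal terms and overlaps for the single term; they are finite because their sums over all scales and shears are.
\<close>

theorem shearlet_frame_inequalities:
  fixes a :: "nat \<Rightarrow> real" and K :: "nat \<Rightarrow> int set" and s :: "int \<Rightarrow> real" and c :: "real^2"
  assumes a: "\<And>j. a j > 0" and c: "c$1 > 0" "c$2 > 0" and \<psi>: "\<psi> \<in> L2"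
    and R: "R_sum a K s \<psi> c < \<infinity>" and L: "L_sup a K s \<psi> < \<infinity>"
    and f: "f \<in> L2_cone"
  defines "S \<equiv> (\<Sum>\<^sub>\<infinity>i\<in>shearlet_index K. abs_sq (L2_inner f (shearlet_system a s c \<psi> i)))"
    and "N \<equiv> sqnorm lborel f" and "d \<equiv> \<bar>det (sampling_mat c)\<bar>"
  shows "ennreal d * S \<le> L_sup a K s \<psi> * N + R_sum a K s \<psi> c * N"
    and "\<And>l. AE \<xi> in cone_measure. l \<le> Phi a K s \<psi> \<xi> 0 \<Longrightarrow> l * N \<le> ennreal d * S + R_sum a K s \<psi> c * N"
proof -
  define g where "g = fourier f"
  define u where "u = fourier \<psi>"
  have fL2: "f \<in> L2" using f by (simp add: L2_cone_def)
  have ftf: "has_fourier_transform f g" unfolding g_def by (rule has_fourier_transform_fourier[OF fL2])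
  have ft\<psi>: "has_fourier_transform \<psi> u" unfolding u_def by (rule has_fourier_transform_fourier[OF \<psi>])
  have gm[measurable]: "g \<in> borel_measurable borel" and um[measurable]: "u \<in> borel_measurable borel"
    using ftf ft\<psi> by (auto simp: has_fourier_transform_iff sq_integrable_def)
  have supp: "AE \<xi> in lborel. \<xi> \<notin> freq_cone \<longrightarrow> g \<xi> = 0"
    using f by (simp add: L2_cone_def g_def)
  have Ng: "N = sqnorm lborel g" unfolding N_def by (rule Plancherel[OF ftf])
  have Nfin: "N < \<infinity>" using fL2 by (simp add: N_def L2_iff sq_integrable_def)
  define M where "M = sampling_mat c"
  have d: "d > 0" and detM: "det M \<noteq> 0" using c by (simp_all add: d_def M_def det_mats)
  define I where "I = Sigma UNIV K"
  have I: "countable I" by (simp add: I_def)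
  define T where "T i = transpose (shear_mat (s (snd i))) ** scaling_mat (a (fst i))" for i :: "nat \<times> int"
  have detT: "det (T i) = a (fst i) * sqrt (a (fst i))" for i
    by (simp add: T_def det_mul det_transpose det_mats)
  have detT0: "det (T i) \<noteq> 0" for i using a[of "fst i"] by (simp add: detT)
  have Phi: "Phi a K s \<psi> \<xi> \<omega> = (\<integral>\<^sup>+i. ennreal (norm (u (T i *v \<xi>)) * norm (u (T i *v \<xi> + \<omega>))) \<partial>count_space I)" for \<xi> \<omega>
    unfolding Phi_eq T_def u_def I_def ..
  define \<omega> where "\<omega> l = matrix_inv M *v int_vec l" for l
  define D where "D i = (\<integral>\<^sup>+\<xi>. ennreal ((norm (g \<xi>))\<^sup>2 * (norm (u (T i *v \<xi>)))\<^sup>2) \<partial>lborel)" for i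
  define E where "E i l = (\<integral>\<^sup>+\<xi>. ennreal (norm (g \<xi>) * norm (u (T i *v \<xi>)) *
      (norm (g (\<xi> + matrix_inv (T i) *v \<omega> l)) * norm (u (T i *v \<xi> + \<omega> l)))) \<partial>lborel)" for i l
  define E' where "E' i = (\<integral>\<^sup>+l. E i l \<partial>count_space (UNIV - {0}))" for i
  define S' where "S' i = (\<integral>\<^sup>+m. abs_sq (L2_inner f (shearlet_system a s c \<psi> (fst i, snd i, m))) \<partial>Z2)" for i

  have Dsum: "(\<integral>\<^sup>+i. D i \<partial>count_space I) = (\<integral>\<^sup>+\<xi>. abs_sq (g \<xi>) * Phi a K s \<psi> \<xi> 0 \<partial>lborel)"
  proof -
    have "(\<integral>\<^sup>+i. D i \<partial>count_space I) =
        (\<integral>\<^sup>+\<xi>. \<integral>\<^sup>+i. ennreal ((norm (g \<xi>))\<^sup>2 * (norm (u (T i *v \<xi>)))\<^sup>2) \<partial>count_space I \<partial>lborel)"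
      unfolding D_def by (rule nn_integral_count_space_nn_integral[OF I, symmetric]) measurable
    also have "\<dots> = (\<integral>\<^sup>+\<xi>. abs_sq (g \<xi>) * Phi a K s \<psi> \<xi> 0 \<partial>lborel)"
      unfolding Phi by (simp add: ennreal_mult power2_eq_square nn_integral_cmult)
    finally show ?thesis .
  qed
  have Dle: "(\<integral>\<^sup>+i. D i \<partial>count_space I) \<le> L_sup a K s \<psi> * N"
    unfolding Dsum Ng L_sup_def nn_integral_sqnorm_const[OF gm, symmetric]
    by (rule nn_integral_cone_mono[OF supp esssup_AE])
  have Esum: "(\<integral>\<^sup>+i. E' i \<partial>count_space I) \<le> R_sum a K s \<psi> c * N"
  proof -
    have cI: "countable (UNIV - {0 :: int^2})" by simp
    have "(\<integral>\<^sup>+i. E' i \<partial>count_space I) = (\<integral>\<^sup>+l. \<integral>\<^sup>+i. E i l \<partial>count_space I \<partial>count_space (UNIV - {0}))"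
      unfolding E'_def by (rule nn_integral_count_space_nn_integral[OF cI]) simp
    also have "\<dots> \<le> (\<integral>\<^sup>+l. ennreal_sqrt (Gamma_sup a K s \<psi> (\<omega> l) * Gamma_sup a K s \<psi> (- \<omega> l)) * N \<partial>count_space (UNIV - {0}))"
    proof (rule nn_integral_mono)
      fix l
      show "(\<integral>\<^sup>+i. E i l \<partial>count_space I) \<le> ennreal_sqrt (Gamma_sup a K s \<psi> (\<omega> l) * Gamma_sup a K s \<psi> (- \<omega> l)) * N"
        unfolding E_def
      proof (rule total_overlap_le[OF _ _ I detT0 _ Nfin])
        fix \<sigma>
        show "(\<integral>\<^sup>+\<xi>. abs_sq (g \<xi>) *
            (\<integral>\<^sup>+i. ennreal (norm (u (T i *v \<xi>)) * norm (u (T i *v \<xi> + \<sigma>))) \<partial>count_space I) \<partial>lborel) \<le> Gamma_sup a K s \<psi> \<sigma> * N"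
          unfolding Phi[symmetric] Ng Gamma_sup_def nn_integral_sqnorm_const[OF gm, symmetric]
            by (rule nn_integral_cone_mono[OF supp esssup_AE])
      qed measurable
    qed
    also have "\<dots> = R_sum a K s \<psi> c * N"
      unfolding R_sum_def infsum_ennreal_eq_nn_integral \<omega>_def M_def by (rule nn_integral_multc) simp
    finally show ?thesis .
  qed

  have single: "ennreal d * S' i \<le> D i + E' i" "D i \<le> ennreal d * S' i + E' i" if i: "i \<in> I" for i
  proof -
    have Dfin: "D i < \<infinity>"
    proof -
      have "D i \<le> (\<integral>\<^sup>+i. D i \<partial>count_space I)" by (rule nn_integral_ge_point[OF i])
      also have "\<dots> < \<infinity>" using Dle L Nfin by (simp add: ennreal_mult_less_top le_less_trans)
      finally show ?thesis .
    qed
    have Efin: "E' i < \<infinity>"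
    proof -
      have "E' i \<le> (\<integral>\<^sup>+i. E' i \<partial>count_space I)" by (rule nn_integral_ge_point[OF i])
      also have "\<dots> < \<infinity>" using Esum R Nfin by (simp add: ennreal_mult_less_top le_less_trans)
      finally show ?thesis .
    qed
    define b where "b m = (LINT \<xi>|lborel. g \<xi> *
        cnj (cis (- 2 * pi * ((M *v int_vec m) \<bullet> (T i *v \<xi>))) * u (T i *v \<xi>)))" for m
    define \<kappa> where "\<kappa> = a (fst i) powr (3/4)"
    have \<kappa>2: "\<kappa>\<^sup>2 = a (fst i) * sqrt (a (fst i))"
    proof -
      have "\<kappa>\<^sup>2 = a (fst i) powr (1 + 1/2)"
        unfolding \<kappa>_def power2_eq_square powr_add[symmetric] by simp
      also have "\<dots> = a (fst i) * sqrt (a (fst i))"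
        using a[of "fst i"] unfolding powr_add by (simp add: powr_half_sqrt)
      finally show ?thesis .
    qed
    have inner: "L2_inner f (shearlet_system a s c \<psi> (fst i, snd i, m)) = of_real \<kappa> * b m" for m
    proof -
      have "L2_inner f (shearlet_system a s c \<psi> (fst i, snd i, m)) = ip lborel g
          (\<lambda>\<xi>. (of_real \<kappa> * cis (- 2 * pi * ((M *v int_vec m) \<bullet> (T i *v \<xi>)))) * u (T i *v \<xi>))"
        unfolding L2_inner_eq_ip \<kappa>_def M_def T_def
        by (rule Parseval[OF ftf has_fourier_transform_shearlet[OF ft\<psi> a]])
      also have "\<dots> = of_real \<kappa> * b m"
        using ip_cmult_right[of lborel g "of_real \<kappa>"]
        by (simp add: b_def mult.assoc) (simp add: ip_def mult.assoc)
      finally show ?thesis .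
    qed
    have "S' i = (\<integral>\<^sup>+m. ennreal (\<kappa>\<^sup>2) * abs_sq (b m) \<partial>Z2)"
      unfolding S'_def inner by (simp add: norm_mult power_mult_distrib ennreal_mult)
    also have "\<dots> = ennreal (\<kappa>\<^sup>2) * (\<integral>\<^sup>+m. abs_sq (b m) \<partial>Z2)"
      by (rule nn_integral_cmult) simp
    finally have "ennreal d * S' i = ennreal (d * \<kappa>\<^sup>2) * (\<integral>\<^sup>+m. abs_sq (b m) \<partial>Z2)"
      using d by (simp add: ennreal_mult mult.assoc)
    also have "d * \<kappa>\<^sup>2 = \<bar>det (M ** T i)\<bar>"
      using a[of "fst i"] by (simp add: \<kappa>2 d_def M_def det_mul detT abs_mult)
    finally have dS: "ennreal d * S' i = ennreal \<bar>det (M ** T i)\<bar> * (\<integral>\<^sup>+m. abs_sq (b m) \<partial>Z2)" .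
    have sym: "(M *v x) \<bullet> y = (M *v y) \<bullet> x" for x y
      unfolding M_def by (rule inner_sampling_mat)
    note est = dilated_coefficients[OF gm um detT0 detM sym,
        of i, folded \<omega>_def D_def b_def, OF Dfin Efin[unfolded E'_def E_def]]
    show "ennreal d * S' i \<le> D i + E' i" "D i \<le> ennreal d * S' i + E' i"
      unfolding dS E'_def E_def by (rule est)+
  qed

  have Ssum: "ennreal d * S = (\<integral>\<^sup>+i. ennreal d * S' i \<partial>count_space I)"
    unfolding S_def nn_integral_shearlet_index S'_def I_def by (simp add: nn_integral_cmult)
  have "ennreal d * S \<le> (\<integral>\<^sup>+i. D i + E' i \<partial>count_space I)"
    unfolding Ssum by (intro nn_integral_mono) (simp add: single)
  also have "\<dots> = (\<integral>\<^sup>+i. D i \<partial>count_space I) + (\<integral>\<^sup>+i. E' i \<partial>count_space I)"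
    by (rule nn_integral_add) auto
  also have "\<dots> \<le> L_sup a K s \<psi> * N + R_sum a K s \<psi> c * N"
    by (intro add_mono Dle Esum)
  finally show "ennreal d * S \<le> L_sup a K s \<psi> * N + R_sum a K s \<psi> c * N" .

  fix l assume l: "AE \<xi> in cone_measure. l \<le> Phi a K s \<psi> \<xi> 0"
  have "l * N \<le> (\<integral>\<^sup>+i. D i \<partial>count_space I)"
    unfolding Dsum Ng nn_integral_sqnorm_const[OF gm, symmetric] by (rule nn_integral_cone_mono[OF supp l])
  also have "\<dots> \<le> (\<integral>\<^sup>+i. ennreal d * S' i + E' i \<partial>count_space I)"
    by (intro nn_integral_mono) (simp add: single)
  also have "\<dots> = ennreal d * S + (\<integral>\<^sup>+i. E' i \<partial>count_space I)"
    unfolding Ssum by (rule nn_integral_add) auto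
  also have "\<dots> \<le> ennreal d * S + R_sum a K s \<psi> c * N"
    by (intro add_left_mono Esum)
  finally show "l * N \<le> ennreal d * S + R_sum a K s \<psi> c * N" .
qed

text \<open>
  For a function that is not measurable the essential infimum is 0 by definition, so that the claim is trivial;
  for a measurable one, \<open>l\<close> is approached from below by a sequence, and countably many null sets are discarded.
\<close>

lemma AE_le_essinf:
  assumes "l \<le> essinf M h"
  shows "AE x in M. l \<le> h x"
proof (cases "h \<in> borel_measurable M")
  case True
  then have *: "l \<le> Liminf (ae_filter M) h" using assms by (simp add: essinf_def)
  show ?thesis
  proof (cases "l = 0")
    case False
    obtain y :: "nat \<Rightarrow> ennreal" where y: "\<And>n. y n < l" "y \<longlonglongrightarrow> l"
      using approx_from_below_dense_linorder[of 0 l] False by (auto simp: zero_less_iff_neq_zero)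
    have "AE x in M. \<forall>n. y n < h x"
      unfolding AE_all_countable using * y(1) unfolding le_Liminf_iff by auto
    then show ?thesis
      by eventually_elim (rule LIMSEQ_le_const2[OF y(2)], auto intro: less_imp_le)
  qed simp
qed (use assms in \<open>simp add: essinf_def\<close>)

text \<open>
  A single function of positive norm puts every lower bound below every upper bound, which makes the supremum
  of the former and the infimum of the latter finite. Both are again bounds, since the defining inequalities are
  closed conditions.
\<close>

lemma optimal_frame_bounds_exist:
  fixes \<phi> :: "'i \<Rightarrow> real^2 \<Rightarrow> complex"
  assumes f0: "f0 \<in> H" "L2_norm f0 > 0"
    and lower: "lower_frame_bound H I \<phi> A0" and upper: "upper_frame_bound H I \<phi> B0"
  shows "\<exists>A B. is_frame_with_optimal_bounds H I \<phi> A B \<and> A0 \<le> A \<and> A \<le> B \<and> B \<le> B0"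
proof -
  define n where "n f = (L2_norm f)\<^sup>2" for f
  define \<sigma> where "\<sigma> f = enn2real (\<Sum>\<^sub>\<infinity>i\<in>I. abs_sq (L2_inner f (\<phi> i)))" for f
  have \<sigma>: "(\<Sum>\<^sub>\<infinity>i\<in>I. abs_sq (L2_inner f (\<phi> i))) = ennreal (\<sigma> f)" if "f \<in> H" for f
  proof -
    have "(\<Sum>\<^sub>\<infinity>i\<in>I. abs_sq (L2_inner f (\<phi> i))) \<le> ennreal (B0 * n f)"
      using upper that by (simp add: upper_frame_bound_def n_def)
    then have "(\<Sum>\<^sub>\<infinity>i\<in>I. abs_sq (L2_inner f (\<phi> i))) < top"
      by (rule le_less_trans) simp
    then show ?thesis by (simp add: \<sigma>_def)
  qed
  have \<sigma>0: "\<sigma> f \<ge> 0" for f by (simp add: \<sigma>_def)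
  have n0: "n f \<ge> 0" for f by (simp add: n_def)
  have nf0: "n f0 > 0" using f0 by (simp add: n_def)
  have lb: "lower_frame_bound H I \<phi> A \<longleftrightarrow> 0 < A \<and> (\<forall>f\<in>H. A * n f \<le> \<sigma> f)" for A
    unfolding lower_frame_bound_def n_def[symmetric] using \<sigma> \<sigma>0 by auto
  have ub: "upper_frame_bound H I \<phi> B \<longleftrightarrow> 0 < B \<and> (\<forall>f\<in>H. \<sigma> f \<le> B * n f)" for B
    unfolding upper_frame_bound_def n_def[symmetric] using \<sigma> n0 by (auto simp: ennreal_le_iff)
  define As where "As = {A. lower_frame_bound H I \<phi> A}"
  define Bs where "Bs = {B. upper_frame_bound H I \<phi> B}"
  have AB: "A \<le> B" if "A \<in> As" "B \<in> Bs" for A B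
  proof -
    have "A * n f0 \<le> B * n f0" using that f0(1) by (force simp: As_def Bs_def lb ub)
    then show ?thesis using nf0 by simp
  qed
  have A0: "A0 \<in> As" and B0: "B0 \<in> Bs" using lower upper by (simp_all add: As_def Bs_def)
  have bddA: "bdd_above As" using AB B0 by (auto simp: bdd_above_def)
  have bddB: "bdd_below Bs" using AB A0 by (auto simp: bdd_below_def)
  define A where "A = Sup As"
  define B where "B = Inf Bs"
  have A0A: "A0 \<le> A" unfolding A_def by (rule cSup_upper[OF A0 bddA])
  have BB0: "B \<le> B0" unfolding B_def by (rule cInf_lower[OF B0 bddB])
  have "A \<le> B'" if "B' \<in> Bs" for B' unfolding A_def using A0 AB that by (intro cSup_least) auto
  then have AleB: "A \<le> B" unfolding B_def using B0 by (intro cInf_greatest) auto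
  have A0pos: "A0 > 0" using A0 by (simp add: As_def lb)
  have lowerA: "A * n f \<le> \<sigma> f" if f: "f \<in> H" for f
  proof (cases "n f = 0")
    case False
    then have nf: "n f > 0" using n0[of f] by simp
    have "A \<le> \<sigma> f / n f"
      unfolding A_def
    proof (rule cSup_least)
      fix A' assume "A' \<in> As"
      then have "A' * n f \<le> \<sigma> f" using f by (simp add: As_def lb)
      then show "A' \<le> \<sigma> f / n f" using nf by (simp add: pos_le_divide_eq)
    qed (use A0 in auto)
    then show ?thesis using nf by (simp add: pos_le_divide_eq)
  qed (simp add: \<sigma>0)
  have upperB: "\<sigma> f \<le> B * n f" if f: "f \<in> H" for f
  proof (cases "n f = 0")
    case True
    have "\<sigma> f \<le> B0 * n f" using B0 f by (simp add: Bs_def ub)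
    then show ?thesis using True by simp
  next
    case False
    then have nf: "n f > 0" using n0[of f] by simp
    have "\<sigma> f / n f \<le> B"
      unfolding B_def
    proof (rule cInf_greatest)
      fix B' assume "B' \<in> Bs"
      then have "\<sigma> f \<le> B' * n f" using f by (simp add: Bs_def ub)
      then show "\<sigma> f / n f \<le> B'" using nf by (simp add: pos_divide_le_eq)
    qed (use B0 in auto)
    then show ?thesis using nf by (simp add: pos_divide_le_eq)
  qed
  have "is_frame_with_optimal_bounds H I \<phi> A B"
    unfolding is_frame_with_optimal_bounds_def
  proof (intro conjI allI impI)
    show "lower_frame_bound H I \<phi> A" using lowerA A0A A0pos by (simp add: lb)
    show "upper_frame_bound H I \<phi> B" using upperB AleB A0A A0pos by (simp add: ub)
    show "A' \<le> A" if "lower_frame_bound H I \<phi> A'" for A'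
      unfolding A_def using that by (intro cSup_upper bddA) (simp add: As_def)
    show "B \<le> B'" if "upper_frame_bound H I \<phi> B'" for B'
      unfolding B_def using that by (intro cInf_lower bddB) (simp add: Bs_def)
  qed
  with A0A AleB BB0 show ?thesis by blast
qed

theorem theorem3p4:
  fixes \<Lambda> :: "(real \<times> real \<times> (real^2)) set"
    and a :: "nat \<Rightarrow> real" and K :: "nat \<Rightarrow> int set" and s :: "int \<Rightarrow> real" and c :: "real^2"
    and \<psi> :: "real^2 \<Rightarrow> complex"
    and Lt_inf Lt_sup :: real
  assumes "feasible_parameters \<Lambda> a K s c"
    and "feasible_shearlet \<psi>"
    and "enn2ereal (R_sum a K s \<psi> c) < ereal Lt_inf"
    and "ereal Lt_inf \<le> enn2ereal (L_inf a K s \<psi>)"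
    and "enn2ereal (L_sup a K s \<psi>) \<le> ereal Lt_sup"
  shows "\<exists>A B. is_frame_with_optimal_bounds L2_cone (shearlet_index K) (shearlet_system a s c \<psi>) A B \<and>
    1 / \<bar>det (sampling_mat c)\<bar> * (Lt_inf - enn2real (R_sum a K s \<psi> c)) \<le> A \<and>
    A \<le> B \<and>
    B \<le> 1 / \<bar>det (sampling_mat c)\<bar> * (Lt_sup + enn2real (R_sum a K s \<psi> c))"
proof -
  have a: "\<And>j. a j > 0" and c: "c$1 > 0" "c$2 > 0"
    using assms(1) by (simp_all add: feasible_parameters_def)
  have \<psi>: "\<psi> \<in> L2" using assms(2) by (simp add: feasible_shearlet_def)
  define d where "d = \<bar>det (sampling_mat c)\<bar>"
  have d: "d > 0" using c by (simp add: d_def det_mats)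
  define r where "r = enn2real (R_sum a K s \<psi> c)"
  have Rfin: "R_sum a K s \<psi> c < \<infinity>"
    using assms(3) by (cases "R_sum a K s \<psi> c") auto
  then have R: "R_sum a K s \<psi> c = ennreal r" and r0: "r \<ge> 0" by (simp_all add: r_def)
  have rL: "r < Lt_inf" using assms(3) r0 by (simp add: R enn2ereal_ennreal)
  have Lt0: "0 \<le> Lt_sup"
    using order_trans[OF enn2ereal_nonneg assms(5)] by simp
  have Lsup: "L_sup a K s \<psi> \<le> ennreal Lt_sup"
    using assms(5) Lt0 by (simp add: less_eq_ennreal.rep_eq enn2ereal_ennreal)
  have Linf: "ennreal Lt_inf \<le> L_inf a K s \<psi>"
    using assms(4) rL r0 by (simp add: less_eq_ennreal.rep_eq enn2ereal_ennreal)
  have AE: "AE \<xi> in cone_measure. ennreal Lt_inf \<le> Phi a K s \<psi> \<xi> 0"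
    using AE_le_essinf Linf unfolding L_inf_def by blast
  have Lfin: "L_sup a K s \<psi> < \<infinity>" using Lsup by (rule le_less_trans) simp
  define S where "S f = (\<Sum>\<^sub>\<infinity>i\<in>shearlet_index K. abs_sq (L2_inner f (shearlet_system a s c \<psi> i)))" for f
  note ineq = shearlet_frame_inequalities[OF a c \<psi> Rfin Lfin, folded S_def d_def]
  have N: "sqnorm lborel f = ennreal ((L2_norm f)\<^sup>2)" if "f \<in> L2_cone" for f
    using that by (simp add: L2_cone_def L2_norm_square)
  have up: "S f \<le> ennreal (1 / d * (Lt_sup + r) * (L2_norm f)\<^sup>2)" if f: "f \<in> L2_cone" for f
  proof -
    have "S f = ennreal (1 / d) * (ennreal d * S f)"
      using d by (simp add: mult.assoc[symmetric] flip: ennreal_mult)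
    also have "\<dots> \<le> ennreal (1 / d) * (ennreal Lt_sup * ennreal ((L2_norm f)\<^sup>2) + ennreal r * ennreal ((L2_norm f)\<^sup>2))"
    proof (rule mult_left_mono)
      have "ennreal d * S f \<le> L_sup a K s \<psi> * ennreal ((L2_norm f)\<^sup>2) + ennreal r * ennreal ((L2_norm f)\<^sup>2)"
        using ineq(1)[OF f] by (simp add: N[OF f] R)
      also have "\<dots> \<le> ennreal Lt_sup * ennreal ((L2_norm f)\<^sup>2) + ennreal r * ennreal ((L2_norm f)\<^sup>2)"
        by (intro add_right_mono mult_right_mono Lsup) simp
      finally show "ennreal d * S f \<le> ennreal Lt_sup * ennreal ((L2_norm f)\<^sup>2) + ennreal r * ennreal ((L2_norm f)\<^sup>2)" .
    qed simp
    also have "\<dots> = ennreal (1 / d * (Lt_sup * (L2_norm f)\<^sup>2 + r * (L2_norm f)\<^sup>2))"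
      using d Lt0 r0 by (simp only: ennreal_mult[symmetric] ennreal_plus[symmetric] zero_le_power2 mult_nonneg_nonneg
          add_nonneg_nonneg divide_nonneg_pos zero_le_one)
    finally show ?thesis by (simp add: distrib_right mult.assoc)
  qed
  have low: "ennreal (1 / d * (Lt_inf - r) * (L2_norm f)\<^sup>2) \<le> S f" if f: "f \<in> L2_cone" for f
  proof -
    have "S f < top" by (rule le_less_trans[OF up[OF f]]) simp
    then obtain \<sigma> where \<sigma>: "S f = ennreal \<sigma>" "\<sigma> \<ge> 0" by (cases "S f") auto
    have "ennreal (Lt_inf * (L2_norm f)\<^sup>2) \<le> ennreal (d * \<sigma> + r * (L2_norm f)\<^sup>2)"
      using ineq(2)[OF f AE] d r0 rL \<sigma>(2) by (simp add: N[OF f] R \<sigma>(1) ennreal_mult)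
    then have "Lt_inf * (L2_norm f)\<^sup>2 \<le> d * \<sigma> + r * (L2_norm f)\<^sup>2"
      by (rule ennreal_le_iff[THEN iffD1, rotated]) (use d \<sigma>(2) r0 in auto)
    then have "1 / d * (Lt_inf - r) * (L2_norm f)\<^sup>2 \<le> \<sigma>"
      using d by (simp add: field_simps)
    then show ?thesis unfolding \<sigma>(1) by (rule ennreal_leI)
  qed
  obtain f0 where f0: "f0 \<in> L2_cone" "0 < sqnorm lborel f0" using L2_cone_nontrivial by blast
  have n0: "L2_norm f0 > 0"
  proof -
    have "L2_norm f0 \<ge> 0" by (simp add: L2_norm_def)
    moreover have "L2_norm f0 \<noteq> 0" using f0(2) N[OF f0(1)] by auto
    ultimately show ?thesis by simp
  qed
  have A0: "0 < 1 / d * (Lt_inf - r)" using d rL by simp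
  have B0: "0 < 1 / d * (Lt_sup + r)"
  proof (rule ccontr)
    assume "\<not> ?thesis"
    then have "1 / d * (Lt_sup + r) \<le> 0" by linarith
    then have "1 / d * (Lt_sup + r) * (L2_norm f0)\<^sup>2 \<le> 0"
      by (rule mult_nonpos_nonneg) simp
    then have "S f0 \<le> 0" using up[OF f0(1)] by (simp add: ennreal_neg)
    then have "ennreal (1 / d * (Lt_inf - r) * (L2_norm f0)\<^sup>2) \<le> 0"
      using low[OF f0(1)] by (rule order_trans[rotated])
    then have "1 / d * (Lt_inf - r) * (L2_norm f0)\<^sup>2 \<le> 0" by (simp add: ennreal_eq_0_iff)
    moreover have "0 < 1 / d * (Lt_inf - r) * (L2_norm f0)\<^sup>2" by (rule mult_pos_pos[OF A0 zero_less_power[OF n0]])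
    ultimately show False by linarith
  qed
  have "lower_frame_bound L2_cone (shearlet_index K) (shearlet_system a s c \<psi>) (1 / d * (Lt_inf - r))"
    using A0 low unfolding lower_frame_bound_def S_def by blast
  moreover have "upper_frame_bound L2_cone (shearlet_index K) (shearlet_system a s c \<psi>) (1 / d * (Lt_sup + r))"
    using B0 up unfolding upper_frame_bound_def S_def by blast
  ultimately show ?thesis
    using optimal_frame_bounds_exist[OF f0(1) n0] unfolding d_def r_def by blast
qed

end
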